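(* Let $p_1=2,p_2=3,\ldots$ be the sequence of all primes, let $k\ge 0$ be an arbitrary integer and let $r\ge 1$ be an integer. Then $$\lim_{N\to\infty}\frac{\sum_{i=1}^{N}p_i^k\,\mathcal{S}(p_i)}{\sum_{i=1}^{N}p_i^k\,(p_i-1)^2}=S,\qquad\text{where } S=\prod_{i=1}^{\infty}\Bigl(1-\frac{p_i}{p_i^3-1}\Bigr),$$ and $$\lim_{N\to\infty}\frac{\sum_{i=1}^{N}p_i^k\,\mathcal{A}_r(p_i)}{\sum_{i=1}^{N}p_i^k\,(p_i-1)^r}=A_r,\qquad\text{where } A_r=\prod_{i=1}^{\infty}\Bigl(1-\frac{1}{p_i^{\,r}(p_i-1)}\Bigr).$$ Here $\mathcal{S}(p)$ and $\mathcal{A}_r(p)$ are the arithmetic functions of a prime $p$ defined in the context.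
   Context: For a prime $p$ with prime factorization $p-1=\prod_{j=1}^m q_j^{k_j}$ (distinct primes $q_j$, exponents $k_j\ge 1$; the empty product, equal to $1$, when $p=2$), define $$\mathcal{S}(p)=\sum_{d\mid p-1}d\,\phi(d)=\prod_{j=1}^m\frac{q_j^{2k_j+1}+1}{q_j+1},\qquad \mathcal{A}_r(p)=\prod_{j=1}^m\bigl(q_j^{rk_j}-q_j^{r(k_j-1)}\bigr),$$ where $\phi$ is Euler's totient function and $d$ runs over positive divisors. The constant $S$ is (the generic value of) Stephens' constant and $A_r$ is the generic value of the rank $r$ Artin constant. *)

theory Defs
  imports "HOL-Analysis.Infinite_Products" "HOL-Number_Theory.Totient" "HOL-Library.Infinite_Set"
begin

text \<open>The increasing enumeration of the primes, indexed from 0: the prime usually written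
  \<open>p\<^sub>i\<close> with \<open>i \<ge> 1\<close> is \<open>nth_prime (i - 1)\<close>, and sums over the first \<open>N\<close> primes range over
  \<open>i < N\<close>.\<close>

definition nth_prime :: "nat \<Rightarrow> nat" where
  "nth_prime = enumerate {p. prime p}"

lemma strict_mono_nth_prime: "strict_mono nth_prime"
  unfolding nth_prime_def by (rule strict_mono_enumerate) (rule primes_infinite)

lemma range_nth_prime: "range nth_prime = {p. prime p}"
  unfolding nth_prime_def by (rule range_enumerate) (rule primes_infinite)

definition stephens_fun :: "nat \<Rightarrow> nat" where
  "stephens_fun p = (\<Sum>d | d dvd p - 1. d * totient d)"

text \<open>For a prime factor \<open>q\<close> of \<open>p - 1\<close> the multiplicity is at least 1, so the subtraction of 1 in
  the exponent below does not truncate. For \<open>p = 2\<close> the product is empty.\<close>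

definition artin_fun :: "nat \<Rightarrow> nat \<Rightarrow> real" where
  "artin_fun r p =
     (\<Prod>q\<in>prime_factors (p - 1).
        real q ^ (r * multiplicity q (p - 1)) - real q ^ (r * (multiplicity q (p - 1) - 1)))"

definition stephens_factor :: "nat \<Rightarrow> real" where
  "stephens_factor p = 1 - real p / (real p ^ 3 - 1)"

definition artin_factor :: "nat \<Rightarrow> nat \<Rightarrow> real" where
  "artin_factor r p = 1 - 1 / (real p ^ r * (real p - 1))"

text \<open>An infinite product \<^const>\<open>prodinf\<close> is unspecified unless it converges, so statements
  about these constants should be accompanied by convergence of the products.\<close>

definition stephens_const :: real where
  "stephens_const = (\<Prod>i. stephens_factor (nth_prime i))"

definition artin_const :: "nat \<Rightarrow> real" where
  "artin_const r = (\<Prod>i. artin_factor r (nth_prime i))"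

end

theory Submission
  imports Defs "HOL-Complex_Analysis.Complex_Analysis" "HOL-Number_Theory.Number_Theory"
    "HOL-Computational_Algebra.Squarefree" "HOL-Real_Asymp.Real_Asymp"
begin

text \<open>Write \<open>F p\<close> for \<open>\<S>(p)/(p-1)\<^sup>2\<close> or \<open>\<A>\<^sub>r(p)/(p-1)\<^sup>r\<close>. In both cases \<open>F p\<close> is the product, over the primes
  \<open>q\<close> dividing \<open>p - 1\<close>, of factors \<open>h q v\<close> with \<open>v\<close> the multiplicity of \<open>q\<close> in \<open>p - 1\<close> and
  \<open>0 \<le> 1 - h q v \<le> 1/q\<close>. If only the primes \<open>q\<close> from a finite set are kept, the mean over \<open>p\<close> follows
  from the equidistribution of the primes in residue classes: the proportion of primes with
  \<open>d dvd p - 1\<close> is \<open>1/totient d\<close>. This rests on the non-vanishing of Dirichlet L-series on the line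
  \<open>Re s = 1\<close> and on Newman's contour argument, applied to \<open>\<Sum>n. mu n * \<xi> n / n powr s\<close>.

  Discarding the primes \<open>q > y\<close> changes \<open>F p\<close> by at most the sum of \<open>1/q\<close> over the prime factors
  \<open>q > y\<close> of \<open>p - 1\<close>. Its mean over \<open>p \<le> N\<close> is
  \<open>O(1/y) + o(1)\<close>: a sieve gives the uniform bound \<open>O(N/q + N / ln N)\<close> for the sum of \<open>mangoldt n\<close> over
  \<open>n \<le> N\<close> with \<open>[n = 1] (mod q)\<close>, and the trivial bound suffices for \<open>q > (ln N)\<^sup>2\<close>.\<close>

section \<open>Dirichlet characters\<close>

text \<open>Newman's argument needs bounded coefficients: \<open>mu n * \<xi> n\<close> has them,
  \<open>mangoldt n * \<xi> n\<close> does not, so the passage to \<open>mangoldt\<close> is left to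
  the hyperbola method. Equidistribution holds for each fixed modulus, without uniformity, whereas
  the prime factors of p - 1 range up to N. This forces the cut at y and a separate upper bound
  beyond it. A prime q divides p - 1 with frequency O(1/q) and its removal costs at most 1/q, so the
  discarded part behaves like the sum of 1/q^2 over q > y. The second sieve term N / ln N comes with
  the sum of 1/q, which is only O(ln ln N) over q \<le> (ln N)^2; further out, counting all integers
  congruent to 1 modulo q loses a factor ln N, and the sum of 1/q^2 over q > (ln N)^2 repays it. The
  weights p^k (p - 1)^r are handled through their quotient by ln p, which increases: partial
  summation carries bounds for sums of ln p over to the weighted sums, and a Chebyshev lower bound
  makes N times the last quotient comparable with the total weight.\<close>

definition dchar :: "nat \<Rightarrow> (nat \<Rightarrow> complex) \<Rightarrow> bool" where
  "dchar m \<xi> \<longleftrightarrow> (\<forall>a b. \<xi> (a * b) = \<xi> a * \<xi> b) \<and> (\<forall>a. \<xi> (a mod m) = \<xi> a) \<and> (\<forall>a. \<xi> a \<noteq> 0 \<longleftrightarrow> coprime a m)"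

definition principal_dchar :: "nat \<Rightarrow> nat \<Rightarrow> complex" where
  "principal_dchar m a = (if coprime a m then 1 else 0)"

lemma dcharD:
  assumes "dchar m \<xi>"
  shows "\<xi> (a * b) = \<xi> a * \<xi> b" "\<xi> (a mod m) = \<xi> a" "\<xi> a \<noteq> 0 \<longleftrightarrow> coprime a m"
  using assms by (auto simp: dchar_def)

lemma dchar_1: "dchar m \<xi> \<Longrightarrow> \<xi> (Suc 0) = 1"
  using dcharD(1)[of m \<xi> 1 1] dcharD(3)[of m \<xi> 1] by simp

lemma dchar_power: "dchar m \<xi> \<Longrightarrow> \<xi> (a ^ k) = \<xi> a ^ k"
  by (induction k) (auto simp: dcharD dchar_1)

lemma dchar_cong: "dchar m \<xi> \<Longrightarrow> [a = b] (mod m) \<Longrightarrow> \<xi> a = \<xi> b"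
  by (metis Cong.cong_def dcharD(2))

lemma dchar_root_unity:
  assumes "dchar m \<xi>" "coprime a m"
  shows "\<xi> a ^ totient m = 1"
  using dchar_cong[OF assms(1) euler_theorem[OF assms(2)]] dchar_power[OF assms(1)] dchar_1[OF assms(1)] by simp

lemma dchar_norm:
  assumes "m > 0" "dchar m \<xi>"
  shows "norm (\<xi> a) \<le> 1" "coprime a m \<Longrightarrow> norm (\<xi> a) = 1"
proof -
  show 1: "norm (\<xi> a) = 1" if "coprime a m"
    using power_eq_1_iff[OF dchar_root_unity[OF assms(2) that]] assms(1) by simp
  show "norm (\<xi> a) \<le> 1"
    using 1 dcharD(3)[OF assms(2), of a] by (cases "coprime a m") auto
qed

lemma dchar_principal: "m > 0 \<Longrightarrow> dchar m (principal_dchar m)"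
  by (auto simp: dchar_def principal_dchar_def coprime_mod_left_iff)

lemma dchar_mult: "dchar m \<xi> \<Longrightarrow> dchar m \<psi> \<Longrightarrow> dchar m (\<lambda>a. \<xi> a * \<psi> a)"
  by (auto simp: dchar_def)

text \<open>A character is determined by its values on the residues below m, and these lie in the
  finite set consisting of 0 and the roots of unity of order dividing
  \<open>totient m\<close>.\<close>

lemma finite_dchars:
  assumes "m > 0"
  shows "finite {\<xi>. dchar m \<xi>}"
proof -
  let ?R = "insert 0 {z::complex. z ^ totient m = 1}"
  have fin: "finite ?R"
    using assms by (intro finite.insertI finite_roots_unity) (simp add: Suc_leI)
  have "(\<lambda>\<xi>. restrict \<xi> {..<m}) ` {\<xi>. dchar m \<xi>} \<subseteq> PiE {..<m} (\<lambda>_. ?R)"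
  proof (intro subsetI, elim imageE)
    fix f \<xi> assume *: "f = restrict \<xi> {..<m}" "\<xi> \<in> {\<xi>. dchar m \<xi>}"
    have "\<xi> a \<in> ?R" for a
      using *(2) dchar_root_unity[of m \<xi> a] dcharD(3)[of m \<xi> a] by auto
    thus "f \<in> PiE {..<m} (\<lambda>_. ?R)" unfolding *(1) by (intro restrict_PiE_iff[THEN iffD2] ballI)
  qed
  moreover have "finite (PiE {..<m} (\<lambda>_. ?R))" using fin by (intro finite_PiE) auto
  ultimately have "finite ((\<lambda>\<xi>. restrict \<xi> {..<m}) ` {\<xi>. dchar m \<xi>})" by (rule finite_subset)
  moreover have "inj_on (\<lambda>\<xi>. restrict \<xi> {..<m}) {\<xi>. dchar m \<xi>}"
  proof (rule inj_onI)
    fix \<xi> \<psi> assume *: "\<xi> \<in> {\<xi>. dchar m \<xi>}" "\<psi> \<in> {\<xi>. dchar m \<xi>}" "restrict \<xi> {..<m} = restrict \<psi> {..<m}"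
    show "\<xi> = \<psi>"
    proof
      fix a
      have "\<xi> (a mod m) = \<psi> (a mod m)"
        using fun_cong[OF *(3), of "a mod m"] assms by simp
      thus "\<xi> a = \<psi> a" using *(1,2) dcharD(2)[of m \<xi> a] dcharD(2)[of m \<psi> a] by simp
    qed
  qed
  ultimately show ?thesis by (rule finite_imageD)
qed

text \<open>Multiplication by a unit b with \<xi>(b) different from 1 permutes the residues, so the
  sum equals \<xi>(b) times itself.\<close>

lemma sum_dchar_eq_0:
  assumes m: "m > 0" and \<xi>: "dchar m \<xi>" "\<xi> \<noteq> principal_dchar m"
  shows "(\<Sum>a<m. \<xi> a) = 0"
proof -
  obtain b where "\<xi> b \<noteq> principal_dchar m b" using \<xi>(2) by auto
  hence b: "coprime b m" "\<xi> b \<noteq> 1"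
    using dcharD(3)[OF \<xi>(1), of b] by (auto simp: principal_dchar_def split: if_splits)
  have inj: "inj_on (\<lambda>a. (b * a) mod m) {..<m}"
  proof (rule inj_onI)
    fix x y assume *: "x \<in> {..<m}" "y \<in> {..<m}" "b * x mod m = b * y mod m"
    hence "[x = y] (mod m)"
      using b(1) cong_mult_lcancel_nat[of b m x y] by (simp add: Cong.cong_def)
    thus "x = y" using * by (simp add: Cong.cong_def)
  qed
  moreover have "(\<lambda>a. (b * a) mod m) ` {..<m} \<subseteq> {..<m}" using m by auto
  ultimately have "bij_betw (\<lambda>a. (b * a) mod m) {..<m} {..<m}"
    using endo_inj_surj[of "{..<m}"] by (simp add: bij_betw_def)
  hence "(\<Sum>a<m. \<xi> a) = (\<Sum>a<m. \<xi> (b * a mod m))"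
    by (intro sum.reindex_bij_betw[symmetric])
  also have "\<dots> = \<xi> b * (\<Sum>a<m. \<xi> a)"
    by (simp add: dcharD[OF \<xi>(1)] sum_distrib_left)
  finally show ?thesis using b(2) by (simp add: algebra_simps)
qed

lemma sum_principal_dchar:
  assumes "m > 0"
  shows "(\<Sum>a<m. principal_dchar m a) = of_nat (totient m)"
proof -
  have "(\<Sum>a\<in>{0<..m}. principal_dchar m a) = (\<Sum>a\<in>totatives m. 1)"
    by (rule sum.mono_neutral_cong_right) (auto simp: principal_dchar_def totatives_def)
  hence 1: "(\<Sum>a\<in>{0<..m}. principal_dchar m a) = of_nat (totient m)" by (simp add: totient_def)
  obtain k where k: "m = Suc k" using assms by (cases m) auto
  have "{..<m} = insert 0 {0<..k}" "{0<..m} = insert m {0<..k}" using k by auto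
  moreover have "principal_dchar m 0 = principal_dchar m m" by (simp add: principal_dchar_def)
  ultimately show ?thesis using 1 k by simp
qed

text \<open>Complete periods cancel. This is what bounds the partial sums of a nonprincipal
  character.\<close>

lemma sum_periodic_mod:
  fixes f :: "nat \<Rightarrow> 'a :: comm_monoid_add"
  assumes per: "\<And>a. f (a mod m) = f a" and z: "(\<Sum>a<m. f a) = 0"
  shows "(\<Sum>a<N. f a) = (\<Sum>a<N mod m. f a)"
proof (cases "m = 0")
  case False
  show ?thesis
  proof (induction N rule: less_induct)
    case (less N)
    show ?case
    proof (cases "N < m")
      case False
      then obtain K where K: "N = m + K" by (metis le_Suc_ex not_less)
      have "(\<Sum>a<m + K. f a) = (\<Sum>a<m. f a) + (\<Sum>a<K. f (m + a))"
        by (induction K) (auto simp: add_ac)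
      also have "(\<Sum>a<K. f (m + a)) = (\<Sum>a<K. f a)"
        using per by (intro sum.cong refl) (metis mod_add_self1)
      also have "\<dots> = (\<Sum>a<K mod m. f a)" using less[of K] K \<open>m \<noteq> 0\<close> by simp
      finally show ?thesis using K z by simp
    qed simp
  qed
qed simp

lemma dchar_partial_sum_bound:
  assumes m: "m > 0" and \<xi>: "dchar m \<xi>" "\<xi> \<noteq> principal_dchar m"
  shows "norm (\<Sum>a<N. \<xi> a) \<le> m"
proof -
  have "(\<Sum>a<N. \<xi> a) = (\<Sum>a<N mod m. \<xi> a)"
    by (rule sum_periodic_mod) (use sum_dchar_eq_0[OF assms] dcharD(2)[OF \<xi>(1)] in auto)
  also have "norm \<dots> \<le> (\<Sum>a<N mod m. 1)"
    by (intro sum_norm_le dchar_norm[OF m \<xi>(1)])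
  also have "\<dots> \<le> m" using m by (simp add: less_imp_le)
  finally show ?thesis .
qed

text \<open>Averaging a function over the powers of g, twisted by a root of unity, produces an eigenfunction
  of translation by g; commuting translations make it possible to do this for all g successively.\<close>

definition twist :: "nat \<Rightarrow> complex \<Rightarrow> nat \<Rightarrow> (nat \<Rightarrow> complex) \<Rightarrow> nat \<Rightarrow> complex" where
  "twist n c g f u = (\<Sum>j<n. c ^ j * f (u * g ^ j))"

text \<open>This models complex functions on the unit group modulo m, extended by zero to all
  residues. The joint eigenfunctions of its translations are the multiples of the
  characters.\<close>

definition unit_fun :: "nat \<Rightarrow> (nat \<Rightarrow> complex) \<Rightarrow> bool" where
  "unit_fun m f \<longleftrightarrow> (\<forall>u. f (u mod m) = f u) \<and> (\<forall>u. \<not> coprime u m \<longrightarrow> f u = 0)"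

definition translation_eigen :: "(nat \<Rightarrow> complex) \<Rightarrow> nat \<Rightarrow> complex \<Rightarrow> bool" where
  "translation_eigen f g c \<longleftrightarrow> (\<forall>u. f (u * g) = c * f u)"

lemma unit_fun_cong: "unit_fun m f \<Longrightarrow> [a = b] (mod m) \<Longrightarrow> f a = f b"
  unfolding unit_fun_def Cong.cong_def by metis

lemma unit_fun_twist:
  assumes "unit_fun m f"
  shows "unit_fun m (twist n c g f)"
proof -
  have 1: "f (u mod m * g ^ j) = f (u * g ^ j)" for u j
    by (rule unit_fun_cong[OF assms]) (simp add: Cong.cong_def mod_mult_left_eq)
  have 2: "f (u * g ^ j) = 0" if "\<not> coprime u m" for u j
    using assms that unfolding unit_fun_def by simp
  show ?thesis unfolding unit_fun_def twist_def by (simp add: 1 2)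
qed

text \<open>Both c^j and the residue of u g^j are periodic in j with period
  \<open>totient m\<close>, so the sum is cyclic; shifting j by one produces the eigenvalue
  1/c.\<close>

lemma translation_eigen_twist:
  assumes f: "unit_fun m f" and g: "coprime g m" and c: "c ^ totient m = 1" "m > 0"
  shows "translation_eigen (twist (totient m) c g f) g (inverse c)"
  unfolding translation_eigen_def
proof
  fix u
  define n where "n = totient m"
  have c0: "c \<noteq> 0" using c by (auto simp: power_0_left split: if_splits)
  have n: "n > 0" using c by (simp add: n_def)
  have per: "f (u * g ^ n) = f u"
    by (rule unit_fun_cong[OF f]) (use cong_scalar_left[OF euler_theorem[OF g], of u] in \<open>simp add: n_def\<close>)
  have "twist n c g f (u * g) = (\<Sum>j<n. inverse c * (c ^ Suc j * f (u * g ^ Suc j)))"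
    unfolding twist_def using c0 by (intro sum.cong refl) (simp add: field_simps)
  also have "\<dots> = inverse c * (\<Sum>j<n. c ^ Suc j * f (u * g ^ Suc j))" by (simp add: sum_distrib_left)
  also have "(\<Sum>j<n. c ^ Suc j * f (u * g ^ Suc j)) = (\<Sum>j<n. c ^ j * f (u * g ^ j))"
  proof -
    have "(\<Sum>j<n. c ^ Suc j * f (u * g ^ Suc j) - c ^ j * f (u * g ^ j)) = c ^ n * f (u * g ^ n) - c ^ 0 * f (u * g ^ 0)"
      by (rule sum_lessThan_telescope)
    also have "\<dots> = 0" using c(1) per by (simp add: n_def)
    finally show ?thesis unfolding sum_subtractf by simp
  qed
  finally show "twist (totient m) c g f (u * g) = inverse c * twist (totient m) c g f u"
    by (simp add: twist_def n_def)
qed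

text \<open>Translations commute, so an eigenvalue obtained earlier survives later twists.\<close>

lemma translation_eigen_twist_other:
  assumes "translation_eigen f h d"
  shows "translation_eigen (twist n c g f) h d"
  unfolding translation_eigen_def
proof
  fix u
  have "f (u * h * g ^ j) = d * f (u * g ^ j)" for j
    using assms unfolding translation_eigen_def by (metis mult.assoc mult.commute)
  thus "twist n c g f (u * h) = d * twist n c g f u"
    by (simp add: twist_def sum_distrib_left mult_ac)
qed

lemma sum_roots_of_unity_power:
  assumes "j < n"
  shows "(\<Sum>k<n. (exp (2 * of_real pi * \<i> * of_nat k / of_nat n)) ^ j) = (if j = 0 then of_nat n else (0::complex))"
proof (cases "j = 0")
  case False
  define w where "w = exp (2 * of_real pi * \<i> * of_nat j / of_nat n)"
  have "w \<noteq> 1"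
    using complex_root_unity_eq_1[of n j] assms False by (auto simp: w_def dest: dvd_imp_le)
  have eq: "(exp (2 * of_real pi * \<i> * of_nat k / of_nat n)) ^ j = w ^ k" for k
    unfolding w_def exp_of_nat_mult[symmetric] by (simp add: mult_ac)
  have "w ^ n = 1" unfolding w_def exp_of_nat_mult[symmetric] using complex_root_unity[of n j] assms
    by (metis exp_of_nat_mult not_less_zero)
  thus ?thesis using \<open>w \<noteq> 1\<close> False unfolding eq by (simp add: geometric_sum)
qed auto

text \<open>Summing the twists at u over all roots of unity c leaves only the term j = 0, which is
  \<open>totient m\<close> times f u. Hence they cannot all vanish.\<close>

lemma exists_twist_nonzero:
  assumes m: "m > 0" and f: "f u \<noteq> 0"
  obtains c where "c ^ totient m = 1" "twist (totient m) c g f u \<noteq> 0"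
proof (rule ccontr)
  define n where "n = totient m"
  have n: "n > 0" using m by (simp add: n_def)
  define r where "r = (\<lambda>k. exp (2 * of_real pi * \<i> * of_nat k / of_nat n))"
  assume "\<not> thesis"
  hence z: "twist n (r k) g f u = 0" for k
    using that[of "r k"] complex_root_unity[of n k] n by (auto simp: n_def r_def)
  have "0 = (\<Sum>k<n. twist n (r k) g f u)" by (simp add: z)
  also have "\<dots> = (\<Sum>j<n. (\<Sum>k<n. r k ^ j) * f (u * g ^ j))"
    unfolding twist_def by (subst sum.swap) (simp add: sum_distrib_right)
  also have "\<dots> = (\<Sum>j<n. (if j = 0 then of_nat n else 0) * f (u * g ^ j))"
    by (intro sum.cong refl) (simp add: r_def sum_roots_of_unity_power)
  also have "\<dots> = (\<Sum>j\<in>{0}. of_nat n * f (u * g ^ j))"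
    using n by (intro sum.mono_neutral_cong_right) auto
  finally show False using f n by simp
qed

text \<open>The last clause retains the eigenvalues that f already has: in
  \<open>dchar_separates\<close> it protects the eigenvalue prescribed at x.\<close>

lemma exists_joint_eigenfunction:
  assumes m: "m > 0" and f: "unit_fun m f" "f u \<noteq> 0"
    and G: "finite G" "\<And>g. g \<in> G \<Longrightarrow> coprime g m"
  shows "\<exists>f' u. unit_fun m f' \<and> f' u \<noteq> 0 \<and> (\<forall>g\<in>G. \<exists>c. translation_eigen f' g c) \<and>
           (\<forall>h d. translation_eigen f h d \<longrightarrow> translation_eigen f' h d)"
  using G
proof (induction G rule: finite_induct)
  case empty
  thus ?case using f by auto
next
  case (insert g G)
  then obtain f' u where f': "unit_fun m f'" "f' u \<noteq> 0" "\<forall>g\<in>G. \<exists>c. translation_eigen f' g c"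
    "\<forall>h d. translation_eigen f h d \<longrightarrow> translation_eigen f' h d" by auto
  obtain c where c: "c ^ totient m = 1" "twist (totient m) c g f' u \<noteq> 0"
    using exists_twist_nonzero[OF m, of f' u g] f'(2) by blast
  have "translation_eigen (twist (totient m) c g f') g (inverse c)"
    using translation_eigen_twist[OF f'(1) _ c(1) m] insert.prems by auto
  hence "\<forall>h\<in>insert g G. \<exists>d. translation_eigen (twist (totient m) c g f') h d"
    using f'(3) translation_eigen_twist_other by blast
  moreover have "\<forall>h d. translation_eigen f h d \<longrightarrow> translation_eigen (twist (totient m) c g f') h d"
    using f'(4) translation_eigen_twist_other by blast
  ultimately show ?case
    using unit_fun_twist[OF f'(1), of "totient m" c g] c(2)
    by (intro exI[of _ "twist (totient m) c g f'"] exI[of _ u] conjI)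
qed

text \<open>In substance a character of the cyclic group generated by x is extended to all units. A
  nontrivial eigenvalue is prescribed at x, simultaneous diagonalisation yields a joint
  eigenfunction F, and its eigenvalues form the character.\<close>

lemma dchar_separates:
  assumes m: "m > 0" and x: "coprime x m" "\<not> [x = 1] (mod m)"
  obtains \<xi> where "dchar m \<xi>" "\<xi> x \<noteq> 1"
proof -
  define n where "n = totient m"
  define d where "d = ord m x"
  have d: "d > 0" "d dvd n" using x(1) m unfolding d_def n_def by (auto simp: ord_eq_0 coprime_commute order_divides_totient)
  have d1: "d \<noteq> 1" unfolding d_def using ord[of x m] x(2) by (metis power_one_right)
  \<comment> \<open>A primitive d-th root of unity, so that c^j = 1 whenever x^j is congruent to 1;
    it differs from 1 because d does.\<close>
  define c where "c = exp (2 * of_real pi * \<i> * of_nat 1 / of_nat d)"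
  have cd: "c ^ d = 1" unfolding c_def using complex_root_unity[of d 1] d by simp
  have c1: "c \<noteq> 1" unfolding c_def using complex_root_unity_eq_1[of d 1] d d1 by auto
  have cn: "c ^ totient m = 1" 
  proof -
    obtain k where "totient m = d * k" using d(2) unfolding n_def by (elim dvdE)
    thus ?thesis using cd by (simp add: power_mult)
  qed
  define f0 where "f0 = (\<lambda>u::nat. if [u = 1] (mod m) then 1 else 0 :: complex)"
  have f0: "unit_fun m f0"
    unfolding unit_fun_def
  proof (intro conjI allI impI)
    show "f0 (u mod m) = f0 u" for u by (simp add: f0_def Cong.cong_def)
    fix u assume "\<not> coprime u m"
    hence "\<not> [u = 1] (mod m)" using cong_imp_coprime[of 1 u m] by (metis coprime_1_left cong_sym)
    thus "f0 u = 0" by (simp add: f0_def)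
  qed
  define f where "f = twist n c x f0"
  have f: "unit_fun m f" unfolding f_def by (rule unit_fun_twist[OF f0])
  have fe: "translation_eigen f x (inverse c)"
    unfolding f_def n_def by (rule translation_eigen_twist[OF f0 x(1) cn m])
  \<comment> \<open>Only the j with x^j congruent to 1 contribute, and there d divides j, so c^j =
    1: the value is a positive count and f does not vanish.\<close>
  have "f 1 = (\<Sum>j<n. if [x ^ j = 1] (mod m) then 1 else 0)"
    unfolding f_def twist_def f0_def
  proof (intro sum.cong refl)
    fix j
    have "c ^ j = 1" if j: "[x ^ j = 1] (mod m)"
    proof -
      have "d dvd j" using j unfolding d_def by (simp only: ord_divides)
      then obtain k where "j = d * k" by (elim dvdE)
      thus ?thesis using cd by (simp add: power_mult)
    qed
    thus "c ^ j * (if [1 * x ^ j = 1] (mod m) then 1 else 0) = (if [x ^ j = 1] (mod m) then 1 else 0)"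
      by simp
  qed
  also have "\<dots> = of_nat (card {j\<in>{..<n}. [x ^ j = 1] (mod m)})"
    by (subst sum.inter_filter[symmetric]) auto
  also have "{j\<in>{..<n}. [x ^ j = 1] (mod m)} \<noteq> {}" using m by (auto simp: n_def intro!: exI[of _ 0])
  hence "of_nat (card {j\<in>{..<n}. [x ^ j = 1] (mod m)}) \<noteq> (0::complex)" by (simp del: Collect_empty_eq)
  finally have f1: "f 1 \<noteq> 0" .
  define G where "G = {g. g < m \<and> coprime g m}"
  have "finite G" "\<And>g. g \<in> G \<Longrightarrow> coprime g m" by (auto simp: G_def)
  from exists_joint_eigenfunction[OF m f f1 this]
  obtain F u where F: "unit_fun m F" "F u \<noteq> 0" "\<forall>g\<in>G. \<exists>c. translation_eigen F g c"
    "\<forall>h d. translation_eigen f h d \<longrightarrow> translation_eigen F h d" by blast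
  have Fx: "translation_eigen F x (inverse c)" using F(4) fe by blast
  have ev: "\<exists>c. translation_eigen F g c" if "coprime g m" for g
  proof -
    have "coprime (g mod m) m" "g mod m < m" using that m by (auto simp: coprime_mod_left_iff)
    then obtain c where c: "translation_eigen F (g mod m) c" using F(3) unfolding G_def by blast
    have "F (u * g) = F (u * (g mod m))" for u
      by (rule unit_fun_cong[OF F(1)]) (simp add: Cong.cong_def mod_mult_right_eq)
    thus ?thesis using c by (auto simp: translation_eigen_def)
  qed
  \<comment> \<open>The eigenvalue of translation by g, read off at a point where F is nonzero. For
    non-units the same formula gives 0.\<close>
  define \<xi> where "\<xi> = (\<lambda>g. F (u * g) / F u)"
  have *: "F (v * g) = \<xi> g * F v" if "coprime g m" for v g
    using ev[OF that] F(2) unfolding translation_eigen_def \<xi>_def by auto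
  have z: "\<xi> g = 0" if "\<not> coprime g m" for g
    using that F(1) by (auto simp: \<xi>_def unit_fun_def)
  have "dchar m \<xi>"
    unfolding dchar_def
  proof (intro conjI allI)
    fix a b
    show "\<xi> (a * b) = \<xi> a * \<xi> b"
    proof (cases "coprime a m \<and> coprime b m")
      case True
      have "F (u * (a * b)) = \<xi> b * (\<xi> a * F u)"
        using *[of b "u * a"] *[of a u] True by (simp add: mult_ac)
      thus ?thesis using F(2) by (simp add: \<xi>_def)
    next
      case False
      hence "\<not> coprime (a * b) m" by simp
      thus ?thesis using False z by auto
    qed
    show "\<xi> (a mod m) = \<xi> a"
      unfolding \<xi>_def using unit_fun_cong[OF F(1), of "u * (a mod m)" "u * a"] by (simp add: Cong.cong_def mod_mult_right_eq)
    \<comment> \<open>An eigenvalue 0 would force F to vanish at u a^n, which is congruent to u by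
      Euler's theorem.\<close>
    have "\<xi> a \<noteq> 0" if a: "coprime a m"
    proof
      assume "\<xi> a = 0"
      have "F (u * a ^ Suc k) = 0" for k
        using *[OF a, of "u * a ^ k"] \<open>\<xi> a = 0\<close> by (simp add: mult_ac)
      from this[of "n - 1"] have "F (u * a ^ n) = 0" using m by (simp add: n_def)
      moreover have "F (u * a ^ n) = F u"
        by (rule unit_fun_cong[OF F(1)]) (use cong_scalar_left[OF euler_theorem[OF a], of u] in \<open>simp add: n_def\<close>)
      ultimately show False using F(2) by simp
    qed
    thus "(\<xi> a \<noteq> 0) = coprime a m" using z by blast
  qed
  moreover have "\<xi> x \<noteq> 1"
    using F(2) Fx c1 unfolding \<xi>_def translation_eigen_def by auto
  ultimately show ?thesis by (rule that)
qed

text \<open>Away from the class of 1, multiplication by a character \<psi> with \<psi>(a) different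
  from 1 permutes all characters and multiplies the sum by \<psi>(a). At 1 the value comes from
  summing over characters and residues in both orders: one order keeps only the principal character,
  the other only the residue 1.\<close>

theorem sum_dchars:
  assumes m: "m > 0"
  shows "(\<Sum>\<xi> | dchar m \<xi>. \<xi> a) = (if [a = 1] (mod m) then of_nat (totient m) else 0)"
proof -
  have vanish: "(\<Sum>\<xi> | dchar m \<xi>. \<xi> a) = 0" if "\<not> [a = 1] (mod m)" for a
  proof (cases "coprime a m")
    case False
    thus ?thesis using dcharD(3) by (intro sum.neutral) auto
  next
    case True
    obtain \<psi> where \<psi>: "dchar m \<psi>" "\<psi> a \<noteq> 1" using dchar_separates[OF m True \<open>\<not> [a = 1] (mod m)\<close>] .
    \<comment> \<open>All characters have the same zeros, so multiplication by \<psi> can be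
      cancelled.\<close>
    have nz: "\<psi> b = 0 \<Longrightarrow> \<xi> b = 0" if "dchar m \<xi>" for \<xi> b
      using dcharD(3)[OF \<psi>(1), of b] dcharD(3)[OF that, of b] by auto
    have inj: "inj_on (\<lambda>\<xi> b. \<psi> b * \<xi> b) {\<xi>. dchar m \<xi>}"
    proof (rule inj_onI)
      fix \<xi>1 \<xi>2 assume *: "\<xi>1 \<in> {\<xi>. dchar m \<xi>}" "\<xi>2 \<in> {\<xi>. dchar m \<xi>}" "(\<lambda>b. \<psi> b * \<xi>1 b) = (\<lambda>b. \<psi> b * \<xi>2 b)"
      show "\<xi>1 = \<xi>2"
      proof
        fix b show "\<xi>1 b = \<xi>2 b"
          using fun_cong[OF *(3), of b] nz[of \<xi>1 b] nz[of \<xi>2 b] *(1,2) by (cases "\<psi> b = 0") auto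
      qed
    qed
    moreover have "(\<lambda>\<xi> b. \<psi> b * \<xi> b) ` {\<xi>. dchar m \<xi>} \<subseteq> {\<xi>. dchar m \<xi>}"
      using dchar_mult[OF \<psi>(1)] by auto
    ultimately have "bij_betw (\<lambda>\<xi> b. \<psi> b * \<xi> b) {\<xi>. dchar m \<xi>} {\<xi>. dchar m \<xi>}"
      using endo_inj_surj[OF finite_dchars[OF m]] by (simp add: bij_betw_def)
    hence "(\<Sum>\<xi> | dchar m \<xi>. \<xi> a) = (\<Sum>\<xi> | dchar m \<xi>. \<psi> a * \<xi> a)"
      by (intro sum.reindex_bij_betw[symmetric])
    also have "\<dots> = \<psi> a * (\<Sum>\<xi> | dchar m \<xi>. \<xi> a)" by (simp add: sum_distrib_left)
    finally show ?thesis using \<psi>(2) by (simp add: algebra_simps)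
  qed
  have "(\<Sum>\<xi> | dchar m \<xi>. \<xi> 1) = of_nat (totient m)"
  proof -
    have "(\<Sum>\<xi> | dchar m \<xi>. \<Sum>b<m. \<xi> b) = (\<Sum>\<xi>\<in>{principal_dchar m}. of_nat (totient m))"
      using m sum_dchar_eq_0[OF m] sum_principal_dchar[OF m] dchar_principal[OF m]
      by (intro sum.mono_neutral_cong_right finite_dchars) auto
    moreover have "(\<Sum>\<xi> | dchar m \<xi>. \<Sum>b<m. \<xi> b) = (\<Sum>b<m. \<Sum>\<xi> | dchar m \<xi>. \<xi> b)"
      by (rule sum.swap)
    moreover have "\<dots> = (\<Sum>b\<in>{1 mod m}. \<Sum>\<xi> | dchar m \<xi>. \<xi> b)"
      using m vanish by (intro sum.mono_neutral_right) (auto simp: Cong.cong_def)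
    moreover have "\<dots> = (\<Sum>\<xi> | dchar m \<xi>. \<xi> (1 mod m))" by simp
    moreover have "\<dots> = (\<Sum>\<xi> | dchar m \<xi>. \<xi> 1)"
      by (intro sum.cong refl dcharD(2)) simp
    ultimately show ?thesis by simp
  qed
  moreover have "(\<Sum>\<xi> | dchar m \<xi>. \<xi> a) = (\<Sum>\<xi> | dchar m \<xi>. \<xi> 1)" if "[a = 1] (mod m)"
    using dchar_cong[OF _ that] by (intro sum.cong) auto
  ultimately show ?thesis using vanish by auto
qed

section \<open>Dirichlet convolution\<close>

text \<open>Factor pairs, unlike a sum over divisors d with n div d, make commutativity and
  associativity mere reindexings. For n = 0 the set is infinite, so sums over it take the default
  value 0.\<close>

definition divpairs :: "nat \<Rightarrow> (nat \<times> nat) set" where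
  "divpairs n = {p. fst p * snd p = n}"

definition dconv :: "(nat \<Rightarrow> 'a) \<Rightarrow> (nat \<Rightarrow> 'a) \<Rightarrow> nat \<Rightarrow> 'a :: comm_ring_1" where
  "dconv f g n = (\<Sum>p\<in>divpairs n. f (fst p) * g (snd p))"

lemma finite_divpairs: "n > 0 \<Longrightarrow> finite (divpairs n)"
  by (rule finite_subset[of _ "{..n} \<times> {..n}"]) (auto simp: divpairs_def)

lemma dconv_divisors:
  assumes "n > 0"
  shows "dconv f g n = (\<Sum>d | d dvd n. f d * g (n div d))"
  unfolding dconv_def
  by (rule sum.reindex_bij_witness[where i="\<lambda>d. (d, n div d)" and j=fst]) (use assms in \<open>auto simp: divpairs_def\<close>)

lemma dconv_commute: "dconv f g n = dconv g f n"
  unfolding dconv_def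
  by (rule sum.reindex_bij_witness[where i="\<lambda>(d, e). (e, d)" and j="\<lambda>(d, e). (e, d)"]) (auto simp: mult.commute divpairs_def)

lemma dconv_cong:
  assumes "n > 0" "\<And>d. d > 0 \<Longrightarrow> f d = f' d" "\<And>d. d > 0 \<Longrightarrow> g d = g' d"
  shows "dconv f g n = dconv f' g' n"
  unfolding dconv_def by (rule sum.cong) (use assms in \<open>auto simp: divpairs_def\<close>)

text \<open>Both sides run over the factorisations of n into three factors; the bijection regroups
  the nested pair.\<close>

lemma dconv_assoc:
  assumes n: "n > 0"
  shows "dconv (dconv f g) h n = dconv f (dconv g h) n"
proof -
  have pos: "\<forall>p\<in>divpairs n. fst p > 0 \<and> snd p > 0" using n by (auto simp: divpairs_def intro: Nat.gr0I)
  have "dconv (dconv f g) h n = (\<Sum>p\<in>divpairs n. \<Sum>q\<in>divpairs (fst p). f (fst q) * g (snd q) * h (snd p))"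
    by (simp add: dconv_def sum_distrib_right)
  also have "\<dots> = (\<Sum>x\<in>(SIGMA p:divpairs n. divpairs (fst p)). f (fst (snd x)) * g (snd (snd x)) * h (snd (fst x)))"
    using n pos by (subst sum.Sigma) (auto simp: finite_divpairs case_prod_unfold)
  also have "\<dots> = (\<Sum>x\<in>(SIGMA p:divpairs n. divpairs (snd p)). f (fst (fst x)) * (g (fst (snd x)) * h (snd (snd x))))"
    by (rule sum.reindex_bij_witness[where j="\<lambda>((k, e), (a, b)). ((a, b * e), (b, e))"
           and i="\<lambda>((a, l), (b, e)). ((a * b, e), (a, b))"]) (auto simp: mult_ac divpairs_def)
  also have "\<dots> = (\<Sum>p\<in>divpairs n. \<Sum>q\<in>divpairs (snd p). f (fst p) * (g (fst q) * h (snd q)))"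
    using n pos by (subst sum.Sigma) (auto simp: finite_divpairs case_prod_unfold)
  also have "\<dots> = dconv f (dconv g h) n"
    by (simp add: dconv_def sum_distrib_left)
  finally show ?thesis .
qed

lemma dconv_unit:
  assumes "n > 0"
  shows "dconv (\<lambda>k. if k = 1 then 1 else 0) f n = f n"
proof -
  have "dconv (\<lambda>k. if k = 1 then 1 else 0) f n = (\<Sum>d\<in>{1::nat}. f n)"
    unfolding dconv_divisors[OF assms] by (rule sum.mono_neutral_cong_right) (use assms in auto)
  thus ?thesis by simp
qed

text \<open>This reduces identities twisted by a character or by a power n^(-s) to the untwisted
  ones.\<close>

lemma dconv_mult_completely:
  assumes "\<And>a b. c (a * b) = c a * c b"
  shows "dconv (\<lambda>n. c n * f n) (\<lambda>n. c n * g n) n = c n * dconv f g n"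
  unfolding dconv_def sum_distrib_left by (rule sum.cong) (auto simp: assms mult_ac divpairs_def)

lemma dconv_of_real: "dconv (\<lambda>n. of_real (f n)) (\<lambda>n. of_real (g n)) n = (of_real (dconv f g n) :: 'a :: {comm_ring_1, real_algebra_1})"
  unfolding dconv_def by simp

lemma dconv_add_right: "dconv f (\<lambda>n. g n + h n) n = dconv f g n + dconv f h n"
  unfolding dconv_def by (simp add: algebra_simps sum.distrib)

text \<open>Since ln turns products into sums, pointwise multiplication by it is a derivation of the
  convolution ring. This is the source of Selberg's identity in
  \<open>dconv_mu_ln_squared\<close>.\<close>

lemma dconv_ln_derivation:
  fixes f g :: "nat \<Rightarrow> real"
  assumes "n > 0"
  shows "ln n * dconv f g n = dconv (\<lambda>n. ln n * f n) g n + dconv f (\<lambda>n. ln n * g n) n"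
proof -
  have "ln (real n) * dconv f g n = (\<Sum>p\<in>divpairs n. ln (fst p) * f (fst p) * g (snd p) + f (fst p) * (ln (snd p) * g (snd p)))"
    unfolding dconv_def sum_distrib_left
  proof (rule sum.cong, goal_cases)
    case (2 x)
    hence "ln (real n) = ln (real (fst x)) + ln (real (snd x))"
      using assms by (auto simp: ln_mult divpairs_def)
    thus ?case by (simp add: algebra_simps)
  qed simp
  thus ?thesis by (simp add: dconv_def sum.distrib)
qed

section \<open>The Moebius function and the identities of von Mangoldt and Selberg\<close>

definition mu :: "nat \<Rightarrow> real" where
  "mu n = (if squarefree n then (-1) ^ card (prime_factors n) else 0)"

lemma mu_1 [simp]: "mu (Suc 0) = 1"
  by (simp add: mu_def)

lemma abs_mu_le: "\<bar>mu n\<bar> \<le> 1"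
  by (simp add: mu_def power_abs)

lemma mu_prime_mult:
  assumes "prime (q::nat)"
  shows "mu (q * d) = (if q dvd d then 0 else - mu d)"
proof (cases "q dvd d")
  case True
  hence "q ^ 2 dvd q * d" by (simp add: power2_eq_square)
  moreover have "\<not> q dvd 1" using prime_gt_1_nat[OF assms] by simp
  ultimately have "\<not> squarefree (q * d)" using squarefreeD[of "q * d" q] by iprover
  thus ?thesis using True by (simp add: mu_def)
next
  case False
  hence cop: "coprime q d" using assms by (simp add: prime_imp_coprime)
  have d: "d > 0" using False by (auto intro: Nat.gr0I)
  have "squarefree (q * d) \<longleftrightarrow> squarefree d"
    using squarefree_mult_coprime[OF cop squarefree_prime[OF assms]] squarefree_multD(2)[of q d] by iprover
  moreover have "prime_factors (q * d) = insert q (prime_factors d)"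
    using assms d by (auto simp: prime_factors_product prime_prime_factors)
  moreover have "q \<notin> prime_factors d" using False by auto
  ultimately show ?thesis using False by (simp add: mu_def)
qed

text \<open>For a prime p dividing n, the squarefree divisors come in pairs d, p d with p not
  dividing d, and \<open>mu\<close> takes opposite values on each pair.\<close>

lemma dconv_mu_1:
  assumes "n > 0"
  shows "dconv mu (\<lambda>_. 1) n = (if n = 1 then 1 else 0)"
proof (cases "n = 1")
  case True
  thus ?thesis by (simp add: dconv_divisors)
next
  case False
  then obtain p where p: "prime p" "p dvd n" using prime_factor_nat by blast
  define A where "A = {d. d dvd n \<and> squarefree d \<and> \<not> p dvd d}"
  have fin: "finite {d. d dvd n}" using assms by simp
  have finA: "finite A" by (rule finite_subset[OF _ fin]) (auto simp: A_def)
  have "dconv mu (\<lambda>_. 1) n = (\<Sum>d | d dvd n. mu d)"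
    using dconv_divisors[OF assms, of mu "\<lambda>_. 1"] by simp
  also have "\<dots> = (\<Sum>d\<in>A \<union> (\<lambda>d. p * d) ` A. mu d)"
  proof (rule sum.mono_neutral_right[OF fin])
    show "A \<union> (*) p ` A \<subseteq> {d. d dvd n}"
      using p by (auto simp: A_def intro!: divides_mult prime_imp_coprime)
    show "\<forall>d\<in>{d. d dvd n} - (A \<union> (*) p ` A). mu d = 0"
    proof
      fix d assume d: "d \<in> {d. d dvd n} - (A \<union> (*) p ` A)"
      show "mu d = 0"
      proof (cases "p dvd d")
        case False
        thus ?thesis using d by (auto simp: A_def mu_def)
      next
        case True
        then obtain e where e: "d = p * e" by (elim dvdE)
        show ?thesis
        proof (cases "p dvd e")
          case True
          thus ?thesis using mu_prime_mult[OF p(1), of e] e by simp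
        next
          case False
          have "e dvd n" using d e by (auto elim: dvd_mult_right)
          hence "\<not> squarefree e" using d e False by (auto simp: A_def)
          thus ?thesis using mu_prime_mult[OF p(1), of e] e False by (simp add: mu_def)
        qed
      qed
    qed
  qed
  also have "\<dots> = (\<Sum>d\<in>A. mu d) + (\<Sum>d\<in>(\<lambda>d. p * d) ` A. mu d)"
    using finA by (intro sum.union_disjoint) (auto simp: A_def)
  also have "(\<Sum>d\<in>(\<lambda>d. p * d) ` A. mu d) = (\<Sum>d\<in>A. mu (p * d))"
    using p(1) by (subst sum.reindex) (auto simp: inj_on_def)
  also have "\<dots> = (\<Sum>d\<in>A. - mu d)"
    by (intro sum.cong refl) (use mu_prime_mult[OF p(1)] in \<open>auto simp: A_def\<close>)
  finally show ?thesis using False by (simp add: sum_negf)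
qed

lemma dconv_mangoldt_1:
  assumes "n > 0"
  shows "dconv mangoldt (\<lambda>_. 1) n = ln (real n)"
  using mangoldt_sum[of n, where 'a=real] assms by (simp add: dconv_divisors)

lemma moebius_inversion:
  assumes n: "n > 0" and "\<And>k. k > 0 \<Longrightarrow> dconv f (\<lambda>_. 1) k = g k"
  shows "dconv mu g n = f n"
proof -
  have "dconv mu g n = dconv mu (dconv (\<lambda>_. 1) f) n"
    using assms by (intro dconv_cong) (auto simp: dconv_commute)
  also have "\<dots> = dconv (dconv mu (\<lambda>_. 1)) f n" by (rule dconv_assoc[OF n, symmetric])
  also have "\<dots> = dconv (\<lambda>k. if k = 1 then 1 else 0) f n"
    by (intro dconv_cong n dconv_mu_1) auto
  finally show ?thesis using n by (simp only: dconv_unit)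
qed

lemma dconv_mu_ln:
  assumes "n > 0"
  shows "dconv mu (\<lambda>n. ln (real n)) n = mangoldt n"
  using assms dconv_mangoldt_1 by (rule moebius_inversion)

text \<open>Selberg's identity. One factor of ln^2 is written as \<open>mangoldt\<close> convolved
  with 1, the derivation rule is applied to it, and the remaining ln is replaced in the same way
  before Moebius inversion.\<close>

lemma dconv_mu_ln_squared:
  assumes "n > 0"
  shows "dconv mu (\<lambda>n. (ln (real n))\<^sup>2) n = ln n * mangoldt n + dconv mangoldt mangoldt n"
proof (rule moebius_inversion[OF assms])
  fix k :: nat assume k: "k > 0"
  have "(ln (real k))\<^sup>2 = ln k * dconv mangoldt (\<lambda>_. 1) k"
    using k by (simp add: dconv_mangoldt_1 power2_eq_square)
  also have "\<dots> = dconv (\<lambda>n. ln n * mangoldt n) (\<lambda>_. 1) k + dconv mangoldt (\<lambda>n. ln n) k"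
    using dconv_ln_derivation[OF k, of mangoldt "\<lambda>_. 1"] by simp
  also have "dconv mangoldt (\<lambda>n. ln (real n)) k = dconv mangoldt (dconv mangoldt (\<lambda>_. 1)) k"
    by (intro dconv_cong k) (auto simp: dconv_mangoldt_1)
  also have "\<dots> = dconv (dconv mangoldt mangoldt) (\<lambda>_. 1) k" by (rule dconv_assoc[OF k, symmetric])
  finally show "dconv (\<lambda>n. ln n * mangoldt n + dconv mangoldt mangoldt n) (\<lambda>_. 1) k = (ln (real k))\<^sup>2"
    by (subst dconv_commute, subst dconv_add_right) (simp add: dconv_commute)
qed

section \<open>Products of absolutely convergent series\<close>

lemma has_sum_positive_nat:
  fixes A :: "nat \<Rightarrow> complex"
  assumes "summable (\<lambda>n. norm (A (Suc n)))"
  shows "(A has_sum (\<Sum>n. A (Suc n))) {0<..}" "(\<lambda>n. norm (A n)) summable_on {0<..}"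
proof -
  have bij: "bij_betw Suc UNIV {0<..}"
    by (rule bij_betwI[where g="\<lambda>n. n - 1"]) auto
  have "((\<lambda>n. A (Suc n)) has_sum (\<Sum>n. A (Suc n))) UNIV"
    using assms by (intro norm_summable_imp_has_sum summable_sums summable_norm_cancel[OF assms]) auto
  thus "(A has_sum (\<Sum>n. A (Suc n))) {0<..}" by (simp add: has_sum_reindex_bij_betw[OF bij])
  have "(\<lambda>n. norm (A (Suc n))) summable_on UNIV"
    using assms by (intro norm_summable_imp_summable_on) auto
  thus "(\<lambda>n. norm (A n)) summable_on {0<..}"
    using summable_on_reindex_bij_betw[OF bij, of "\<lambda>n. norm (A n)"] by simp
qed

text \<open>The double series converges absolutely on pairs of positive integers, so its terms may
  be regrouped according to the product of the two indices.\<close>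

lemma sums_dconv:
  fixes A B :: "nat \<Rightarrow> complex"
  assumes A: "summable (\<lambda>n. norm (A (Suc n)))" and B: "summable (\<lambda>n. norm (B (Suc n)))"
  shows "(\<lambda>n. dconv A B (Suc n)) sums ((\<Sum>n. A (Suc n)) * (\<Sum>n. B (Suc n)))"
proof -
  define SA where "SA = (\<Sum>n. A (Suc n))"
  define SB where "SB = (\<Sum>n. B (Suc n))"
  note a = has_sum_positive_nat[OF A, folded SA_def] and b = has_sum_positive_nat[OF B, folded SB_def]
  have bij: "bij_betw (\<lambda>(d, e). (d * e, (d, e))) ({0<..} \<times> {0<..}) (SIGMA n:{0<..}. divpairs n)"
    by (rule bij_betwI[where g=snd]) (auto simp: divpairs_def intro: Nat.gr0I)
  have "((\<lambda>(d, e). A d * B e) has_sum SA * SB) ({0<..} \<times> {0<..})"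
  proof (rule has_sum_SigmaI)
    show "((\<lambda>y. case (x, y) of (d, e) \<Rightarrow> A d * B e) has_sum A x * SB) {0<..}" for x
      using has_sum_cmult_right[OF b(1), of "A x"] by simp
    show "((\<lambda>x. A x * SB) has_sum SA * SB) {0<..}" by (rule has_sum_cmult_left[OF a(1)])
    have "(\<lambda>x. norm ((\<lambda>(d, e). A d * B e) x)) summable_on ({0<..} \<times> {0<..})"
      unfolding Infinite_Sum.abs_summable_on_Sigma_iff
      using a(2) b(2) by (auto simp: norm_mult infsum_cmult_right' abs_mult infsum_nonneg intro!: summable_on_cmult_right summable_on_cmult_left)
    thus "(\<lambda>(d, e). A d * B e) summable_on ({0<..} \<times> {0<..})" by (rule abs_summable_summable)
  qed
  hence "((\<lambda>(n, (d, e)). A d * B e) has_sum SA * SB) (SIGMA n:{0<..}. divpairs n)"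
    by (subst has_sum_reindex_bij_betw[OF bij, symmetric]) (simp add: case_prod_unfold)
  hence "(dconv A B has_sum SA * SB) {0<..}"
  proof (rule has_sum_SigmaD)
    fix n :: nat assume n: "n \<in> {0<..}"
    show "((\<lambda>y. case (n, y) of (n, (d, e)) \<Rightarrow> A d * B e) has_sum dconv A B n) (divpairs n)"
      unfolding dconv_def using has_sum_finite[OF finite_divpairs[of n], of "\<lambda>p. A (fst p) * B (snd p)"] n by (simp add: case_prod_unfold)
  qed
  moreover have bij2: "bij_betw Suc UNIV {0<..}"
    by (rule bij_betwI[where g="\<lambda>n. n - 1"]) auto
  ultimately have "((\<lambda>n. dconv A B (Suc n)) has_sum SA * SB) UNIV"
    by (simp add: has_sum_reindex_bij_betw[OF bij2])
  thus ?thesis unfolding SA_def SB_def by (rule has_sum_imp_sums)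
qed

section \<open>Dirichlet series\<close>

definition dser :: "(nat \<Rightarrow> complex) \<Rightarrow> complex \<Rightarrow> complex" where
  "dser a s = (\<Sum>n. a (Suc n) * of_nat (Suc n) powr (-s))"

lemma norm_nat_powr: "norm (of_nat (Suc n) powr (s::complex)) = real (Suc n) powr Re s"
  by (subst norm_powr_real_powr) (auto simp del: of_nat_Suc)

lemma nat_powr_add: "of_nat (Suc n) powr (a + b :: complex) = of_nat (Suc n) powr a * of_nat (Suc n) powr b"
  by (simp add: powr_add)

lemma nat_powr_mult: "of_nat (a * b) powr (s :: complex) = of_nat a powr s * of_nat b powr s"
  by (simp add: powr_times_real)

lemma summable_Suc_powr: "p > 1 \<Longrightarrow> summable (\<lambda>n. real (Suc n) powr (-p))"
  using summable_real_powr_iff[of "-p"] by (subst summable_Suc_iff) auto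

text \<open>The growth condition 1 + ln n covers characters, \<open>mu\<close> and
  \<open>mangoldt\<close> alike. Half of the excess Re s - 1 absorbs the logarithm.\<close>

lemma dser_norm_summable:
  assumes a: "\<And>n. n > 0 \<Longrightarrow> norm (a n) \<le> 1 + ln (real n)" and s: "Re s > 1"
  shows "summable (\<lambda>n. norm (a (Suc n) * of_nat (Suc n) powr (-s)))"
proof -
  define e where "e = (Re s - 1) / 2"
  have e: "e > 0" using s by (simp add: e_def)
  show ?thesis
  proof (rule summable_comparison_test)
    show "summable (\<lambda>n. (1 + 1 / e) * real (Suc n) powr (-(1 + e)))"
      using e by (intro summable_mult summable_Suc_powr) auto
    have "norm (norm (a (Suc n) * of_nat (Suc n) powr (-s))) \<le> (1 + 1 / e) * real (Suc n) powr (-(1 + e))" for n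
    proof -
      have "norm (a (Suc n)) \<le> 1 + ln (real (Suc n))" by (rule a) simp
      also have "\<dots> \<le> 1 * real (Suc n) powr e + real (Suc n) powr e / e"
        using e ln_powr_bound[of "real (Suc n)" e] by (intro add_mono) (auto simp: ge_one_powr_ge_zero)
      also have "\<dots> = (1 + 1 / e) * real (Suc n) powr e" by (simp add: algebra_simps)
      finally have "norm (a (Suc n)) * real (Suc n) powr (- Re s) \<le> (1 + 1 / e) * real (Suc n) powr e * real (Suc n) powr (- Re s)"
        by (intro mult_right_mono) auto
      also have "\<dots> = (1 + 1 / e) * (real (Suc n) powr (e + - Re s))"
        by (subst powr_add) (simp only: mult.assoc)
      also have "e + - Re s = -(1 + e)" by (simp add: e_def field_simps)
      finally show ?thesis by (simp add: norm_mult norm_nat_powr del: of_nat_Suc)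
    qed
    thus "\<exists>N. \<forall>n\<ge>N. norm (norm (a (Suc n) * of_nat (Suc n) powr (-s))) \<le> (1 + 1 / e) * real (Suc n) powr (-(1 + e))" by blast
  qed
qed

lemma bounded_imp_ln_bounded:
  assumes "\<And>n. norm (a n :: complex) \<le> 1" "n > 0"
  shows "norm (a n) \<le> 1 + ln (real n)"
proof -
  have "norm (a n) \<le> 1" by (rule assms)
  moreover have "ln (real n) \<ge> 0" using assms by simp
  ultimately show ?thesis by linarith
qed

lemma dser_sums:
  assumes a: "\<And>n. n > 0 \<Longrightarrow> norm (a n) \<le> 1 + ln (real n)" and s: "Re s > 1"
  shows "(\<lambda>n. a (Suc n) * of_nat (Suc n) powr (-s)) sums dser a s"
  unfolding dser_def by (rule summable_sums[OF summable_norm_cancel[OF dser_norm_summable[OF assms]]])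

lemma dser_mult:
  assumes a: "\<And>n. n > 0 \<Longrightarrow> norm (a n) \<le> 1 + ln (real n)"
    and b: "\<And>n. n > 0 \<Longrightarrow> norm (b n) \<le> 1 + ln (real n)"
    and c: "\<And>n. n > 0 \<Longrightarrow> dconv a b n = c n" and s: "Re s > 1"
  shows "dser c s = dser a s * dser b s"
proof -
  have "dconv (\<lambda>n. a n * of_nat n powr (-s)) (\<lambda>n. b n * of_nat n powr (-s)) (Suc n) = c (Suc n) * of_nat (Suc n) powr (-s)" for n
    using dconv_mult_completely[of "\<lambda>n. of_nat n powr (-s)" a b "Suc n", OF nat_powr_mult] c[of "Suc n"]
    by (simp add: mult.commute del: of_nat_Suc)
  moreover have "(\<lambda>n. dconv (\<lambda>n. a n * of_nat n powr (-s)) (\<lambda>n. b n * of_nat n powr (-s)) (Suc n)) sums (dser a s * dser b s)"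
    unfolding dser_def by (rule sums_dconv; rule dser_norm_summable[OF _ s]; rule a b; assumption)
  ultimately have "(\<lambda>n. c (Suc n) * of_nat (Suc n) powr (-s)) sums (dser a s * dser b s)" by simp
  thus ?thesis unfolding dser_def by (rule sums_unique[symmetric])
qed

lemma open_Re_gt: "open {s. Re s > c}"
  by (rule open_halfspace_Re_gt)

lemma has_field_derivative_nat_powr:
  "((\<lambda>s. of_nat (Suc n) powr (-s)) has_field_derivative (- of_real (ln (real (Suc n))) * complex_of_nat (Suc n) powr (-s))) (at s)"
proof -
  have *: "Ln (of_nat (Suc n)) = of_real (ln (real (Suc n)))" using Ln_of_real[of "real (Suc n)"] by simp
  have "((\<lambda>z. complex_of_nat (Suc n) powr z) has_field_derivative Ln (of_nat (Suc n)) * of_nat (Suc n) powr (-s)) (at (-s))"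
    by (rule has_field_derivative_powr_right) (simp del: of_nat_Suc)
  from DERIV_chain2[OF this DERIV_minus[OF DERIV_ident]] show ?thesis by (simp add: * del: of_nat_Suc)
qed

lemma dser_has_field_derivative:
  assumes a: "\<And>n. norm (a n) \<le> 1" and s: "Re s > 1"
  shows "(dser a has_field_derivative - dser (\<lambda>n. a n * ln (real n)) s) (at s)"
proof -
  let ?S = "{s. Re s > 1}"
  let ?f = "\<lambda>n s. a (Suc n) * of_nat (Suc n) powr (-s)"
  let ?f' = "\<lambda>n s. a (Suc n) * (- of_real (ln (real (Suc n))) * complex_of_nat (Suc n) powr (-s))"
  have "\<exists>g g'. \<forall>x\<in>?S. ((\<lambda>n. ?f n x) sums g x) \<and> ((\<lambda>n. ?f' n x) sums g' x) \<and> (g has_field_derivative g' x) (at x)"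
  proof (rule series_and_derivative_comparison_local[OF open_Re_gt])
    show "(?f n has_field_derivative ?f' n x) (at x)" for n x
      by (rule DERIV_cmult[OF has_field_derivative_nat_powr])
    fix x assume x: "x \<in> ?S"
    \<comment> \<open>On a ball of this radius Re y stays above 1 + d. A locally uniform summable
      bound on the terms themselves is enough to differentiate the holomorphic series
      termwise.\<close>
    define d where "d = (Re x - 1) / 2"
    have d: "d > 0" using x by (simp add: d_def)
    have "norm (?f n y) \<le> real (Suc n) powr (-(1 + d))" if "y \<in> ball x d \<inter> ?S" for n y
    proof -
      have "norm (x - y) < d" "\<bar>Re x - Re y\<bar> \<le> norm (x - y)"
        using that abs_Re_le_cmod[of "x - y"] by (auto simp: dist_norm)
      hence "Re x - Re y < d" by linarith
      hence y: "Re y \<ge> 1 + d" unfolding d_def by (simp add: field_simps)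
      have "norm (?f n y) = norm (a (Suc n)) * real (Suc n) powr (- Re y)"
        by (simp add: norm_mult norm_nat_powr del: of_nat_Suc)
      also have "\<dots> \<le> 1 * real (Suc n) powr (-(1 + d))"
        using y by (intro mult_mono a powr_mono) auto
      finally show ?thesis by simp
    qed
    moreover have "summable (\<lambda>n. real (Suc n) powr (-(1 + d)))" using d by (intro summable_Suc_powr) auto
    ultimately show "\<exists>d h. 0 < d \<and> summable h \<and> (\<forall>\<^sub>F n in sequentially. \<forall>y\<in>ball x d \<inter> ?S. norm (?f n y) \<le> h n)"
      using d by (intro exI[of _ d] exI[of _ "\<lambda>n. real (Suc n) powr (-(1 + d))"] conjI always_eventually allI ballI)
  qed
  then obtain g g' where gg: "\<forall>x\<in>?S. ((\<lambda>n. ?f n x) sums g x) \<and> ((\<lambda>n. ?f' n x) sums g' x) \<and> (g has_field_derivative g' x) (at x)"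
    by blast
  have g: "(\<lambda>n. ?f n x) sums g x" "(\<lambda>n. ?f' n x) sums g' x" "(g has_field_derivative g' x) (at x)" if "Re x > 1" for x
    using gg that by blast+
  have "(dser a has_field_derivative g' s) (at s)"
  proof (rule has_field_derivative_transform_within_open[OF g(3)[OF s] open_Re_gt])
    show "s \<in> ?S" using s by simp
    show "g x = dser a x" if "x \<in> ?S" for x
      using sums_unique[OF g(1)[of x]] that unfolding dser_def by simp
  qed
  moreover have "g' s = - dser (\<lambda>n. a n * ln (real n)) s"
  proof -
    have "(\<lambda>n. - ?f' n s) sums (- g' s)" by (rule sums_minus[OF g(2)[OF s]])
    moreover have "(\<lambda>n. - ?f' n s) = (\<lambda>n. a (Suc n) * ln (real (Suc n)) * of_nat (Suc n) powr (-s))"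
      by (simp only: mult_minus_left mult_minus_right minus_minus mult.assoc)
    ultimately have "(\<lambda>n. a (Suc n) * ln (real (Suc n)) * of_nat (Suc n) powr (-s)) sums (- g' s)"
      by metis
    from sums_unique[OF this] have *: "- g' s = dser (\<lambda>n. a n * ln (real n)) s" unfolding dser_def .
    have "g' s = - (- g' s)" by simp
    thus ?thesis unfolding * .
  qed
  ultimately show ?thesis by simp
qed

section \<open>Analytic continuation to the half-plane Re s > 0\<close>

lemma complex_powr_diff_bound:
  fixes a b :: real and s :: complex
  assumes ab: "0 < a" "a \<le> b" and s: "Re s \<ge> -1"
  shows "norm (of_real b powr (-s) - of_real a powr (-s)) \<le> norm s * a powr (- Re s - 1) * (b - a)"
proof -
  let ?S = "closed_segment (complex_of_real a) (complex_of_real b)"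
  have "norm (of_real b powr (-s) - of_real a powr (-s)) \<le> norm s * a powr (- Re s - 1) * norm (complex_of_real b - of_real a)"
  proof (rule field_differentiable_bound[where S="?S"])
    fix z assume "z \<in> ?S"
    then obtain t where t: "a \<le> t" "t \<le> b" "z = of_real t"
      using ab by (auto simp: closed_segment_of_real closed_segment_eq_real_ivl)
    have "z \<notin> \<real>\<^sub>\<le>\<^sub>0" using t ab by (auto simp: complex_nonpos_Reals_iff)
    thus "((\<lambda>z. z powr (-s)) has_field_derivative (-s) * z powr (-s - 1)) (at z within ?S)"
      by (intro has_field_derivative_powr has_field_derivative_at_within)
    have "norm ((-s) * z powr (-s - 1)) = norm s * t powr (- Re s - 1)"
      using t ab by (simp add: norm_mult norm_powr_real_powr)
    \<comment> \<open>The condition Re s \<ge> -1 makes the exponent nonpositive, so the derivative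
      is largest at the left end a.\<close>
    also have "\<dots> \<le> norm s * a powr (- Re s - 1)"
      using t ab s by (intro mult_left_mono powr_mono2') auto
    finally show "norm ((-s) * z powr (-s - 1)) \<le> norm s * a powr (- Re s - 1)" .
  qed auto
  also have "norm (complex_of_real b - of_real a) = b - a"
    using ab by (simp flip: of_real_diff)
  finally show ?thesis .
qed

text \<open>Summation by parts continues a Dirichlet series with bounded partial sums of coefficients to \<open>Re s > 0\<close>.\<close>

definition Lser :: "(nat \<Rightarrow> complex) \<Rightarrow> complex \<Rightarrow> complex" where
  "Lser a s = (\<Sum>n. (\<Sum>k<Suc n. a (Suc k)) * (of_nat (Suc n) powr (-s) - of_nat (Suc (Suc n)) powr (-s)))"

lemma nat_powr_Suc_diff_bound:
  assumes "Re s \<ge> -1"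
  shows "norm (of_nat (Suc n) powr (-s) - of_nat (Suc (Suc n)) powr (-s)) \<le> norm s * real (Suc n) powr (- Re s - 1)"
  using complex_powr_diff_bound[of "real (Suc n)" "real (Suc (Suc n))" s] assms
  by (simp add: norm_minus_commute)

text \<open>On the ball of radius Re x / 2 one has Re y \<ge> Re x / 2, which fixes one summable
  majorant for all y.\<close>

lemma local_series_bound:
  assumes x: "Re x > 0" and K: "K \<ge> 0"
    and bd: "\<And>n y. Re y > 0 \<Longrightarrow> norm y \<le> norm x + Re x \<Longrightarrow> norm (f n y) \<le> K * real (Suc n) powr (- Re y - 1)"
  shows "\<exists>d h. 0 < d \<and> summable h \<and> (\<forall>\<^sub>F n in sequentially. \<forall>y\<in>ball x d \<inter> {s. Re s > 0}. norm (f n y) \<le> h n)"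
proof -
  define d where "d = Re x / 2"
  have d: "d > 0" using x by (simp add: d_def)
  have "norm (f n y) \<le> K * real (Suc n) powr (-(1 + d))" if "y \<in> ball x d \<inter> {s. Re s > 0}" for n y
  proof -
    have "norm y \<le> norm x + norm (y - x)" by (metis norm_triangle_sub)
    also have "norm (y - x) \<le> Re x" using that x by (simp add: dist_norm d_def norm_minus_commute)
    finally have "norm (f n y) \<le> K * real (Suc n) powr (- Re y - 1)" using that by (intro bd) auto
    moreover have "norm (x - y) < d" "\<bar>Re x - Re y\<bar> \<le> norm (x - y)"
        using that abs_Re_le_cmod[of "x - y"] by (auto simp: dist_norm)
    hence "Re x - Re y < d" by linarith
    hence "Re y \<ge> d" unfolding d_def by (simp add: field_simps)
    hence "K * real (Suc n) powr (- Re y - 1) \<le> K * real (Suc n) powr (-(1 + d))"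
      using K by (intro mult_left_mono powr_mono) auto
    ultimately show ?thesis by linarith
  qed
  moreover have "summable (\<lambda>n. K * real (Suc n) powr (-(1 + d)))"
    using d by (intro summable_mult summable_Suc_powr) auto
  ultimately show ?thesis
    using d by (intro exI[of _ d] exI[of _ "\<lambda>n. K * real (Suc n) powr (-(1 + d))"] conjI always_eventually allI ballI)
qed

text \<open>Shared by \<open>Lser\<close> and \<open>zser\<close>: differencing makes the terms of
  both O(n^(- Re s - 1)), locally uniformly in s.\<close>

lemma local_series_holomorphic:
  assumes hol: "\<And>n. f n holomorphic_on UNIV"
    and bd: "\<And>x. Re x > 0 \<Longrightarrow> \<exists>K\<ge>0. \<forall>n y. Re y > 0 \<longrightarrow> norm y \<le> norm x + Re x \<longrightarrow> norm (f n y) \<le> K * real (Suc n) powr (- Re y - 1)"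
  shows "(\<lambda>s. \<Sum>n. f n s) holomorphic_on {s. Re s > 0}" "Re s > 0 \<Longrightarrow> summable (\<lambda>n. f n s)"
proof -
  let ?S = "{s. Re s > 0}"
  have "\<exists>g g'. \<forall>x\<in>?S. ((\<lambda>n. f n x) sums g x) \<and> ((\<lambda>n. deriv (f n) x) sums g' x) \<and> (g has_field_derivative g' x) (at x)"
  proof (rule series_and_derivative_comparison_local[OF open_Re_gt])
    show "(f n has_field_derivative deriv (f n) x) (at x)" for n x
      using holomorphic_derivI[OF hol open_UNIV] by simp
    show "\<exists>d h. 0 < d \<and> summable h \<and> (\<forall>\<^sub>F n in sequentially. \<forall>y\<in>ball x d \<inter> ?S. norm (f n y) \<le> h n)" if x: "x \<in> ?S" for x
    proof -
      obtain K where "K \<ge> 0" "\<And>n y. Re y > 0 \<Longrightarrow> norm y \<le> norm x + Re x \<Longrightarrow> norm (f n y) \<le> K * real (Suc n) powr (- Re y - 1)"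
        using bd[of x] x by auto
      from local_series_bound[OF _ this] show ?thesis using x by simp
    qed
  qed
  then obtain g g' where g: "\<And>x. Re x > 0 \<Longrightarrow> (\<lambda>n. f n x) sums g x" "\<And>x. Re x > 0 \<Longrightarrow> (g has_field_derivative g' x) (at x)"
    by (metis mem_Collect_eq)
  show "Re s > 0 \<Longrightarrow> summable (\<lambda>n. f n s)" using g(1) by (auto simp: summable_def)
  have "g holomorphic_on ?S"
    using g(2) by (auto simp: holomorphic_on_open[OF open_Re_gt])
  moreover have "(\<Sum>n. f n s) = g s" if "s \<in> ?S" for s using g(1)[of s] that by (simp add: sums_iff)
  ultimately show "(\<lambda>s. \<Sum>n. f n s) holomorphic_on ?S" by (rule holomorphic_transform[OF _ sym])
qed

lemma Lser_holomorphic: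
  assumes B: "\<And>n. norm (\<Sum>k<n. a (Suc k)) \<le> B"
  shows "Lser a holomorphic_on {s. Re s > 0}"
    and "Re s > 0 \<Longrightarrow> summable (\<lambda>n. (\<Sum>k<Suc n. a (Suc k)) * (of_nat (Suc n) powr (-s) - of_nat (Suc (Suc n)) powr (-s)))"
proof -
  let ?f = "\<lambda>n s. (\<Sum>k<Suc n. a (Suc k)) * (of_nat (Suc n) powr (-s) - of_nat (Suc (Suc n)) powr (-s))"
  have B0: "B \<ge> 0" using B[of 0] by simp
  have 1: "?f n holomorphic_on UNIV" for n
    by (intro holomorphic_intros) (auto simp del: of_nat_Suc)
  have 2: "\<exists>K\<ge>0. \<forall>n y. Re y > 0 \<longrightarrow> norm y \<le> norm x + Re x \<longrightarrow> norm (?f n y) \<le> K * real (Suc n) powr (- Re y - 1)"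
    if "Re x > 0" for x
  proof (intro exI[of _ "B * (norm x + Re x)"] conjI allI impI)
    show "0 \<le> B * (norm x + Re x)" using B0 that by auto
    fix n y assume y: "Re y > 0" "norm y \<le> norm x + Re x"
    have "norm (?f n y) \<le> B * (norm y * real (Suc n) powr (- Re y - 1))"
      unfolding norm_mult using y B0 by (intro mult_mono B nat_powr_Suc_diff_bound) auto
    also have "\<dots> \<le> B * ((norm x + Re x) * real (Suc n) powr (- Re y - 1))"
      using y B0 by (intro mult_left_mono mult_right_mono) auto
    finally show "norm (?f n y) \<le> B * (norm x + Re x) * real (Suc n) powr (- Re y - 1)" by (simp add: mult.assoc)
  qed
  show "Lser a holomorphic_on {s. Re s > 0}"
    unfolding Lser_def by (rule local_series_holomorphic(1)[OF 1 2])
  show "Re s > 0 \<Longrightarrow> summable (\<lambda>n. ?f n s)" by (rule local_series_holomorphic(2)[OF 1 2])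
qed

lemma Lser_sums:
  assumes B: "\<And>n. norm (\<Sum>k<n. a (Suc k)) \<le> B" and s: "Re s > 0"
  shows "(\<lambda>n. a (Suc n) * of_nat (Suc n) powr (-s)) sums Lser a s"
proof -
  define x where "x = (\<lambda>n. complex_of_nat (Suc n) powr (-s))"
  define C where "C = (\<lambda>n. \<Sum>k<n. a (Suc k))"
  have parts: "(\<Sum>n<N. a (Suc n) * x n) = (\<Sum>n<N. C (Suc n) * (x n - x (Suc n))) + C N * x N" for N
    by (induction N) (auto simp: C_def algebra_simps)
  have B0: "B \<ge> 0" using B[of 0] by simp
  \<comment> \<open>The boundary term of the summation by parts: a bounded factor times a power that
    tends to 0 for Re s > 0.\<close>
  have "(\<lambda>N. C N * x N) \<longlonglongrightarrow> 0"
  proof (rule Lim_null_comparison)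
    show "\<forall>\<^sub>F N in sequentially. norm (C N * x N) \<le> B * real (Suc N) powr (- Re s)"
      using B0 by (intro always_eventually allI) (auto simp: norm_mult x_def norm_nat_powr C_def B intro!: mult_right_mono simp del: of_nat_Suc)
    have "(\<lambda>N. real (Suc N) powr (- Re s)) \<longlonglongrightarrow> 0"
      using s by (intro tendsto_neg_powr filterlim_compose[OF filterlim_real_sequentially filterlim_Suc]) auto
    from tendsto_mult_right_zero[OF this, of B]
    show "(\<lambda>N. B * real (Suc N) powr (- Re s)) \<longlonglongrightarrow> 0" .
  qed
  moreover have "(\<lambda>N. \<Sum>n<N. C (Suc n) * (x n - x (Suc n))) \<longlonglongrightarrow> Lser a s"
    using summable_LIMSEQ[OF Lser_holomorphic(2)[OF B s]] unfolding Lser_def C_def x_def .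
  ultimately have "(\<lambda>N. \<Sum>n<N. a (Suc n) * x n) \<longlonglongrightarrow> Lser a s + 0"
    unfolding parts by (intro tendsto_add)
  thus ?thesis unfolding sums_def x_def by simp
qed

lemma Lser_eq_dser:
  assumes "\<And>n. norm (\<Sum>k<n. a (Suc k)) \<le> B" "Re s > 0"
  shows "Lser a s = dser a s"
  using Lser_sums[OF assms] unfolding dser_def by (simp add: sums_unique)

text \<open>This continues (s - 1) zeta(s), with the pole at 1 removed. The bracket is -(s - 1)
  times the integral of x^(-s) over [n + 1, n + 2], so each term compares a summand with an integral
  and is small; the brackets telescope to -1 for Re s > 1, which the leading 1 compensates.\<close>

definition zser :: "complex \<Rightarrow> complex" where
  "zser s = 1 + (\<Sum>n. (s - 1) * of_nat (Suc n) powr (-s) + (of_nat (Suc (Suc n)) powr (1 - s) - of_nat (Suc n) powr (1 - s)))"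

lemma zser_term_bound:
  assumes s: "Re s > 0"
  shows "norm ((s - 1) * of_nat (Suc n) powr (-s) + (of_nat (Suc (Suc n)) powr (1 - s) - of_nat (Suc n) powr (1 - s)))
     \<le> norm (s - 1) * norm s * real (Suc n) powr (- Re s - 1)"
proof -
  define a b where "a = real (Suc n)" and "b = real (Suc (Suc n))"
  have ab: "0 < a" "a \<le> b" "b - a = 1" by (auto simp: a_def b_def)
  let ?S = "closed_segment (complex_of_real a) (complex_of_real b)"
  \<comment> \<open>The increment of \<open>?p\<close> from a to b = a + 1 is the term to be
    bounded, and its derivative (s - 1) (a^(-s) - z^(-s)) is already small by
    \<open>complex_powr_diff_bound\<close>.\<close>
  let ?p = "\<lambda>z. (s - 1) * of_real a powr (-s) * z + z powr (1 - s)"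
  have "norm (?p (of_real b) - ?p (of_real a)) \<le> norm (s - 1) * norm s * a powr (- Re s - 1) * norm (complex_of_real b - of_real a)"
  proof (rule field_differentiable_bound[where S="?S"])
    fix z assume "z \<in> ?S"
    then obtain t where t: "a \<le> t" "t \<le> b" "z = of_real t"
      using ab by (auto simp: closed_segment_of_real closed_segment_eq_real_ivl)
    have z: "z \<notin> \<real>\<^sub>\<le>\<^sub>0" using t ab by (auto simp: complex_nonpos_Reals_iff)
    have "((\<lambda>z. z powr (1 - s)) has_field_derivative (1 - s) * z powr (1 - s - 1)) (at z within ?S)"
      by (intro has_field_derivative_powr has_field_derivative_at_within z)
    moreover have "1 - s - 1 = -s" by simp
    ultimately have d: "((\<lambda>z. z powr (1 - s)) has_field_derivative (1 - s) * z powr (-s)) (at z within ?S)" by metis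
    from DERIV_add[OF DERIV_cmult[OF DERIV_ident] this]
    show "(?p has_field_derivative (s - 1) * (of_real a powr (-s) - z powr (-s))) (at z within ?S)"
      by (rule DERIV_cong) (simp add: algebra_simps)
    have "norm (of_real a powr (-s) - z powr (-s)) \<le> norm s * a powr (- Re s - 1) * (t - a)"
      using complex_powr_diff_bound[of a t s] t ab s by (simp add: norm_minus_commute)
    also have "\<dots> \<le> norm s * a powr (- Re s - 1) * 1"
      using t ab by (intro mult_left_mono) auto
    finally show "norm ((s - 1) * (of_real a powr (-s) - z powr (-s))) \<le> norm (s - 1) * norm s * a powr (- Re s - 1)"
      unfolding norm_mult by (simp add: mult.assoc mult_left_mono)
  qed auto
  moreover have "norm (complex_of_real b - of_real a) = 1" using ab(3) by (simp flip: of_real_diff)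
  moreover have "complex_of_real b - of_real a = 1" using ab(3) by (simp flip: of_real_diff)
  hence "?p (of_real b) - ?p (of_real a) = (s - 1) * of_real a powr (-s) + (of_real b powr (1 - s) - of_real a powr (1 - s))"
    by (simp add: algebra_simps)
  ultimately have "norm ((s - 1) * of_real a powr (-s) + (of_real b powr (1 - s) - of_real a powr (1 - s))) \<le> norm (s - 1) * norm s * a powr (- Re s - 1)"
    by simp
  thus ?thesis unfolding a_def b_def of_real_of_nat_eq .
qed

lemma zser_holomorphic:
  shows "zser holomorphic_on {s. Re s > 0}"
    and "Re s > 0 \<Longrightarrow> summable (\<lambda>n. (s - 1) * of_nat (Suc n) powr (-s) + (of_nat (Suc (Suc n)) powr (1 - s) - of_nat (Suc n) powr (1 - s)))"
proof -
  let ?f = "\<lambda>n s. (s - 1) * of_nat (Suc n) powr (-s) + (of_nat (Suc (Suc n)) powr (1 - s) - of_nat (Suc n) powr (1 - s)) :: complex"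
  have 1: "?f n holomorphic_on UNIV" for n
    by (intro holomorphic_intros) (auto simp del: of_nat_Suc)
  have 2: "\<exists>K\<ge>0. \<forall>n y. Re y > 0 \<longrightarrow> norm y \<le> norm x + Re x \<longrightarrow> norm (?f n y) \<le> K * real (Suc n) powr (- Re y - 1)"
    if "Re x > 0" for x
  proof (intro exI[of _ "(norm x + Re x + 1) * (norm x + Re x)"] conjI allI impI)
    show "0 \<le> (norm x + Re x + 1) * (norm x + Re x)" using that by auto
    fix n y assume y: "Re y > 0" "norm y \<le> norm x + Re x"
    have "norm (y - 1) \<le> norm x + Re x + 1" using y(2) norm_triangle_ineq4[of y 1] by simp
    hence "norm (y - 1) * norm y * real (Suc n) powr (- Re y - 1) \<le> (norm x + Re x + 1) * (norm x + Re x) * real (Suc n) powr (- Re y - 1)"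
      using y that by (intro mult_right_mono mult_mono) auto
    thus "norm (?f n y) \<le> (norm x + Re x + 1) * (norm x + Re x) * real (Suc n) powr (- Re y - 1)"
      using zser_term_bound[OF y(1), of n] by (rule order_trans[rotated])
  qed
  show "zser holomorphic_on {s. Re s > 0}"
    unfolding zser_def by (intro holomorphic_intros local_series_holomorphic(1)[OF 1 2])
  show "Re s > 0 \<Longrightarrow> summable (\<lambda>n. ?f n s)" by (rule local_series_holomorphic(2)[OF 1 2])
qed

lemma zser_1: "zser 1 = 1"
  by (simp add: zser_def del: of_nat_Suc)

lemma zser_eq_dser:
  assumes s: "Re s > 1"
  shows "zser s = (s - 1) * dser (\<lambda>_. 1) s"
proof -
  let ?f = "\<lambda>n. (s - 1) * of_nat (Suc n) powr (-s) + (of_nat (Suc (Suc n)) powr (1 - s) - of_nat (Suc n) powr (1 - s)) :: complex"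
  have "(\<lambda>n. 1 * complex_of_nat (Suc n) powr (-s)) sums dser (\<lambda>_. 1) s"
    by (rule dser_sums) (use s in auto)
  hence "(\<lambda>N. \<Sum>n<N. complex_of_nat (Suc n) powr (-s)) \<longlonglongrightarrow> dser (\<lambda>_. 1) s"
    unfolding sums_def mult_1 .
  from tendsto_mult_left[OF this, of "s - 1"]
  have "(\<lambda>N. (s - 1) * (\<Sum>n<N. complex_of_nat (Suc n) powr (-s))) \<longlonglongrightarrow> (s - 1) * dser (\<lambda>_. 1) s" .
  moreover have "(\<lambda>N. complex_of_nat (Suc N) powr (1 - s)) \<longlonglongrightarrow> 0"
  proof (rule Lim_null_comparison)
    show "\<forall>\<^sub>F N in sequentially. norm (complex_of_nat (Suc N) powr (1 - s)) \<le> real (Suc N) powr (1 - Re s)"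
      by (simp add: norm_nat_powr del: of_nat_Suc)
    show "(\<lambda>N. real (Suc N) powr (1 - Re s)) \<longlonglongrightarrow> 0"
      using s by (intro tendsto_neg_powr filterlim_compose[OF filterlim_real_sequentially filterlim_Suc]) auto
  qed
  ultimately have "(\<lambda>N. (s - 1) * (\<Sum>n<N. of_nat (Suc n) powr (-s)) + of_nat (Suc N) powr (1 - s) - 1) \<longlonglongrightarrow> (s - 1) * dser (\<lambda>_. 1) s + 0 - 1"
    by (intro tendsto_add tendsto_diff tendsto_const)
  moreover have "(\<Sum>n<N. ?f n) = (s - 1) * (\<Sum>n<N. of_nat (Suc n) powr (-s)) + of_nat (Suc N) powr (1 - s) - 1" for N
  proof -
    have "(\<Sum>n<N. of_nat (Suc (Suc n)) powr (1 - s) - of_nat (Suc n) powr (1 - s)) = of_nat (Suc N) powr (1 - s) - of_nat (Suc 0) powr (1 - s)"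
      by (rule sum_lessThan_telescope[of "\<lambda>n. of_nat (Suc n) powr (1 - s)"])
    thus ?thesis by (simp add: sum.distrib sum_distrib_left del: of_nat_Suc) simp
  qed
  ultimately have "?f sums ((s - 1) * dser (\<lambda>_. 1) s - 1)" unfolding sums_def by simp
  thus ?thesis unfolding zser_def by (simp add: sums_iff)
qed

section \<open>Non-vanishing on the line Re s = 1\<close>

text \<open>Covers the characters and the constant 1 together, so that L-series and the zeta
  function share their arguments.\<close>

definition bounded_cmult :: "(nat \<Rightarrow> complex) \<Rightarrow> bool" where
  "bounded_cmult f \<longleftrightarrow> (\<forall>a b. f (a * b) = f a * f b) \<and> f (Suc 0) = 1 \<and> (\<forall>n. norm (f n) \<le> 1)"

lemma bounded_cmultD:
  assumes "bounded_cmult f"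
  shows "f (a * b) = f a * f b" "f (Suc 0) = 1" "norm (f n) \<le> 1"
  using assms by (auto simp: bounded_cmult_def)

lemma bounded_cmult_dchar: "m > 0 \<Longrightarrow> dchar m \<xi> \<Longrightarrow> bounded_cmult \<xi>"
  by (simp add: bounded_cmult_def dchar_1 dcharD(1) dchar_norm(1))

lemma bounded_cmult_1: "bounded_cmult (\<lambda>_. 1)"
  by (simp add: bounded_cmult_def)

lemma norm_mult_le_1: "norm (a::complex) \<le> 1 \<Longrightarrow> norm b \<le> c \<Longrightarrow> norm (a * b) \<le> c"
  unfolding norm_mult by (metis mult_left_le_one_le norm_ge_zero order_trans)

lemma dser_unit: "dser (\<lambda>n. if n = 1 then 1 else 0) s = 1"
proof -
  have "(\<lambda>n. (if Suc n = 1 then 1 else 0) * of_nat (Suc n) powr (-s)) sums (\<Sum>n\<in>{0}. (if Suc n = 1 then 1 else 0) * complex_of_nat (Suc n) powr (-s))"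
    by (rule sums_finite) auto
  thus ?thesis unfolding dser_def by (simp add: sums_iff)
qed

lemma dser_cmult_inverse:
  assumes f: "bounded_cmult f" and s: "Re s > 1"
  shows "dser (\<lambda>n. f n * mu n) s * dser f s = 1"
proof -
  have "dser (\<lambda>n. if n = 1 then 1 else 0) s = dser (\<lambda>n. f n * mu n) s * dser f s"
  proof (rule dser_mult[OF _ _ _ s])
    fix n :: nat assume n: "n > 0"
    have ln: "0 \<le> ln (real n)" using n by simp
    have "norm (f n * mu n) \<le> 1"
      by (rule norm_mult_le_1[OF bounded_cmultD(3)[OF f]]) (simp add: abs_mu_le)
    thus "norm (f n * mu n) \<le> 1 + ln (real n)" using ln by linarith
    show "norm (f n) \<le> 1 + ln (real n)" using bounded_cmultD(3)[OF f, of n] ln by linarith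
    have "dconv (\<lambda>n. f n * mu n) f n = dconv (\<lambda>n. f n * of_real (mu n)) (\<lambda>n. f n * of_real 1) n" by simp
    also have "\<dots> = f n * of_real (dconv mu (\<lambda>_. 1) n)"
      unfolding dconv_mult_completely[OF bounded_cmultD(1)[OF f]] dconv_of_real ..
    also have "\<dots> = (if n = 1 then 1 else 0)"
      using dconv_mu_1[OF n] bounded_cmultD(2)[OF f] by simp
    finally show "dconv (\<lambda>n. f n * mu n) f n = (if n = 1 then 1 else 0)" .
  qed
  thus ?thesis by (simp only: dser_unit)
qed

lemma dser_cmult_nonzero: "bounded_cmult f \<Longrightarrow> Re s > 1 \<Longrightarrow> dser f s \<noteq> 0"
  using dser_cmult_inverse[of f s] by auto

lemma mangoldt_ln_bound:
  assumes f: "bounded_cmult f" and n: "n > 0"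
  shows "norm (f n * mangoldt n) \<le> 1 + ln (real n)"
proof (rule norm_mult_le_1[OF bounded_cmultD(3)[OF f]])
  have "mangoldt n \<le> ln (real n)" using mangoldt_le[OF n] by simp
  thus "norm (mangoldt n :: complex) \<le> 1 + ln (real n)" by simp
qed

text \<open>Convolving \<open>f n * mangoldt n\<close> with f gives f(n) ln n, the coefficients of
  the negative derivative; dividing by the nonvanishing series yields the logarithmic
  derivative.\<close>

lemma dser_mangoldt:
  assumes f: "bounded_cmult f" and s: "Re s > 1"
  shows "dser (\<lambda>n. f n * mangoldt n) s = - (deriv (dser f) s / dser f s)"
proof -
  have "dser (\<lambda>n. f n * ln (real n)) s = dser (\<lambda>n. f n * mangoldt n) s * dser f s"
  proof (rule dser_mult[OF _ _ _ s])
    fix n :: nat assume n: "n > 0"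
    show "norm (f n * mangoldt n) \<le> 1 + ln (real n)" by (rule mangoldt_ln_bound[OF f n])
    show "norm (f n) \<le> 1 + ln (real n)" by (rule bounded_imp_ln_bounded[OF bounded_cmultD(3)[OF f] n])
    have "dconv (\<lambda>n. f n * mangoldt n) f n = dconv (\<lambda>n. f n * of_real (mangoldt n)) (\<lambda>n. f n * of_real 1) n" by simp
    also have "\<dots> = f n * of_real (dconv mangoldt (\<lambda>_. 1) n)"
      unfolding dconv_mult_completely[OF bounded_cmultD(1)[OF f]] dconv_of_real ..
    finally show "dconv (\<lambda>n. f n * mangoldt n) f n = f n * ln (real n)"
      unfolding dconv_mangoldt_1[OF n] .
  qed
  moreover have "deriv (dser f) s = - dser (\<lambda>n. f n * ln (real n)) s"
    by (rule DERIV_imp_deriv[OF dser_has_field_derivative[OF bounded_cmultD(3)[OF f] s]])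
  ultimately show ?thesis using dser_cmult_nonzero[OF f s] by simp
qed

text \<open>The limit k is the order of vanishing at z0. Writing F = g (z - z0)^k with g nonzero
  near z0, the logarithmic derivative is k / (z - z0) plus a bounded term. The point w rules out
  that F vanishes identically.\<close>

lemma log_deriv_limit:
  assumes F: "F holomorphic_on S" "open S" "connected S" and z: "z0 \<in> S" and w: "w \<in> S" "F w \<noteq> 0"
  obtains k :: nat where "k = 0 \<longleftrightarrow> F z0 \<noteq> 0"
    "((\<lambda>t::real. of_real t * (deriv F (z0 + of_real t) / F (z0 + of_real t))) \<longlongrightarrow> of_nat k) (at_right 0)"
proof -
  define g where "g = zor_poly F z0"
  define n where "n = zorder F z0"
  have "(if F z0 = 0 then n > 0 else n = 0) \<and> (\<exists>r. r > 0 \<and> cball z0 r \<subseteq> S \<and> g holomorphic_on cball z0 r \<and>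
          (\<forall>w\<in>cball z0 r. F w = g w * (w - z0) ^ nat n \<and> g w \<noteq> 0))"
    unfolding g_def n_def by (rule zorder_exist_zero[OF F z]) (use w in blast)
  then obtain r where n: "if F z0 = 0 then n > 0 else n = 0" and r: "r > 0" "g holomorphic_on cball z0 r"
    "\<forall>w\<in>cball z0 r. F w = g w * (w - z0) ^ nat n \<and> g w \<noteq> 0" by blast
  define k where "k = nat n"
  have hg: "g holomorphic_on ball z0 r" using r(2) by (rule holomorphic_on_subset) auto
  have eq: "of_real t * (deriv F (z0 + of_real t) / F (z0 + of_real t)) = of_real t * (deriv g (z0 + of_real t) / g (z0 + of_real t)) + of_nat k"
    if t: "t \<in> {0<..<r}" for t :: real
  proof -
    define x where "x = z0 + of_real t"
    have x: "x \<in> ball z0 r" using t by (simp add: x_def dist_norm)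
    have gx: "g x \<noteq> 0" using r(3) x by auto
    have dg: "(g has_field_derivative deriv g x) (at x)" by (rule holomorphic_derivI[OF hg _ x]) simp
    have "((\<lambda>w. g w * (w - z0) ^ k) has_field_derivative (deriv g x * (x - z0) ^ k + of_nat k * (x - z0) ^ (k - 1) * g x)) (at x)"
      by (rule derivative_eq_intros dg refl)+ simp
    hence "(F has_field_derivative (deriv g x * (x - z0) ^ k + of_nat k * (x - z0) ^ (k - 1) * g x)) (at x)"
      by (rule has_field_derivative_transform_within_open[OF _ open_ball x]) (use r(3) in \<open>auto simp: k_def\<close>)
    hence dF: "deriv F x = deriv g x * (x - z0) ^ k + of_nat k * (x - z0) ^ (k - 1) * g x" by (rule DERIV_imp_deriv)
    have Fx: "F x = g x * (x - z0) ^ k" using r(3) x by (auto simp: k_def)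
    have xz: "x - z0 = of_real t" "of_real t \<noteq> (0::complex)" using t by (auto simp: x_def)
    have "of_real t * (deriv F x / F x) = of_real t * (deriv g x / g x) + of_nat k"
    \<comment> \<open>For k = 0 the exponent k - 1 truncates to 0, so this case is treated
      apart.\<close>
    proof (cases k)
      case 0
      thus ?thesis unfolding dF Fx xz using gx by simp
    next
      case (Suc j)
      thus ?thesis unfolding dF Fx xz using gx xz(2) by (simp add: field_simps)
    qed
    thus ?thesis by (simp add: x_def)
  qed
  have ev: "eventually (\<lambda>t. t \<in> {0<..<r}) (at_right (0::real))"
    using r(1) by (rule eventually_at_right_real)
  have tz: "((\<lambda>t::real. z0 + of_real t) \<longlongrightarrow> z0) (at_right 0)"
    by (auto intro!: tendsto_eq_intros)
  have "isCont (\<lambda>w. deriv g w / g w) z0"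
    using r hg by (intro continuous_divide continuous_on_interior[of "ball z0 r"] holomorphic_on_imp_continuous_on holomorphic_deriv) auto
  from isCont_tendsto_compose[OF this tz]
  have "((\<lambda>t::real. of_real t * (deriv g (z0 + of_real t) / g (z0 + of_real t)) + of_nat k) \<longlongrightarrow> of_real 0 * (deriv g z0 / g z0) + of_nat k) (at_right 0)"
    by (intro tendsto_add tendsto_mult tendsto_of_real tendsto_ident_at tendsto_const)
  hence "((\<lambda>t::real. of_real t * (deriv F (z0 + of_real t) / F (z0 + of_real t))) \<longlongrightarrow> of_nat k) (at_right 0)"
    by (subst tendsto_cong[OF eventually_mono[OF ev eq]]) simp_all
  moreover have "k = 0 \<longleftrightarrow> F z0 \<noteq> 0" using n by (auto simp: k_def split: if_splits)
  ultimately show ?thesis by (rule that[rotated])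
qed

lemma dchar_Lser_bound:
  assumes "m > 0" "dchar m \<xi>" "\<xi> \<noteq> principal_dchar m"
  shows "norm (\<Sum>k<n. \<xi> (Suc k)) \<le> real m + 1"
proof -
  have "(\<Sum>k<n. \<xi> (Suc k)) = (\<Sum>a<Suc n. \<xi> a) - \<xi> 0"
    by (subst sum.lessThan_Suc_shift) simp
  also have "norm \<dots> \<le> norm (\<Sum>a<Suc n. \<xi> a) + norm (\<xi> 0)" by (rule norm_triangle_ineq4)
  also have "\<dots> \<le> real m + 1"
    by (intro add_mono dchar_partial_sum_bound[OF assms] dchar_norm(1)[OF assms(1,2)])
  finally show ?thesis .
qed

lemma connected_Re_gt: "connected {s. Re s > c}"
  by (rule convex_connected[OF convex_halfspace_Re_gt])

text \<open>Here k is the order of the zero of \<open>Lser \<xi>\<close> at 1 + it. It enters with a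
  minus sign because the series is the negative logarithmic derivative.\<close>

lemma mangoldt_dser_limit_dchar:
  assumes "m > 0" "dchar m \<xi>" "\<xi> \<noteq> principal_dchar m"
  obtains k :: nat where "k = 0 \<longleftrightarrow> Lser \<xi> (Complex 1 t) \<noteq> 0"
    "((\<lambda>x::real. of_real x * dser (\<lambda>n. \<xi> n * mangoldt n) (Complex 1 t + of_real x)) \<longlongrightarrow> - of_nat k) (at_right 0)"
proof -
  note B = dchar_Lser_bound[OF assms]
  note f = bounded_cmult_dchar[OF assms(1,2)]
  have eq: "Lser \<xi> s = dser \<xi> s" if "Re s > 0" for s by (rule Lser_eq_dser[OF B that])
  have mem: "Complex 1 t \<in> {s. Re s > 0}" "2 \<in> {s. Re s > 0}" by simp_all
  have nz: "Lser \<xi> 2 \<noteq> 0" using eq[of 2] dser_cmult_nonzero[OF f, of 2] by simp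
  obtain k :: nat where k: "k = 0 \<longleftrightarrow> Lser \<xi> (Complex 1 t) \<noteq> 0"
    "((\<lambda>x::real. of_real x * (deriv (Lser \<xi>) (Complex 1 t + of_real x) / Lser \<xi> (Complex 1 t + of_real x))) \<longlongrightarrow> of_nat k) (at_right 0)"
    by (rule log_deriv_limit[OF Lser_holomorphic(1)[OF B] open_Re_gt connected_Re_gt mem nz])
  have "eventually (\<lambda>x. of_real x * dser (\<lambda>n. \<xi> n * mangoldt n) (Complex 1 t + of_real x) =
      - (of_real x * (deriv (Lser \<xi>) (Complex 1 t + of_real x) / Lser \<xi> (Complex 1 t + of_real x)))) (at_right (0::real))"
    using eventually_at_right_less[of 0]
  proof eventually_elim
    case (elim x)
    let ?s = "Complex 1 t + of_real x"
    have s: "Re ?s > 1" using elim by simp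
    have "(dser \<xi> has_field_derivative - dser (\<lambda>n. \<xi> n * ln (real n)) ?s) (at ?s)"
      by (rule dser_has_field_derivative[OF bounded_cmultD(3)[OF f] s])
    hence d: "(dser \<xi> has_field_derivative deriv (dser \<xi>) ?s) (at ?s)" using DERIV_imp_deriv by metis
    have "(Lser \<xi> has_field_derivative deriv (dser \<xi>) ?s) (at ?s)"
      by (rule has_field_derivative_transform_within_open[OF d open_Re_gt[of 1]]) (use s eq in auto)
    hence "deriv (Lser \<xi>) ?s = deriv (dser \<xi>) ?s" by (rule DERIV_imp_deriv)
    moreover have "Lser \<xi> ?s = dser \<xi> ?s" using eq s by simp
    ultimately show ?case using dser_mangoldt[OF f s] by simp
  qed
  from tendsto_cong[OF this] tendsto_minus[OF k(2)]
  have "((\<lambda>x::real. of_real x * dser (\<lambda>n. \<xi> n * mangoldt n) (Complex 1 t + of_real x)) \<longlongrightarrow> - of_nat k) (at_right 0)" by simp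
  with k(1) show ?thesis by (rule that)
qed

text \<open>Zeta is \<open>zser\<close> divided by s - 1. The denominator accounts for the 1 at t =
  0, a zero of \<open>zser\<close> for the -k, and \<open>zser_1\<close> excludes such a zero at t =
  0.\<close>

lemma mangoldt_dser_limit_1:
  obtains k :: nat where "t = 0 \<longrightarrow> k = 0"
    "((\<lambda>x::real. of_real x * dser (\<lambda>n. mangoldt n) (Complex 1 t + of_real x)) \<longlongrightarrow> (if t = 0 then 1 else 0) - of_nat k) (at_right 0)"
proof -
  note f = bounded_cmult_1
  have mem: "Complex 1 t \<in> {s. Re s > 0}" "2 \<in> {s. Re s > 0}" by simp_all
  have nz: "zser 2 \<noteq> 0" using zser_eq_dser[of 2] dser_cmult_nonzero[OF f, of 2] by simp
  obtain k :: nat where k: "k = 0 \<longleftrightarrow> zser (Complex 1 t) \<noteq> 0"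
    "((\<lambda>x::real. of_real x * (deriv zser (Complex 1 t + of_real x) / zser (Complex 1 t + of_real x))) \<longlongrightarrow> of_nat k) (at_right 0)"
    by (rule log_deriv_limit[OF zser_holomorphic(1) open_Re_gt connected_Re_gt mem nz])
  have "eventually (\<lambda>x. of_real x * dser (\<lambda>n. mangoldt n) (Complex 1 t + of_real x) =
      of_real x / (Complex 1 t + of_real x - 1) - of_real x * (deriv zser (Complex 1 t + of_real x) / zser (Complex 1 t + of_real x))) (at_right (0::real))"
    using eventually_at_right_less[of 0]
  proof eventually_elim
    case (elim x)
    define s where "s = Complex 1 t + of_real x"
    have s: "Re s > 1" using elim by (simp add: s_def)
    hence s1: "s - 1 \<noteq> 0" by auto
    note nz = dser_cmult_nonzero[OF f s]
    have "(dser (\<lambda>_. 1) has_field_derivative deriv (dser (\<lambda>_. 1)) s) (at s)"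
      using dser_has_field_derivative[of "\<lambda>_. 1" s] s by (simp add: DERIV_imp_deriv)
    hence "((\<lambda>w. (w - 1) * dser (\<lambda>_. 1) w) has_field_derivative (dser (\<lambda>_. 1) s + (s - 1) * deriv (dser (\<lambda>_. 1)) s)) (at s)"
      by (auto intro!: derivative_eq_intros)
    hence "(zser has_field_derivative (dser (\<lambda>_. 1) s + (s - 1) * deriv (dser (\<lambda>_. 1)) s)) (at s)"
      by (rule has_field_derivative_transform_within_open[OF _ open_Re_gt[of 1]]) (use s zser_eq_dser in auto)
    hence d: "deriv zser s = dser (\<lambda>_. 1) s + (s - 1) * deriv (dser (\<lambda>_. 1)) s" by (rule DERIV_imp_deriv)
    have "dser (\<lambda>n. mangoldt n) s = - (deriv (dser (\<lambda>_. 1)) s / dser (\<lambda>_. 1) s)"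
      using dser_mangoldt[OF f s] by simp
    also have "\<dots> = 1 / (s - 1) - deriv zser s / zser s"
    proof -
      have "- (B / A) = 1 / u - (A + u * B) / (u * A)" if "u \<noteq> 0" "A \<noteq> 0" for u A B :: complex
        using that by (simp add: field_simps)
      thus ?thesis unfolding d zser_eq_dser[OF s] using s1 nz by blast
    qed
    finally show ?case unfolding s_def[symmetric] by (simp add: right_diff_distrib)
  qed
  note ev = this
  have "((\<lambda>x::real. of_real x / (Complex 1 t + of_real x - 1)) \<longlongrightarrow> (if t = 0 then 1 else 0)) (at_right 0)"
  proof (cases "t = 0")
    case True
    have "eventually (\<lambda>x. of_real x / (Complex 1 t + of_real x - 1) = (1::complex)) (at_right (0::real))"
      using eventually_at_right_less[of 0]
    proof eventually_elim
      case (elim x)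
      have "Complex 1 t + of_real x - 1 = of_real x" using True by (simp add: complex_eq_iff)
      thus ?case using elim by simp
    qed
    thus ?thesis using True by (simp add: tendsto_eventually)
  next
    case False
    have "((\<lambda>x::real. of_real x / (Complex 1 t + of_real x - 1)) \<longlongrightarrow> of_real 0 / (Complex 1 t + of_real 0 - 1)) (at_right 0)"
      using False by (intro tendsto_intros) (auto simp: complex_eq_iff)
    thus ?thesis using False by simp
  qed
  from tendsto_diff[OF this k(2)] tendsto_cong[OF ev]
  have "((\<lambda>x::real. of_real x * dser (\<lambda>n. mangoldt n) (Complex 1 t + of_real x)) \<longlongrightarrow> (if t = 0 then 1 else 0) - of_nat k) (at_right 0)" by simp
  moreover have "t = 0 \<longrightarrow> k = 0" using k(1) zser_1 by (auto simp: complex_eq_iff one_complex.code)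
  ultimately show ?thesis by (rule that[rotated])
qed

text \<open>The classical 3 + 4 cos a + cos 2a = 2 (1 + cos a)^2. The second alternative serves the
  n that are not coprime to the modulus.\<close>

lemma three_four_one:
  fixes w e :: complex
  assumes "(norm w = 1 \<and> e = w\<^sup>2) \<or> (w = 0 \<and> norm e \<le> 1)"
  shows "3 + 4 * Re w + Re e \<ge> 0"
  using assms
proof
  assume w: "norm w = 1 \<and> e = w\<^sup>2"
  have "(Re w)\<^sup>2 + (Im w)\<^sup>2 = 1" using w cmod_power2[of w] by simp
  hence "3 + 4 * Re w + Re e = 2 * (1 + Re w)\<^sup>2" using w by (simp add: power2_eq_square algebra_simps)
  thus ?thesis by simp
next
  assume "w = 0 \<and> norm e \<le> 1"
  thus ?thesis using abs_Re_le_cmod[of e] by auto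
qed

text \<open>The function e stands for the square of f but is unconstrained at the zeros of f, so
  that e = 1 is admissible when the squared character is principal.\<close>

lemma mangoldt_dser_three_four_one:
  assumes f: "bounded_cmult f" and e: "bounded_cmult e" and x: "x > 0"
    and fe: "\<And>n. n > 0 \<Longrightarrow> (norm (f n) = 1 \<and> e n = (f n)\<^sup>2) \<or> f n = 0"
  shows "0 \<le> 3 * Re (dser (\<lambda>n. mangoldt n) (Complex 1 0 + of_real x)) + 4 * Re (dser (\<lambda>n. f n * mangoldt n) (Complex 1 t + of_real x))
    + Re (dser (\<lambda>n. e n * mangoldt n) (Complex 1 (2 * t) + of_real x))"
proof -
  have Ds: "(\<lambda>n. Re ((g (Suc n) * mangoldt (Suc n)) * of_nat (Suc n) powr (-(Complex 1 u + of_real x)))) sums Re (dser (\<lambda>n. g n * mangoldt n) (Complex 1 u + of_real x))"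
    if "bounded_cmult g" for g u
    by (intro sums_Re dser_sums mangoldt_ln_bound that) (use x in auto)
  note S = sums_add[OF sums_add[OF sums_mult[OF Ds[OF bounded_cmult_1, of 0], of 3] sums_mult[OF Ds[OF f, of t], of 4]] Ds[OF e, of "2 * t"]]
  have "0 \<le> 3 * Re (dser (\<lambda>n. 1 * mangoldt n) (Complex 1 0 + of_real x)) + 4 * Re (dser (\<lambda>n. f n * mangoldt n) (Complex 1 t + of_real x))
    + Re (dser (\<lambda>n. e n * mangoldt n) (Complex 1 (2 * t) + of_real x))"
  proof (rule sums_le[OF _ sums_zero S])
    fix n
    define c where "c = of_nat (Suc n) powr (- \<i> * of_real t)"
    define M where "M = mangoldt (Suc n) * real (Suc n) powr (-1-x)"
    have M: "M \<ge> 0" by (simp add: M_def mangoldt_nonneg)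
    have pw: "of_nat (Suc n) powr (-(Complex 1 u + of_real x)) = of_nat (Suc n) powr (- \<i> * of_real u) * of_real (real (Suc n) powr (-1-x))" for u
    proof -
      have "-(Complex 1 u + of_real x) = - \<i> * of_real u + of_real (-1-x)" by (simp add: complex_eq_iff)
      moreover have "of_nat (Suc n) powr (of_real (-1-x)) = complex_of_real (real (Suc n) powr (-1-x))"
        using powr_of_real[of "real (Suc n)" "-1-x"] by simp
      ultimately show ?thesis using nat_powr_add by metis
    qed
    have c2: "of_nat (Suc n) powr (- \<i> * of_real (2 * t)) = c\<^sup>2"
      unfolding c_def power2_eq_square nat_powr_add[symmetric] by (simp add: algebra_simps del: of_nat_Suc)
    have nc: "norm c = 1" unfolding c_def by (simp add: norm_nat_powr del: of_nat_Suc)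
    have t1: "(1 * mangoldt (Suc n)) * of_nat (Suc n) powr (-(Complex 1 0 + of_real x)) = complex_of_real M"
      unfolding pw M_def by (simp del: of_nat_Suc)
    have t2: "(f (Suc n) * mangoldt (Suc n)) * of_nat (Suc n) powr (-(Complex 1 t + of_real x)) = of_real M * (f (Suc n) * c)"
      unfolding pw M_def c_def by (simp del: of_nat_Suc add: mult_ac)
    have t3: "(e (Suc n) * mangoldt (Suc n)) * of_nat (Suc n) powr (-(Complex 1 (2 * t) + of_real x)) = of_real M * (e (Suc n) * c\<^sup>2)"
      unfolding pw M_def c2 by (simp del: of_nat_Suc add: mult_ac)
    have "3 + 4 * Re (f (Suc n) * c) + Re (e (Suc n) * c\<^sup>2) \<ge> 0"
    proof (rule three_four_one)
      show "(norm (f (Suc n) * c) = 1 \<and> e (Suc n) * c\<^sup>2 = (f (Suc n) * c)\<^sup>2) \<or> (f (Suc n) * c = 0 \<and> norm (e (Suc n) * c\<^sup>2) \<le> 1)"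
        using fe[of "Suc n"] bounded_cmultD(3)[OF e, of "Suc n"] nc by (auto simp: norm_mult norm_power power_mult_distrib)
    qed
    hence "0 \<le> M * (3 + 4 * Re (f (Suc n) * c) + Re (e (Suc n) * c\<^sup>2))" using M by simp
    also have "\<dots> = 3 * Re (of_real M) + 4 * Re (of_real M * (f (Suc n) * c)) + Re (of_real M * (e (Suc n) * c\<^sup>2))"
      by (simp add: algebra_simps)
    finally show "0 \<le> 3 * Re ((1 * mangoldt (Suc n)) * of_nat (Suc n) powr (-(Complex 1 0 + of_real x))) +
      4 * Re ((f (Suc n) * mangoldt (Suc n)) * of_nat (Suc n) powr (-(Complex 1 t + of_real x))) +
      Re ((e (Suc n) * mangoldt (Suc n)) * of_nat (Suc n) powr (-(Complex 1 (2 * t) + of_real x)))"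
      unfolding t1 t2 t3 .
  qed
  thus ?thesis by simp
qed

text \<open>A zero of order k1 \<ge> 1 makes nonnegative quantities tend to 3 - 4 k1 - k2 < 0. In
  the excluded case, t = 0 and \<xi> real, the squared character contributes a pole at the same
  point; the total may then reach 4 - 4 k1, which is no contradiction for k1 = 1.\<close>

lemma Lser_nonzero_341:
  assumes \<xi>: "m > 0" "dchar m \<xi>" "\<xi> \<noteq> principal_dchar m"
    and t: "t \<noteq> 0 \<or> (\<lambda>n. \<xi> n * \<xi> n) \<noteq> principal_dchar m"
  shows "Lser \<xi> (Complex 1 t) \<noteq> 0"
proof
  assume z: "Lser \<xi> (Complex 1 t) = 0"
  obtain k1 :: nat where k1: "k1 > 0"
    "((\<lambda>x::real. of_real x * dser (\<lambda>n. \<xi> n * mangoldt n) (Complex 1 t + of_real x)) \<longlongrightarrow> - of_nat k1) (at_right 0)"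
    using mangoldt_dser_limit_dchar[OF \<xi>, of t] z by (metis gr0I)
  have k0: "((\<lambda>x::real. of_real x * dser (\<lambda>n. mangoldt n) (Complex 1 0 + of_real x)) \<longlongrightarrow> 1) (at_right 0)"
    by (rule mangoldt_dser_limit_1[of 0]) simp
  have "\<exists>e k2::nat. bounded_cmult e \<and> (\<forall>n>0. (norm (\<xi> n) = 1 \<and> e n = (\<xi> n)\<^sup>2) \<or> \<xi> n = 0) \<and>
    ((\<lambda>x::real. of_real x * dser (\<lambda>n. e n * mangoldt n) (Complex 1 (2 * t) + of_real x)) \<longlongrightarrow> - of_nat k2) (at_right 0)"
  proof (cases "(\<lambda>n. \<xi> n * \<xi> n) = principal_dchar m")
    case True
    obtain k :: nat where k: "((\<lambda>x::real. of_real x * dser (\<lambda>n. mangoldt n) (Complex 1 (2 * t) + of_real x)) \<longlongrightarrow> (if 2 * t = 0 then 1 else 0) - of_nat k) (at_right 0)"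
      by (rule mangoldt_dser_limit_1[of "2 * t"])
    have "(norm (\<xi> n) = 1 \<and> 1 = (\<xi> n)\<^sup>2) \<or> \<xi> n = 0" for n
      using fun_cong[OF True, of n] dcharD(3)[OF \<xi>(2), of n] dchar_norm(2)[OF \<xi>(1,2), of n]
      by (auto simp: principal_dchar_def power2_eq_square split: if_splits)
    thus ?thesis using k t True bounded_cmult_1
      by (intro exI[of _ "\<lambda>_. 1"] exI[of _ k]) simp
  next
    case False
    note psi = dchar_mult[OF \<xi>(2,2)]
    obtain k :: nat where k: "((\<lambda>x::real. of_real x * dser (\<lambda>n. \<xi> n * \<xi> n * mangoldt n) (Complex 1 (2 * t) + of_real x)) \<longlongrightarrow> - of_nat k) (at_right 0)"
      by (rule mangoldt_dser_limit_dchar[OF \<xi>(1) psi False])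
    have "(norm (\<xi> n) = 1 \<and> \<xi> n * \<xi> n = (\<xi> n)\<^sup>2) \<or> \<xi> n = 0" for n
      using dcharD(3)[OF \<xi>(2), of n] dchar_norm(2)[OF \<xi>(1,2), of n] by (auto simp: power2_eq_square)
    thus ?thesis using k bounded_cmult_dchar[OF \<xi>(1) psi]
      by (intro exI[of _ "\<lambda>n. \<xi> n * \<xi> n"] exI[of _ k]) simp
  qed
  then obtain e k2 where e: "bounded_cmult e" "\<And>n. n > 0 \<Longrightarrow> (norm (\<xi> n) = 1 \<and> e n = (\<xi> n)\<^sup>2) \<or> \<xi> n = 0"
    "((\<lambda>x::real. of_real x * dser (\<lambda>n. e n * mangoldt n) (Complex 1 (2 * t) + of_real x)) \<longlongrightarrow> - of_nat k2) (at_right 0)"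
    by blast
  define H where "H = (\<lambda>x::real. 3 * Re (of_real x * dser (\<lambda>n. mangoldt n) (Complex 1 0 + of_real x))
     + 4 * Re (of_real x * dser (\<lambda>n. \<xi> n * mangoldt n) (Complex 1 t + of_real x))
     + Re (of_real x * dser (\<lambda>n. e n * mangoldt n) (Complex 1 (2 * t) + of_real x)))"
  have "(H \<longlongrightarrow> 3 * Re 1 + 4 * Re (- of_nat k1) + Re (- of_nat k2)) (at_right 0)"
    unfolding H_def by (intro tendsto_add tendsto_mult tendsto_const tendsto_Re k0 k1(2) e(3))
  moreover have "eventually (\<lambda>x. H x \<ge> 0) (at_right 0)"
    using eventually_at_right_less[of 0]
  proof eventually_elim
    case (elim x)
    have "H x = x * (3 * Re (dser (\<lambda>n. mangoldt n) (Complex 1 0 + of_real x)) + 4 * Re (dser (\<lambda>n. \<xi> n * mangoldt n) (Complex 1 t + of_real x))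
      + Re (dser (\<lambda>n. e n * mangoldt n) (Complex 1 (2 * t) + of_real x)))"
      unfolding H_def Re_complex_of_real Re_divide_of_real by (simp add: algebra_simps)
    thus ?case
      using mangoldt_dser_three_four_one[OF bounded_cmult_dchar[OF \<xi>(1,2)] e(1) elim e(2), of t] elim by simp
  qed
  ultimately have "0 \<le> 3 * Re 1 + 4 * Re (- of_nat k1) + Re (- of_nat k2)"
    by (intro tendsto_lowerbound[of H _ "at_right 0"]) auto
  thus False using k1(1) by simp
qed

section \<open>Summation by parts and sums over lattice points under a hyperbola\<close>

lemma summation_by_parts:
  fixes a :: "nat \<Rightarrow> 'a :: real_normed_vector" and b :: "nat \<Rightarrow> real"
  shows "(\<Sum>n<N. b n *\<^sub>R a n) = (\<Sum>n<N. (b n - b (Suc n)) *\<^sub>R (\<Sum>k<Suc n. a k)) + b N *\<^sub>R (\<Sum>k<N. a k)"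
  by (induction N) (simp_all add: scaleR_add_right scaleR_diff_left)

lemma abel_decreasing:
  fixes a :: "nat \<Rightarrow> 'a :: real_normed_vector" and b :: "nat \<Rightarrow> real"
  assumes A: "\<And>n. norm (\<Sum>k<n. a k) \<le> A" and b: "\<And>n. b (Suc n) \<le> b n" "\<And>n. b n \<ge> 0"
  shows "norm (\<Sum>n<N. b n *\<^sub>R a n) \<le> A * b 0"
proof -
  have "norm (\<Sum>n<N. b n *\<^sub>R a n) \<le> norm (\<Sum>n<N. (b n - b (Suc n)) *\<^sub>R (\<Sum>k<Suc n. a k)) + norm (b N *\<^sub>R (\<Sum>k<N. a k))"
    by (subst summation_by_parts) (rule norm_triangle_ineq)
  also have "\<dots> \<le> (\<Sum>n<N. (b n - b (Suc n)) * A) + b N * A"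
  proof (intro add_mono sum_norm_le)
    fix n
    have "norm ((b n - b (Suc n)) *\<^sub>R (\<Sum>k<Suc n. a k)) = (b n - b (Suc n)) * norm (\<Sum>k<Suc n. a k)"
      using b(1)[of n] by simp
    also have "\<dots> \<le> (b n - b (Suc n)) * A"
      using b(1)[of n] by (intro mult_left_mono A) auto
    finally show "norm ((b n - b (Suc n)) *\<^sub>R (\<Sum>k<Suc n. a k)) \<le> (b n - b (Suc n)) * A" .
  next
    have "norm (b N *\<^sub>R (\<Sum>k<N. a k)) = b N * norm (\<Sum>k<N. a k)" using b(2) by simp
    also have "\<dots> \<le> b N * A" using b(2) by (intro mult_left_mono A) auto
    finally show "norm (b N *\<^sub>R (\<Sum>k<N. a k)) \<le> b N * A" .
  qed
  also have "(\<Sum>n<N. (b n - b (Suc n)) * A) = (b 0 - b N) * A"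
    unfolding sum_distrib_right[symmetric] by (simp only: sum_lessThan_telescope')
  finally show ?thesis by (simp add: algebra_simps)
qed

text \<open>The partial sums are controlled only up to \<open>Suc N\<close>, so that A may depend on
  N. The factor 2 comes from the total variation b N - b 0 together with the last value b N.\<close>

lemma abel_increasing:
  fixes a :: "nat \<Rightarrow> 'a :: real_normed_vector" and b :: "nat \<Rightarrow> real"
  assumes A: "\<And>n. n \<le> Suc N \<Longrightarrow> norm (\<Sum>k<n. a k) \<le> A" and b: "\<And>n. n < N \<Longrightarrow> b n \<le> b (Suc n)" "b 0 \<ge> 0"
  shows "norm (\<Sum>n<Suc N. b n *\<^sub>R a n) \<le> 2 * A * b N"
proof -
  have A0: "A \<ge> 0" using A[of 0] by simp
  have mono: "n \<le> N \<Longrightarrow> b 0 \<le> b n" for n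
    by (induction n) (use b(1) in \<open>auto intro: order_trans\<close>)
  have bN: "b N \<ge> 0" using mono[of N] b(2) by simp
  have eq: "(\<Sum>n<Suc N. b n *\<^sub>R a n) = (\<Sum>n<N. (b n - b (Suc n)) *\<^sub>R (\<Sum>k<Suc n. a k)) + b N *\<^sub>R (\<Sum>k<Suc N. a k)"
    unfolding sum.lessThan_Suc[of _ N] summation_by_parts[of b a N] by (simp add: scaleR_add_right)
  have "norm (\<Sum>n<Suc N. b n *\<^sub>R a n) \<le> norm (\<Sum>n<N. (b n - b (Suc n)) *\<^sub>R (\<Sum>k<Suc n. a k)) + norm (b N *\<^sub>R (\<Sum>k<Suc N. a k))"
    unfolding eq by (rule norm_triangle_ineq)
  also have "\<dots> \<le> (\<Sum>n<N. (b (Suc n) - b n) * A) + b N * A"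
  proof (intro add_mono sum_norm_le)
    fix n assume n: "n \<in> {..<N}"
    hence "norm ((b n - b (Suc n)) *\<^sub>R (\<Sum>k<Suc n. a k)) = (b (Suc n) - b n) * norm (\<Sum>k<Suc n. a k)"
      using b(1)[of n] by simp
    also have "\<dots> \<le> (b (Suc n) - b n) * A"
      using n b(1)[of n] by (intro mult_left_mono A) auto
    finally show "norm ((b n - b (Suc n)) *\<^sub>R (\<Sum>k<Suc n. a k)) \<le> (b (Suc n) - b n) * A" .
  next
    have "norm (b N *\<^sub>R (\<Sum>k<Suc N. a k)) = b N * norm (\<Sum>k<Suc N. a k)" using bN by simp
    also have "\<dots> \<le> b N * A" using bN by (intro mult_left_mono A) auto
    finally show "norm (b N *\<^sub>R (\<Sum>k<Suc N. a k)) \<le> b N * A" .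
  qed
  also have "(\<Sum>n<N. (b (Suc n) - b n) * A) = (b N - b 0) * A"
    unfolding sum_distrib_right[symmetric] by (simp only: sum_lessThan_telescope)
  also have "(b N - b 0) * A + b N * A \<le> 2 * A * b N"
    using mult_nonneg_nonneg[OF b(2) A0] by (simp add: algebra_simps)
  finally show ?thesis .
qed

text \<open>Both sides enumerate the lattice points with d k \<le> N, once along hyperbolas and once
  by columns.\<close>

lemma sum_divpairs:
  fixes f :: "nat \<Rightarrow> nat \<Rightarrow> 'a :: comm_monoid_add"
  shows "(\<Sum>j=1..N. \<Sum>p\<in>divpairs j. f (fst p) (snd p)) = (\<Sum>d=1..N. \<Sum>k=1..N div d. f d k)"
proof -
  have "(\<Sum>j=1..N. \<Sum>p\<in>divpairs j. f (fst p) (snd p)) = (\<Sum>x\<in>(SIGMA j:{1..N}. divpairs j). f (fst (snd x)) (snd (snd x)))"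
    by (subst sum.Sigma) (auto simp: finite_divpairs case_prod_unfold)
  also have "\<dots> = (\<Sum>x\<in>(SIGMA d:{1..N}. {1..N div d}). f (fst x) (snd x))"
  proof (rule sum.reindex_bij_witness[where j=snd and i="\<lambda>(d, k). (d * k, (d, k))"])
    fix a assume "a \<in> (SIGMA j:{1..N}. divpairs j)"
    then obtain d k where a: "a = (d * k, (d, k))" "1 \<le> d * k" "d * k \<le> N" by (auto simp: divpairs_def)
    hence "d > 0" "k > 0" by (auto intro: Nat.gr0I)
    moreover have "d \<le> N" using a(3) \<open>k > 0\<close> by (metis One_nat_def Suc_leI le_trans mult.right_neutral mult_le_mono2)
    moreover have "k \<le> N div d" using a(3) \<open>d > 0\<close> by (simp add: less_eq_div_iff_mult_less_eq mult.commute)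
    ultimately show "snd a \<in> (SIGMA d:{1..N}. {1..N div d})" using a by auto
    show "(case snd a of (d, k) \<Rightarrow> (d * k, (d, k))) = a" using a by simp
    show "f (fst (snd a)) (snd (snd a)) = f (fst (snd a)) (snd (snd a))" ..
  next
    fix b assume "b \<in> (SIGMA d:{1..N}. {1..N div d})"
    then obtain d k where b: "b = (d, k)" "1 \<le> d" "d \<le> N" "1 \<le> k" "k \<le> N div d" by auto
    have "d * k \<le> N" using b by (simp add: less_eq_div_iff_mult_less_eq mult.commute)
    thus "(case b of (d, k) \<Rightarrow> (d * k, (d, k))) \<in> (SIGMA j:{1..N}. divpairs j)"
      using b by (auto simp: divpairs_def)
    show "snd (case b of (d, k) \<Rightarrow> (d * k, (d, k))) = b" using b by simp
  qed
  also have "\<dots> = (\<Sum>d=1..N. \<Sum>k=1..N div d. f d k)"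
    by (subst sum.Sigma) (auto simp: case_prod_unfold)
  finally show ?thesis .
qed

lemma sum_dconv: "(\<Sum>j=1..N. dconv f g j) = (\<Sum>d=1..N. f d * (\<Sum>k=1..N div d. g k))"
  unfolding dconv_def sum_divpairs[of "\<lambda>d k. f d * g k"] by (simp add: sum_distrib_left)

section \<open>Real characters at s = 1, by Monsky's Lambert series argument\<close>

lemma divisors_prime_power_mult:
  assumes p: "prime (p::nat)" and m: "\<not> p dvd m"
  shows "bij_betw (\<lambda>(i, e). p ^ i * e) ({..a} \<times> {e. e dvd m}) {d. d dvd p ^ a * m}"
  unfolding bij_betw_def
proof
  show "inj_on (\<lambda>(i, e). p ^ i * e) ({..a} \<times> {e. e dvd m})"
  proof (rule inj_onI, clarify)
    fix i e j e' assume *: "e dvd m" "e' dvd m" "p ^ i * e = p ^ j * e'"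
    have "\<not> p dvd e" "\<not> p dvd e'" using * m dvd_trans by blast+
    moreover have "multiplicity p (p ^ i * e) = i" if "\<not> p dvd e" for i e
      by (rule multiplicity_eqI) (use p that in auto)
    ultimately have "i = j" using *(3) by metis
    thus "i = j \<and> e = e'" using * p by auto
  qed
  show "(\<lambda>(i, e). p ^ i * e) ` ({..a} \<times> {e. e dvd m}) = {d. d dvd p ^ a * m}"
  proof (intro equalityI subsetI)
    fix d assume "d \<in> {d. d dvd p ^ a * m}"
    then obtain b c where bc: "d = b * c" "b dvd p ^ a" "c dvd m" using division_decomp by blast
    then obtain i where "i \<le> a" "b = p ^ i" using p divides_primepow_nat by blast
    thus "d \<in> (\<lambda>(i, e). p ^ i * e) ` ({..a} \<times> {e. e dvd m})" using bc by auto
  qed (auto intro!: mult_dvd_mono le_imp_power_dvd)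
qed

text \<open>By multiplicativity only prime powers p^a matter. There the sum of c(p)^i over i \<le> a
  is a + 1 for c(p) = 1, it is 1 for c(p) = 0, and for c(p) = -1 it is 1 or 0 according as a is even
  or odd.\<close>

lemma real_character_divisor_sum:
  fixes c :: "nat \<Rightarrow> real"
  assumes c: "\<And>a b. c (a * b) = c a * c b" "c (Suc 0) = 1" "\<And>n. c n \<in> {-1, 0, 1}"
  shows "n > 0 \<Longrightarrow> (\<Sum>d | d dvd n. c d) \<ge> 0" "k > 0 \<Longrightarrow> (\<Sum>d | d dvd k\<^sup>2. c d) \<ge> 1"
proof -
  have cpow: "c (p ^ i) = c p ^ i" for p i by (induction i) (simp_all add: c)
  have split: "(\<Sum>d | d dvd p ^ a * m. c d) = (\<Sum>i\<le>a. c p ^ i) * (\<Sum>d | d dvd m. c d)"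
    if "prime p" "\<not> p dvd m" for p a m
  proof -
    have "(\<Sum>d | d dvd p ^ a * m. c d) = (\<Sum>x\<in>{..a} \<times> {e. e dvd m}. c (case x of (i, e) \<Rightarrow> p ^ i * e))"
      by (rule sum.reindex_bij_betw[OF divisors_prime_power_mult[OF that], symmetric])
    also have "\<dots> = (\<Sum>(i, e)\<in>{..a} \<times> {e. e dvd m}. c p ^ i * c e)"
      by (intro sum.cong refl) (auto simp: c(1) cpow)
    also have "\<dots> = (\<Sum>i\<le>a. c p ^ i) * (\<Sum>d | d dvd m. c d)"
      by (simp add: sum_product sum.cartesian_product)
    finally show ?thesis .
  qed
  have alt: "(\<Sum>i\<le>a. (-1) ^ i) = (if even a then 1 else 0 :: real)" for a by (induction a) auto
  have g0: "(\<Sum>i\<le>a. c p ^ i) \<ge> 0" and g1: "even a \<Longrightarrow> (\<Sum>i\<le>a. c p ^ i) \<ge> 1" for p a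
    using c(3)[of p] by (auto simp: alt power_0_left)
  show "n > 0 \<Longrightarrow> (\<Sum>d | d dvd n. c d) \<ge> 0"
  proof (induction n rule: less_induct)
    case (less n)
    show ?case
    proof (cases "n = 1")
      case False
      then obtain p where p: "prime p" "p dvd n" using prime_factor_nat by blast
      obtain a m where n: "n = p ^ a * m" "\<not> p dvd m"
        using multiplicity_decompose'[of n p] p less.prems by (metis not_prime_unit neq0_conv)
      have "a \<noteq> 0" using n p by (metis mult.left_neutral power_0)
      hence "p ^ a > 1" using prime_gt_1_nat[OF p(1)] one_less_power by blast
      hence m: "m < n" "m > 0" using n less.prems by auto
      show ?thesis unfolding n(1) split[OF p(1) n(2)] using g0[of p a] less.IH[OF m] by simp
    qed (simp add: c(2))
  qed
  show "k > 0 \<Longrightarrow> (\<Sum>d | d dvd k\<^sup>2. c d) \<ge> 1"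
  proof (induction k rule: less_induct)
    case (less k)
    show ?case
    proof (cases "k = 1")
      case False
      then obtain p where p: "prime p" "p dvd k" using prime_factor_nat by blast
      obtain a m where k: "k = p ^ a * m" "\<not> p dvd m"
        using multiplicity_decompose'[of k p] p less.prems by (metis not_prime_unit neq0_conv)
      have "a \<noteq> 0" using k p by (metis mult.left_neutral power_0)
      hence "p ^ a > 1" using prime_gt_1_nat[OF p(1)] one_less_power by blast
      hence m: "m < k" "m > 0" using k less.prems by auto
      have k2: "k\<^sup>2 = p ^ (2 * a) * m\<^sup>2" using k by (simp add: power_mult_distrib power_mult mult.commute)
      have "\<not> p dvd m\<^sup>2" using k(2) p(1) prime_dvd_power by blast
      have "1 * 1 \<le> (\<Sum>i\<le>2 * a. c p ^ i) * (\<Sum>d | d dvd m\<^sup>2. c d)"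
        using g1[of "2 * a" p] less.IH[OF m] by (intro mult_mono) auto
      thus ?thesis unfolding k2 split[OF p(1) \<open>\<not> p dvd m\<^sup>2\<close>] by simp
    qed (simp add: c(2))
  qed
qed

text \<open>The inequality of arithmetic and geometric means for 1, x, ..., x^n, obtained by pairing
  x^i with x^(n - i).\<close>

lemma geometric_sum_lower_bound:
  fixes x y :: real
  assumes "x = y\<^sup>2" "y \<ge> 0"
  shows "real (Suc n) * y ^ n \<le> (\<Sum>i\<le>n. x ^ i)"
proof -
  have "2 * (real (Suc n) * y ^ n) = (\<Sum>i\<le>n. 2 * y ^ n)" by simp
  also have "\<dots> \<le> (\<Sum>i\<le>n. x ^ i + x ^ (n - i))"
  proof (rule sum_mono)
    fix i assume i: "i \<in> {..n}"
    have "0 \<le> (y ^ i - y ^ (n - i))\<^sup>2" by simp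
    also have "\<dots> = x ^ i + x ^ (n - i) - 2 * (y ^ i * y ^ (n - i))"
      unfolding assms(1) by (simp add: power2_eq_square algebra_simps power_mult_distrib)
    also have "y ^ i * y ^ (n - i) = y ^ n" using i by (simp flip: power_add)
    finally show "2 * y ^ n \<le> x ^ i + x ^ (n - i)" by simp
  qed
  also have "\<dots> = 2 * (\<Sum>i\<le>n. x ^ i)"
    using sum.atLeastAtMost_rev[of "\<lambda>i. x ^ i" 0 n] by (simp add: sum.distrib atMost_atLeast0)
  finally show ?thesis by simp
qed

text \<open>Monsky's sequence: it decreases because the geometric mean of \<open>1, x, \<dots>, x\<^sup>n\<close> is at most
  the arithmetic mean.\<close>

definition monsky :: "real \<Rightarrow> nat \<Rightarrow> real" where
  "monsky x n = 1 / (real n * (1 - x)) - x ^ n / (1 - x ^ n)"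

lemma monsky_props:
  assumes x: "0 < x" "x < 1"
  shows "monsky x (Suc 0) = 1" "monsky x (Suc n) \<ge> 0" "monsky x (Suc (Suc n)) \<le> monsky x (Suc n)"
proof -
  define S where "S = (\<lambda>n. \<Sum>i\<le>n. x ^ i)"
  have S: "1 - x ^ Suc n = (1 - x) * S n" for n
    unfolding S_def one_diff_power_eq lessThan_Suc_atMost ..
  have Spos: "S n > 0" for n unfolding S_def using x by (intro sum_pos) auto
  define y where "y = sqrt x"
  have y: "x = y\<^sup>2" "y > 0" "y < 1" using x by (auto simp: y_def)
  have lb: "real (Suc n) * y ^ n \<le> S n" for n
    unfolding S_def by (rule geometric_sum_lower_bound) (use y in auto)
  have form: "monsky x (Suc n) = (1 / (1 - x)) * (1 / real (Suc n) - x ^ Suc n / S n)" for n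
    unfolding monsky_def S by (simp add: right_diff_distrib mult.commute del: of_nat_Suc power_Suc)
  show "monsky x (Suc 0) = 1" using x by (simp add: monsky_def diff_divide_distrib[symmetric])
  have yx: "x ^ n \<le> y ^ k" if "k \<le> 2 * n" for n k
  proof -
    have "x ^ n = y ^ (2 * n)" unfolding y(1) by (simp add: power_mult)
    also have "\<dots> \<le> y ^ k" using that y by (intro power_decreasing) auto
    finally show ?thesis .
  qed
  have "real (Suc n) * x ^ Suc n \<le> S n"
  proof -
    have "x ^ Suc n \<le> y ^ n" by (rule yx) simp
    hence "real (Suc n) * x ^ Suc n \<le> real (Suc n) * y ^ n" by (intro mult_left_mono) auto
    thus ?thesis using lb[of n] by (rule order_trans)
  qed
  hence "x ^ Suc n / S n \<le> 1 / real (Suc n)" using Spos[of n] by (simp add: field_simps del: of_nat_Suc power_Suc)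
  thus "monsky x (Suc n) \<ge> 0" unfolding form using x by simp
  \<comment> \<open>The mean inequalities for n and n + 1 are multiplied. Their powers of y combine
    to y^(2n + 1), which is at least x^(n + 1) = y^(2n + 2).\<close>
  have "real (Suc n) * real (Suc (Suc n)) * x ^ Suc n \<le> real (Suc n) * real (Suc (Suc n)) * y ^ (n + Suc n)"
    by (intro mult_left_mono yx) auto
  also have "\<dots> = (real (Suc n) * y ^ n) * (real (Suc (Suc n)) * y ^ Suc n)" by (simp only: power_add mult_ac)
  also have "\<dots> \<le> S n * S (Suc n)" using y Spos[of n] by (intro mult_mono lb) (auto intro: less_imp_le)
  finally have key: "real (Suc n) * real (Suc (Suc n)) * x ^ Suc n \<le> S n * S (Suc n)" .
  have "x ^ Suc n / S n - x ^ Suc (Suc n) / S (Suc n) = x ^ Suc n * (S (Suc n) - x * S n) / (S n * S (Suc n))"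
    using Spos[of n] Spos[of "Suc n"] by (simp add: field_simps)
  also have "S (Suc n) - x * S n = 1"
    unfolding S_def sum_distrib_left by (simp add: sum.atMost_Suc_shift del: sum.atMost_Suc)
  also have "x ^ Suc n * 1 / (S n * S (Suc n)) \<le> 1 / (real (Suc n) * real (Suc (Suc n)))"
    using key Spos[of n] Spos[of "Suc n"] by (simp add: field_simps del: of_nat_Suc power_Suc)
  also have "\<dots> = 1 / real (Suc n) - 1 / real (Suc (Suc n))" by (simp add: field_simps)
  finally have "1 / real (Suc (Suc n)) - x ^ Suc (Suc n) / S (Suc n) \<le> 1 / real (Suc n) - x ^ Suc n / S n" by simp
  thus "monsky x (Suc (Suc n)) \<le> monsky x (Suc n)" unfolding form using x by (intro mult_left_mono) auto
qed

text \<open>The left side is a truncated Lambert series. For fixed n its terms sum to c(n) x^n / (1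
  - x^n) up to an error x^N / (1 - x) from the cut-off, and \<open>monsky\<close> is the difference
  between 1 / (n (1 - x)) and this quotient. The first part collects the partial sum of c(n) / n;
  the second is at most A by monotonicity of \<open>monsky\<close> and its value 1 at n = 1.\<close>

lemma lambert_sum_bound:
  fixes c :: "nat \<Rightarrow> real"
  assumes c: "\<And>n. \<bar>c n\<bar> \<le> 1" and A: "\<And>n. \<bar>\<Sum>k<n. c (Suc k)\<bar> \<le> A" and x: "0 < x" "x < 1"
  shows "(\<Sum>j=1..N. (\<Sum>d | d dvd j. c d) * x ^ j) \<le> A + \<bar>\<Sum>n=1..N. c n / real n\<bar> / (1 - x) + real N * x ^ N / (1 - x)"
proof -
  have "(\<Sum>j=1..N. (\<Sum>d | d dvd j. c d) * x ^ j) = (\<Sum>j=1..N. \<Sum>p\<in>divpairs j. c (fst p) * x ^ (fst p * snd p))"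
  proof (rule sum.cong[OF refl])
    fix j assume j: "j \<in> {1..N}"
    have "(\<Sum>d | d dvd j. c d) = (\<Sum>p\<in>divpairs j. c (fst p))"
      using dconv_divisors[of j c "\<lambda>_. 1"] j by (simp add: dconv_def)
    thus "(\<Sum>d | d dvd j. c d) * x ^ j = (\<Sum>p\<in>divpairs j. c (fst p) * x ^ (fst p * snd p))"
      by (simp add: sum_distrib_right divpairs_def)
  qed
  also have "\<dots> = (\<Sum>n=1..N. \<Sum>k=1..N div n. c n * x ^ (n * k))" by (rule sum_divpairs)
  also have "\<dots> \<le> (\<Sum>n=1..N. c n / real n / (1 - x) - c n * monsky x n + x ^ N / (1 - x))"
  proof (rule sum_mono)
    fix n assume n: "n \<in> {1..N}"
    define K where "K = N div n"
    have y1: "x ^ n < 1" using x n by (simp add: power_less_one_iff)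
    have "N < n * Suc K" unfolding K_def using n dividend_less_times_div[of n N] by (simp add: algebra_simps)
    have "x ^ n \<le> x ^ 1" using x n by (intro power_decreasing) auto
    hence nx: "1 - x \<le> 1 - x ^ n" by simp
    have "(\<Sum>k=1..K. c n * x ^ (n * k)) = c n * (\<Sum>k=1..K. (x ^ n) ^ k)"
      by (simp add: sum_distrib_left power_mult)
    also have "(\<Sum>k=1..K. (x ^ n) ^ k) = (x ^ n - (x ^ n) ^ Suc K) / (1 - x ^ n)"
    proof -
      have "(1 - z) * (\<Sum>k=1..K. z ^ k) = z - z ^ Suc K" for z :: real
      proof (induction K)
        case (Suc K)
        have "(1 - z) * (\<Sum>k=1..Suc K. z ^ k) = (1 - z) * (\<Sum>k=1..K. z ^ k) + (1 - z) * z ^ Suc K"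
          by (simp add: distrib_left)
        also have "(1 - z) * (\<Sum>k=1..K. z ^ k) = z - z ^ Suc K" by (rule Suc)
        also have "z - z ^ Suc K + (1 - z) * z ^ Suc K = z - z ^ Suc (Suc K)" by (simp add: algebra_simps)
        finally show ?case .
      qed simp
      from this[of "x ^ n"] y1 show ?thesis by (simp add: field_simps)
    qed
    also have "c n * \<dots> = c n * (x ^ n / (1 - x ^ n)) + (- c n) * ((x ^ n) ^ Suc K / (1 - x ^ n))"
      by (simp add: diff_divide_distrib algebra_simps)
    also have "x ^ n / (1 - x ^ n) = 1 / (real n * (1 - x)) - monsky x n" by (simp add: monsky_def)
    also have "(- c n) * ((x ^ n) ^ Suc K / (1 - x ^ n)) \<le> 1 * (x ^ N / (1 - x))"
    proof (rule mult_mono)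
      show "- c n \<le> 1" using c[of n] by simp
      have "(x ^ n) ^ Suc K = x ^ (n * Suc K)" by (simp only: power_mult)
      also have "\<dots> \<le> x ^ N" using x \<open>N < n * Suc K\<close> by (intro power_decreasing) auto
      finally show "(x ^ n) ^ Suc K / (1 - x ^ n) \<le> x ^ N / (1 - x)" using x nx by (intro frac_le) auto
    qed (use y1 x in auto)
    finally show "(\<Sum>k=1..N div n. c n * x ^ (n * k)) \<le> c n / real n / (1 - x) - c n * monsky x n + x ^ N / (1 - x)"
      by (simp add: K_def algebra_simps)
  qed
  also have "\<dots> = (\<Sum>n=1..N. c n / real n) / (1 - x) - (\<Sum>n=1..N. c n * monsky x n) + real N * x ^ N / (1 - x)"
    by (simp add: sum.distrib sum_subtractf sum_divide_distrib)
  also have "(\<Sum>n=1..N. c n / real n) / (1 - x) \<le> \<bar>\<Sum>n=1..N. c n / real n\<bar> / (1 - x)"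
    using x by (intro divide_right_mono) auto
  also have "- (\<Sum>n=1..N. c n * monsky x n) \<le> A"
  proof -
    have "norm (\<Sum>n<N. monsky x (Suc n) *\<^sub>R c (Suc n)) \<le> A * monsky x (Suc 0)"
      by (rule abel_decreasing) (use A monsky_props[OF x] in auto)
    thus ?thesis using monsky_props(1)[OF x] by (simp add: sum.atLeast1_atMost_eq mult.commute)
  qed
  hence "\<bar>\<Sum>n=1..N. c n / real n\<bar> / (1 - x) - (\<Sum>n=1..N. c n * monsky x n) + real N * x ^ N / (1 - x)
     \<le> A + \<bar>\<Sum>n=1..N. c n / real n\<bar> / (1 - x) + real N * x ^ N / (1 - x)" by simp
  finally show ?thesis by simp
qed

text \<open>If the series at 1 were 0, letting N grow in \<open>lambert_sum_bound\<close> would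
  leave the bound A for every x < 1. But the squares alone contribute at least x^1 + x^4 + ... +
  x^(K^2), which tends to K > A as x tends to 1.\<close>

lemma real_character_L1_nonzero:
  fixes c :: "nat \<Rightarrow> real"
  assumes c: "\<And>a b. c (a * b) = c a * c b" "c (Suc 0) = 1" "\<And>n. c n \<in> {-1, 0, 1}"
    and A: "\<And>n. \<bar>\<Sum>k<n. c (Suc k)\<bar> \<le> A"
  shows "\<not> (\<lambda>n. c (Suc n) / real (Suc n)) sums 0"
proof
  assume z: "(\<lambda>n. c (Suc n) / real (Suc n)) sums 0"
  define r where "r = (\<lambda>j. \<Sum>d | d dvd j. c d)"
  have rc: "n > 0 \<Longrightarrow> r n \<ge> 0" "k > 0 \<Longrightarrow> r (k\<^sup>2) \<ge> 1" for n k
    unfolding r_def by (rule real_character_divisor_sum[OF c]; assumption)+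
  have c1: "\<bar>c n\<bar> \<le> 1" for n using c(3)[of n] by auto
  obtain K :: nat where K: "real K > A" using reals_Archimedean2 by blast
  have bound: "(\<Sum>k=1..K. x ^ (k\<^sup>2)) \<le> A" if x: "0 < x" "x < 1" for x
  proof -
    have "(\<lambda>N. A + \<bar>\<Sum>n=1..N. c n / real n\<bar> / (1 - x) + real N * x ^ N / (1 - x)) \<longlonglongrightarrow> A + \<bar>0\<bar> / (1 - x) + 0 / (1 - x)"
    proof (intro tendsto_add tendsto_divide tendsto_rabs tendsto_const)
      show "(\<lambda>N. \<Sum>n=1..N. c n / real n) \<longlonglongrightarrow> 0" using z unfolding sums_def sum.atLeast1_atMost_eq One_nat_def .
      show "(\<lambda>N. real N * x ^ N) \<longlonglongrightarrow> 0" using powser_times_n_limit_0[of x] x by simp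
    qed (use x in auto)
    hence lim: "(\<lambda>N. A + \<bar>\<Sum>n=1..N. c n / real n\<bar> / (1 - x) + real N * x ^ N / (1 - x)) \<longlonglongrightarrow> A" by simp
    moreover have "\<forall>N\<ge>K\<^sup>2. (\<Sum>k=1..K. x ^ (k\<^sup>2)) \<le> A + \<bar>\<Sum>n=1..N. c n / real n\<bar> / (1 - x) + real N * x ^ N / (1 - x)"
    proof (intro allI impI)
      fix N assume N: "N \<ge> K\<^sup>2"
      have "(\<Sum>k=1..K. x ^ (k\<^sup>2)) \<le> (\<Sum>k=1..K. r (k\<^sup>2) * x ^ (k\<^sup>2))"
      proof (rule sum_mono)
        fix k assume "k \<in> {1..K}"
        hence "1 \<le> r (k\<^sup>2)" using rc(2)[of k] by simp
        thus "x ^ (k\<^sup>2) \<le> r (k\<^sup>2) * x ^ (k\<^sup>2)" using x mult_right_mono[of 1 "r (k\<^sup>2)" "x ^ (k\<^sup>2)"] by simp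
      qed
      also have "\<dots> = (\<Sum>j\<in>(\<lambda>k. k\<^sup>2) ` {1..K}. r j * x ^ j)"
        by (subst sum.reindex) (auto simp: inj_on_def)
      also have "\<dots> \<le> (\<Sum>j=1..N. r j * x ^ j)"
      proof (rule sum_mono2)
        show "(\<lambda>k. k\<^sup>2) ` {1..K} \<subseteq> {1..N}"
        proof (clarify)
          fix k assume k: "k \<in> {1..K}"
          hence "k\<^sup>2 \<le> K\<^sup>2" by (intro power_mono) auto
          from this N have "k\<^sup>2 \<le> N" by (rule order_trans)
          thus "k\<^sup>2 \<in> {1..N}" using k by (auto simp: Suc_le_eq)
        qed
        show "0 \<le> r j * x ^ j" if "j \<in> {1..N} - (\<lambda>k. k\<^sup>2) ` {1..K}" for j
          using rc(1)[of j] that x by (intro mult_nonneg_nonneg) auto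
      qed simp
      also have "\<dots> \<le> A + \<bar>\<Sum>n=1..N. c n / real n\<bar> / (1 - x) + real N * x ^ N / (1 - x)"
        unfolding r_def by (rule lambert_sum_bound[OF c1 A x])
      finally show "(\<Sum>k=1..K. x ^ (k\<^sup>2)) \<le> A + \<bar>\<Sum>n=1..N. c n / real n\<bar> / (1 - x) + real N * x ^ N / (1 - x)" .
    qed
    ultimately show ?thesis
      by (intro tendsto_lowerbound[OF lim]) (auto simp: eventually_at_top_linorder)
  qed
  have "((\<lambda>x::real. \<Sum>k=1..K. x ^ (k\<^sup>2)) \<longlongrightarrow> (\<Sum>k=1..K. 1 ^ (k\<^sup>2))) (at_left 1)"
    by (intro tendsto_sum tendsto_power tendsto_ident_at)
  moreover have "eventually (\<lambda>x::real. (\<Sum>k=1..K. x ^ (k\<^sup>2)) \<le> A) (at_left 1)"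
  proof -
    have "eventually (\<lambda>x::real. x \<in> {0<..<1}) (at_left 1)" by (rule eventually_at_left_real) simp
    thus ?thesis by (rule eventually_mono) (rule bound; simp)
  qed
  ultimately have "(\<Sum>k=1..K. 1 ^ (k\<^sup>2)) \<le> A"
    by (intro tendsto_upperbound[of "\<lambda>x::real. \<Sum>k=1..K. x ^ (k\<^sup>2)" _ "at_left 1"]) auto
  thus False using K by simp
qed

theorem Lser_nonzero:
  assumes \<xi>: "m > 0" "dchar m \<xi>" "\<xi> \<noteq> principal_dchar m" and s: "Re s \<ge> 1"
  shows "Lser \<xi> s \<noteq> 0"
proof (cases "Re s > 1")
  case True
  have "Lser \<xi> s = dser \<xi> s" by (rule Lser_eq_dser[OF dchar_Lser_bound[OF \<xi>]]) (use True in simp)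
  thus ?thesis using dser_cmult_nonzero[OF bounded_cmult_dchar[OF \<xi>(1,2)] True] by simp
next
  case False
  hence s1: "s = Complex 1 (Im s)" using s by (simp add: complex_eq_iff)
  show ?thesis
  proof (cases "Im s \<noteq> 0 \<or> (\<lambda>n. \<xi> n * \<xi> n) \<noteq> principal_dchar m")
    case True
    thus ?thesis using Lser_nonzero_341[OF \<xi> True] s1 by simp
  next
    case False
    \<comment> \<open>The case left open by \<open>Lser_nonzero_341\<close>: a real character at s =
      1.\<close>
    hence s: "s = 1" and sq: "\<xi> n * \<xi> n = principal_dchar m n" for n
      using s1 by (auto simp: complex_eq_iff dest: fun_cong[of _ _ n])
    define c where "c = (\<lambda>n. Re (\<xi> n))"
    have "\<xi> n \<in> {-1, 0, 1}" for n
    proof -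
      have "\<xi> n * \<xi> n = 1 \<or> \<xi> n = 0" using sq[of n] by (auto simp: principal_dchar_def)
      thus ?thesis by (auto simp: square_eq_1_iff)
    qed
    hence c: "\<xi> n = of_real (c n)" "c n \<in> {-1, 0, 1}" for n
      unfolding c_def by (cases "\<xi> n = 0"; cases "\<xi> n = 1"; force)+
    have c1: "c (a * b) = c a * c b" for a b
    proof -
      have "complex_of_real (c (a * b)) = of_real (c a * c b)"
        using dcharD(1)[OF \<xi>(2), of a b] by (simp add: c(1))
      thus ?thesis by (simp only: of_real_eq_iff)
    qed
    have c2: "c (Suc 0) = 1" using dchar_1[OF \<xi>(2)] by (simp add: c_def)
    have c3: "\<bar>\<Sum>k<n. c (Suc k)\<bar> \<le> real m + 1" for n
    proof -
      have "\<bar>\<Sum>k<n. c (Suc k)\<bar> = \<bar>Re (\<Sum>k<n. \<xi> (Suc k))\<bar>" by (simp add: c_def)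
      also have "\<dots> \<le> norm (\<Sum>k<n. \<xi> (Suc k))" by (rule abs_Re_le_cmod)
      also have "\<dots> \<le> real m + 1" by (rule dchar_Lser_bound[OF \<xi>])
      finally show ?thesis .
    qed
    have "\<not> (\<lambda>n. c (Suc n) / real (Suc n)) sums 0"
      by (rule real_character_L1_nonzero[OF c1 c2 c(2) c3])
    moreover have "(\<lambda>n. Re (\<xi> (Suc n) * of_nat (Suc n) powr (-1))) sums Re (Lser \<xi> 1)"
      by (intro sums_Re Lser_sums[OF dchar_Lser_bound[OF \<xi>]]) simp
    moreover have "Re (\<xi> (Suc n) * of_nat (Suc n) powr (-1)) = c (Suc n) / real (Suc n)" for n
    proof -
      have "complex_of_nat (Suc n) powr (-1) = of_real (1 / real (Suc n))"
        by (simp add: powr_minus divide_inverse del: of_nat_Suc)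
      thus ?thesis unfolding c(1) by (simp del: of_nat_Suc)
    qed
    ultimately show ?thesis using s by auto
  qed
qed

section \<open>Newman's Tauberian theorem\<close>

lemma powr_diff_MVT:
  fixes a b y :: real
  assumes "0 < a" "a < b"
  obtains t where "a < t" "t < b" "b powr y - a powr y = y * (b - a) * t powr (y - 1)"
proof -
  have "\<exists>t. t > a \<and> t < b \<and> b powr y - a powr y = (b - a) * (y * t powr (y - 1))"
    by (rule MVT2[OF assms(2)]) (use assms in \<open>auto intro!: derivative_eq_intros\<close>)
  thus ?thesis using that by (metis mult.assoc mult.commute)
qed

lemma powr_tail_bound:
  fixes x :: real
  assumes "x > 0" "N > 0"
  shows "(\<Sum>n=N..<M. real (Suc n) powr (-(x+1))) \<le> real N powr (-x) / x"
proof -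
  have step: "real (Suc n) powr (-(x+1)) \<le> (real n powr (-x) - real (Suc n) powr (-x)) / x" if n: "n > 0" for n
  proof -
    obtain t where t: "real n < t" "t < real (Suc n)"
      "real (Suc n) powr (-x) - real n powr (-x) = (-x) * (real (Suc n) - real n) * t powr (-x - 1)"
      by (rule powr_diff_MVT[of "real n" "real (Suc n)" "-x"]) (use n in auto)
    have "real (Suc n) powr (-x - 1) \<le> t powr (-x - 1)"
      using t n assms by (intro powr_mono2') auto
    hence "x * real (Suc n) powr (-x - 1) \<le> x * t powr (-x - 1)"
      using assms by simp
    also have "\<dots> = real n powr (-x) - real (Suc n) powr (-x)" using t(3) by simp
    finally have *: "x * real (Suc n) powr (-x - 1) \<le> real n powr (-x) - real (Suc n) powr (-x)" .
    have e: "-(x+1) = -x - 1" by simp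
    show ?thesis unfolding e using * assms by (simp add: pos_le_divide_eq mult.commute)
  qed
  show ?thesis
  proof (cases "N \<le> M")
    case True
    have "(\<Sum>n=N..<M. real (Suc n) powr (-(x+1))) \<le> (\<Sum>n=N..<M. (real n powr (-x) - real (Suc n) powr (-x)) / x)"
      by (intro sum_mono step) (use assms in auto)
    also have "\<dots> = (real N powr (-x) - real M powr (-x)) / x"
      unfolding sum_divide_distrib[symmetric]
      using sum_Suc_diff'[OF True, of "\<lambda>n. - (real n powr (-x))"] by simp
    also have "\<dots> \<le> real N powr (-x) / x" using assms by (simp add: field_simps)
    finally show ?thesis .
  qed (use assms in auto)
qed

text \<open>Comparison with the integral of t^(y - 1). For y > 1 the integrand increases, so each
  term is compared with the interval to its right; the last one falls outside and accounts for 1 /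
  N.\<close>

lemma powr_partial_bound:
  fixes y :: real
  assumes y: "y > 0" and "N > 0"
  shows "(\<Sum>n<N. real (Suc n) powr (y-1)) \<le> real N powr y * (1 / y + 1 / real N)"
proof (cases "y \<le> 1")
  case True
  have step: "real (Suc n) powr (y-1) \<le> (real (Suc n) powr y - real n powr y) / y" for n
  proof (cases "n = 0")
    case True thus ?thesis using y \<open>y \<le> 1\<close> by (simp add: field_simps)
  next
    case False
    obtain t where t: "real n < t" "t < real (Suc n)"
      "real (Suc n) powr y - real n powr y = y * (real (Suc n) - real n) * t powr (y - 1)"
      by (rule powr_diff_MVT[of "real n" "real (Suc n)" y]) (use False in auto)
    have "real (Suc n) powr (y - 1) \<le> t powr (y - 1)"
      using t True False by (intro powr_mono2') auto
    thus ?thesis using t(3) y by (simp add: field_simps)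
  qed
  have "(\<Sum>n<N. real (Suc n) powr (y-1)) \<le> (\<Sum>n<N. (real (Suc n) powr y - real n powr y) / y)"
    by (intro sum_mono step)
  also have "\<dots> = real N powr y / y"
    unfolding sum_divide_distrib[symmetric] using sum_lessThan_telescope[of "\<lambda>n. real n powr y" N] y by simp
  also have "\<dots> \<le> real N powr y * (1 / y + 1 / real N)" by (simp add: field_simps)
  finally show ?thesis .
next
  case False
  have step: "real (Suc n) powr (y-1) \<le> (real (Suc (Suc n)) powr y - real (Suc n) powr y) / y" for n
  proof -
    obtain t where t: "real (Suc n) < t" "t < real (Suc (Suc n))"
      "real (Suc (Suc n)) powr y - real (Suc n) powr y = y * (real (Suc (Suc n)) - real (Suc n)) * t powr (y - 1)"
      by (rule powr_diff_MVT[of "real (Suc n)" "real (Suc (Suc n))" y]) auto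
    have "real (Suc n) powr (y - 1) \<le> t powr (y - 1)"
      using t False by (intro powr_mono2) auto
    thus ?thesis using t(3) y by (simp add: field_simps)
  qed
  obtain M where M: "N = Suc M" using assms(2) by (cases N) auto
  have "(\<Sum>n<M. real (Suc n) powr (y-1)) \<le> (\<Sum>n<M. (real (Suc (Suc n)) powr y - real (Suc n) powr y) / y)"
    by (intro sum_mono step)
  also have "\<dots> = (real (Suc M) powr y - 1) / y"
    unfolding sum_divide_distrib[symmetric] using sum_lessThan_telescope[of "\<lambda>n. real (Suc n) powr y" M] by simp
  also have "\<dots> \<le> real N powr y / y" using M y by (simp add: field_simps)
  finally have "(\<Sum>n<N. real (Suc n) powr (y-1)) \<le> real N powr y / y + real N powr (y-1)"
    using M by simp
  also have "real N powr (y-1) = real N powr y / real N"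
    using assms(2) by (simp add: powr_diff)
  finally show ?thesis by (simp add: field_simps)
qed

text \<open>The kernel \<open>1 + z\<^sup>2/R\<^sup>2\<close> is Newman's: on the circle of radius R it equals \<open>2 z Re z / R\<^sup>2\<close>
  and absorbs the poles of the bounds for the tail and the partial sums.\<close>

lemma newman_kernel_norm:
  assumes "norm z = R" "R > 0"
  shows "norm ((1 + z\<^sup>2 / of_real (R\<^sup>2)) / z) = 2 * \<bar>Re z\<bar> / R\<^sup>2"
proof -
  have z: "z \<noteq> 0" using assms by auto
  have "z * cnj z = of_real (R\<^sup>2)" unfolding complex_norm_square[symmetric] assms by simp
  hence "(1 + z\<^sup>2 / of_real (R\<^sup>2)) / z = (cnj z + z) / of_real (R\<^sup>2)"
    using z assms by (simp add: field_simps power2_eq_square)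
  also have "cnj z + z = of_real (2 * Re z)" by (simp add: complex_eq_iff)
  finally show ?thesis by (simp add: norm_divide norm_power abs_mult del: of_real_mult of_real_power)
qed

text \<open>With Ln (-z) as primitive of 1/z off the nonnegative axis, the left path contributes i
  pi, as does the right semicircle. The left path is arbitrary so that the lemma serves both the
  polygon used for g and the semicircle used for the partial sums.\<close>

lemma winding_right_circle_left_path:
  assumes R: "R > 0" and p: "valid_path p" "pathstart p = \<i> * of_real R" "pathfinish p = - \<i> * of_real R"
    and im: "path_image p \<subseteq> - \<real>\<^sub>\<ge>\<^sub>0"
  shows "winding_number (part_circlepath 0 R (-pi/2) (pi/2) +++ p) 0 = 1"
proof -
  let ?c = "part_circlepath 0 R (-pi/2) (pi/2)"
  have ends: "pathstart ?c = - \<i> * of_real R" "pathfinish ?c = \<i> * of_real R"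
    using cis_conv_exp[of "pi/2"] cis_conv_exp[of "-(pi/2)"] by (simp_all add: cis_minus_pi_half)
  have 1: "((\<lambda>z. 1/z) has_contour_integral Ln (- pathfinish p) - Ln (- pathstart p)) p"
  proof (rule contour_integral_primitive[where S="- \<real>\<^sub>\<ge>\<^sub>0"])
    fix x assume "x \<in> - (\<real>\<^sub>\<ge>\<^sub>0 :: complex set)"
    hence "- x \<notin> \<real>\<^sub>\<le>\<^sub>0" "x \<noteq> 0"
      by (auto simp: complex_nonneg_Reals_iff complex_nonpos_Reals_iff)
    thus "((\<lambda>z. Ln (- z)) has_field_derivative 1 / x) (at x within - \<real>\<^sub>\<ge>\<^sub>0)"
      by (auto intro!: derivative_eq_intros simp: field_simps)
  qed (use p im in auto)
  have "Ln (- pathfinish p) - Ln (- pathstart p) = \<i> * pi"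
    using R Ln_times_of_real[of R \<i>] Ln_times_of_real[of R "-\<i>"] by (simp add: p mult.commute)
  with 1 have 1: "((\<lambda>z. 1/z) has_contour_integral \<i> * pi) p" by simp
  have nz: "0 \<notin> path_image ?c" using R by (auto simp: path_image_part_circlepath')
  have 2: "((\<lambda>z. 1/z) has_contour_integral \<i> * pi) ?c"
  proof -
    have "((\<lambda>t. 1 / (0 + R * cis t) * R * \<i> * cis t) has_integral \<i> * pi) {-pi/2..pi/2}"
    proof -
      have "((\<lambda>t. \<i>) has_integral (pi/2 - (-pi/2)) *\<^sub>R \<i>) {-pi/2..pi/2}"
        using has_integral_const_real[of \<i> "-pi/2" "pi/2"] by simp
      moreover have "(\<lambda>t. 1 / (0 + R * cis t) * R * \<i> * cis t) = (\<lambda>t. \<i>)"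
        using R by (auto simp: field_simps)
      moreover have "(pi/2 - (-pi/2)) *\<^sub>R \<i> = \<i> * pi" by (simp add: scaleR_conv_of_real)
      ultimately show ?thesis by metis
    qed
    thus ?thesis by (subst has_contour_integral_part_circlepath_iff) auto
  qed
  have "((\<lambda>z. 1/z) has_contour_integral (\<i> * pi + \<i> * pi)) (?c +++ p)"
    by (rule has_contour_integral_join[OF 2 1]) (use p in auto)
  moreover have "0 \<notin> path_image (?c +++ p)"
    using nz im ends p by (auto simp: path_image_join)
  moreover have "valid_path (?c +++ p)"
    using p ends by (intro valid_path_join) auto
  ultimately show ?thesis
    by (simp add: winding_number_valid_path contour_integral_unique)
qed


lemma newman_contour_formula:
  assumes R: "R > 0" and p: "valid_path p" "pathstart p = \<i> * of_real R" "pathfinish p = - \<i> * of_real R"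
    and im: "path_image p \<subseteq> - \<real>\<^sub>\<ge>\<^sub>0"
    and V: "convex V" "open V" "path_image p \<subseteq> V" "path_image (part_circlepath 0 R (-pi/2) (pi/2)) \<subseteq> V" "0 \<in> V"
    and f: "f holomorphic_on V"
  shows "contour_integral (part_circlepath 0 R (-pi/2) (pi/2)) (\<lambda>z. f z * ((1 + z\<^sup>2 / of_real (R\<^sup>2)) / z))
         + contour_integral p (\<lambda>z. f z * ((1 + z\<^sup>2 / of_real (R\<^sup>2)) / z)) = 2 * of_real pi * \<i> * f 0"
proof -
  let ?c = "part_circlepath 0 R (-pi/2) (pi/2)"
  let ?h = "\<lambda>z. f z * (1 + z\<^sup>2 / of_real (R\<^sup>2))"
  have ends: "pathstart ?c = - \<i> * of_real R" "pathfinish ?c = \<i> * of_real R"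
    using cis_conv_exp[of "pi/2"] cis_conv_exp[of "-(pi/2)"] by (simp_all add: cis_minus_pi_half)
  have nz: "0 \<notin> path_image ?c" using R by (auto simp: path_image_part_circlepath')
  have nzp: "0 \<notin> path_image p" using im by auto
  have pim: "path_image (?c +++ p) = path_image ?c \<union> path_image p"
    using ends p by (simp add: path_image_join)
  have hol: "?h holomorphic_on V" using R by (intro holomorphic_intros f) auto
  have "((\<lambda>w. ?h w / (w - 0)) has_contour_integral of_real (2 * pi) * \<i> * winding_number (?c +++ p) 0 * ?h 0) (?c +++ p)"
  proof (rule Cauchy_integral_formula_convex_simple[OF V(1) hol])
    show "0 \<in> interior V" using V by (simp add: interior_open)
    show "valid_path (?c +++ p)" using p ends by (intro valid_path_join) auto
    show "path_image (?c +++ p) \<subseteq> V - {0}" using V nz nzp pim by auto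
    show "pathfinish (?c +++ p) = pathstart (?c +++ p)" using p ends by simp
  qed
  hence *: "((\<lambda>z. f z * ((1 + z\<^sup>2 / of_real (R\<^sup>2)) / z)) has_contour_integral 2 * of_real pi * \<i> * f 0) (?c +++ p)"
  proof -
    assume A: "((\<lambda>w. ?h w / (w - 0)) has_contour_integral of_real (2 * pi) * \<i> * winding_number (?c +++ p) 0 * ?h 0) (?c +++ p)"
    have "(\<lambda>w. ?h w / (w - 0)) = (\<lambda>z. f z * ((1 + z\<^sup>2 / of_real (R\<^sup>2)) / z))"
      by (rule ext) (simp only: diff_zero times_divide_eq_right)
    moreover have "of_real (2 * pi) * \<i> * winding_number (?c +++ p) 0 * ?h 0 = 2 * of_real pi * \<i> * f 0"
      unfolding winding_right_circle_left_path[OF R p im] by simp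
    ultimately show ?thesis using A by metis
  qed
  have "contour_integral (?c +++ p) (\<lambda>z. f z * ((1 + z\<^sup>2 / of_real (R\<^sup>2)) / z)) = 2 * of_real pi * \<i> * f 0"
    using * by (rule contour_integral_unique)
  moreover have "(\<lambda>z. f z * ((1 + z\<^sup>2 / of_real (R\<^sup>2)) / z)) contour_integrable_on (?c +++ p)"
    using * by (auto simp: contour_integrable_on_def)
  ultimately show ?thesis
    using p ends by (subst (asm) contour_integral_join) (auto simp: contour_integrable_join)
qed

text \<open>Integration by parts against exp (z L) / L: the boundary terms vanish with h at the
  endpoints, and the exponential has norm at most 1 where Re z \<le> 0. In the application h is g
  times the kernel, whose zeros at iR and -iR supply these conditions.\<close>

lemma newman_left_integral_bound:
  assumes h: "h holomorphic_on W" "open W" "closed_segment a b \<subseteq> W" "closed_segment b c \<subseteq> W"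
    and z: "h a = 0" "h c = 0" and re: "Re a \<le> 0" "Re b \<le> 0" "Re c \<le> 0"
  obtains C where "C \<ge> 0"
    "\<And>L. L > 0 \<Longrightarrow> norm (contour_integral (linepath a b +++ linepath b c) (\<lambda>z. h z * exp (z * of_real L))) \<le> C / L"
proof -
  let ?p = "linepath a b +++ linepath b c"
  let ?I = "closed_segment a b \<union> closed_segment b c"
  have h': "deriv h holomorphic_on W" using h by (intro holomorphic_deriv)
  have ch: "continuous_on W h" and ch': "continuous_on W (deriv h)"
    using h h' by (auto intro: holomorphic_on_imp_continuous_on)
  have "compact (deriv h ` ?I)"
    by (rule compact_continuous_image, rule continuous_on_subset[OF ch']) (use h in auto)
  hence "bounded (deriv h ` ?I)" by (rule compact_imp_bounded)
  then obtain M where M: "M > 0" "\<And>z. z \<in> ?I \<Longrightarrow> norm (deriv h z) \<le> M"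
    unfolding bounded_pos by auto
  have seg: "Re z \<le> 0" if "z \<in> ?I" for z
  proof -
    have "convex {z. Re z \<le> 0}" by (rule convex_halfspace_Re_le)
    hence "closed_segment a b \<subseteq> {z. Re z \<le> 0}" "closed_segment b c \<subseteq> {z. Re z \<le> 0}"
      using re by (simp_all add: closed_segment_subset)
    thus ?thesis using that by auto
  qed
  show ?thesis
  proof (rule that[of "M * norm (b - a) + M * norm (c - b)"])
    show "0 \<le> M * norm (b - a) + M * norm (c - b)" using M by auto
  next
    fix L :: real assume L: "L > 0"
    let ?e = "\<lambda>z. exp (z * of_real L)"
    let ?g = "\<lambda>z. deriv h z * ?e z / of_real L"
    have ci: "?g contour_integrable_on linepath a b" "?g contour_integrable_on linepath b c"
      "(\<lambda>z. h z * ?e z) contour_integrable_on linepath a b" "(\<lambda>z. h z * ?e z) contour_integrable_on linepath b c"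
    proof -
      have cg: "continuous_on W ?g" "continuous_on W (\<lambda>z. h z * ?e z)"
        using L by (intro continuous_on_mult continuous_on_divide ch ch' continuous_intros; simp)+
      show "?g contour_integrable_on linepath a b" "?g contour_integrable_on linepath b c"
        "(\<lambda>z. h z * ?e z) contour_integrable_on linepath a b" "(\<lambda>z. h z * ?e z) contour_integrable_on linepath b c"
        by (rule contour_integrable_continuous_linepath, rule continuous_on_subset[OF cg(1)], rule h,
            rule contour_integrable_continuous_linepath, rule continuous_on_subset[OF cg(1)], rule h,
            rule contour_integrable_continuous_linepath, rule continuous_on_subset[OF cg(2)], rule h,
            rule contour_integrable_continuous_linepath, rule continuous_on_subset[OF cg(2)], rule h)
    qed
    have bd: "norm (?g z) \<le> M / L" if "z \<in> ?I" for z
    proof -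
      have "norm (?e z) \<le> 1" using seg[OF that] L by (simp add: mult_nonpos_nonneg)
      hence "norm (deriv h z) * norm (?e z) \<le> M * 1"
        using M(2)[OF that] M(1) by (intro mult_mono) auto
      thus ?thesis using L by (simp add: norm_mult norm_divide field_simps)
    qed
    have "((\<lambda>z. h z * ?e z + ?g z) has_contour_integral h (pathfinish ?p) * ?e (pathfinish ?p) / of_real L - h (pathstart ?p) * ?e (pathstart ?p) / of_real L) ?p"
    proof (rule contour_integral_primitive[where S=W])
      fix x assume x: "x \<in> W"
      have hd: "(h has_field_derivative deriv h x) (at x within W)"
        using x h by (intro DERIV_subset[OF holomorphic_derivI[of h W x]]) auto
      show "((\<lambda>z. h z * ?e z / of_real L) has_field_derivative h x * ?e x + ?g x) (at x within W)"
        using L by (auto intro!: derivative_eq_intros hd simp: field_simps)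
    qed (use h in \<open>auto simp: path_image_join\<close>)
    hence "((\<lambda>z. h z * ?e z + ?g z) has_contour_integral 0) ?p" using z by simp
    hence "contour_integral ?p (\<lambda>z. h z * ?e z + ?g z) = 0" by (rule contour_integral_unique)
    moreover have "contour_integral ?p (\<lambda>z. h z * ?e z + ?g z) = contour_integral ?p (\<lambda>z. h z * ?e z) + contour_integral ?p ?g"
      using ci by (intro contour_integral_add) (auto simp: contour_integrable_join)
    ultimately have 1: "contour_integral ?p (\<lambda>z. h z * ?e z) = - contour_integral ?p ?g"
      by (simp add: add_eq_0_iff)
    have 2: "contour_integral ?p ?g = contour_integral (linepath a b) ?g + contour_integral (linepath b c) ?g"
      using ci by (intro contour_integral_join) auto
    have mL: "0 \<le> M / L" using M(1) L by simp
    have 3: "norm (contour_integral (linepath a b) ?g) \<le> M / L * norm (b - a)"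
      by (rule contour_integral_bound_linepath[OF ci(1) mL], rule bd) blast
    have 4: "norm (contour_integral (linepath b c) ?g) \<le> M / L * norm (c - b)"
      by (rule contour_integral_bound_linepath[OF ci(2) mL], rule bd) blast
    have "norm (contour_integral ?p (\<lambda>z. h z * ?e z)) \<le> M / L * norm (b - a) + M / L * norm (c - b)"
      unfolding 1 2 norm_minus_cancel by (rule order_trans[OF norm_triangle_ineq add_mono[OF 3 4]])
    thus "norm (contour_integral ?p (\<lambda>z. h z * ?e z)) \<le> (M * norm (b - a) + M * norm (c - b)) / L"
      by (simp add: add_divide_distrib)
  qed
qed

lemma right_half_circle:
  assumes "z \<in> path_image (part_circlepath 0 R (-pi/2) (pi/2))" "R > 0"
  shows "norm z = R" "Re z \<ge> 0"
proof -
  obtain t where t: "-(pi/2) \<le> t" "t \<le> pi/2" "z = of_real R * cis t"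
    using assms by (auto simp: path_image_part_circlepath' closed_segment_eq_real_ivl)
  show "norm z = R" using t assms by (simp add: norm_mult)
  have "cos t \<ge> 0" using t by (intro cos_ge_zero) auto
  thus "Re z \<ge> 0" using t assms by simp
qed

lemma left_half_circle:
  assumes "z \<in> path_image (part_circlepath 0 R (pi/2) (3*pi/2))" "R > 0"
  shows "norm z = R" "Re z \<le> 0"
proof -
  obtain t where t: "pi/2 \<le> t" "t \<le> 3*pi/2" "z = of_real R * cis t"
    using assms by (auto simp: path_image_part_circlepath' closed_segment_eq_real_ivl)
  show "norm z = R" using t assms by (simp add: norm_mult)
  have "cos (t - pi) \<ge> 0" using t by (intro cos_ge_zero) auto
  thus "Re z \<le> 0" using t assms by (simp add: mult_nonneg_nonpos)
qed

lemma dirichlet_tail_bound: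
  fixes a :: "nat \<Rightarrow> complex" and z :: complex
  assumes bnd: "\<And>n. norm (a n) \<le> 1" and s: "(\<lambda>n. a n * of_nat (Suc n) powr (-(z+1))) sums l"
    and z: "Re z > 0" "N > 0"
  shows "norm (l - (\<Sum>n<N. a n * of_nat (Suc n) powr (-(z+1)))) \<le> real N powr (- Re z) / Re z"
proof -
  let ?f = "\<lambda>n. a n * of_nat (Suc n) powr (-(z+1))"
  have "(\<lambda>M. norm ((\<Sum>n<M. ?f n) - (\<Sum>n<N. ?f n))) \<longlonglongrightarrow> norm (l - (\<Sum>n<N. ?f n))"
    using s unfolding sums_def by (intro tendsto_intros)
  moreover have "norm ((\<Sum>n<M. ?f n) - (\<Sum>n<N. ?f n)) \<le> real N powr (- Re z) / Re z" if "M \<ge> N" for M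
  proof -
    have "(\<Sum>n<M. ?f n) - (\<Sum>n<N. ?f n) = (\<Sum>n=N..<M. ?f n)"
      using that by (simp add: lessThan_atLeast0 sum_diff_nat_ivl)
    also have "norm \<dots> \<le> (\<Sum>n=N..<M. norm (?f n))" by (rule norm_sum)
    also have "\<dots> \<le> (\<Sum>n=N..<M. real (Suc n) powr (-(Re z+1)))"
    proof (rule sum_mono)
      fix n
      have "norm (?f n) = norm (a n) * real (Suc n) powr (-(Re z+1))"
        by (subst norm_mult, subst norm_powr_real_powr) (auto simp flip: of_nat_Suc)
      also have "\<dots> \<le> 1 * real (Suc n) powr (-(Re z+1))" by (intro mult_right_mono bnd) auto
      finally show "norm (?f n) \<le> real (Suc n) powr (-(Re z+1))" by simp
    qed
    also have "\<dots> \<le> real N powr (- Re z) / Re z" by (rule powr_tail_bound) (use z in auto)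
    finally show ?thesis .
  qed
  ultimately show ?thesis
    by (intro tendsto_upperbound[where F=sequentially]) (auto simp: eventually_at_top_linorder)
qed

lemma dirichlet_partial_bound:
  fixes a :: "nat \<Rightarrow> complex" and z :: complex
  assumes bnd: "\<And>n. norm (a n) \<le> 1" and z: "Re z < 0" "N > 0"
  shows "norm (\<Sum>n<N. a n * of_nat (Suc n) powr (-(z+1))) \<le> real N powr (- Re z) * (1 / (- Re z) + 1 / real N)"
proof -
  have "norm (\<Sum>n<N. a n * of_nat (Suc n) powr (-(z+1))) \<le> (\<Sum>n<N. norm (a n * of_nat (Suc n) powr (-(z+1))))"
    by (rule norm_sum)
  also have "\<dots> \<le> (\<Sum>n<N. real (Suc n) powr (- Re z - 1))"
  proof (rule sum_mono)
    fix n
    have "norm (a n * of_nat (Suc n) powr (-(z+1))) = norm (a n) * real (Suc n) powr (- Re z - 1)"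
      by (subst norm_mult, subst norm_powr_real_powr) (auto simp flip: of_nat_Suc)
    also have "\<dots> \<le> 1 * real (Suc n) powr (- Re z - 1)" by (intro mult_right_mono bnd) auto
    finally show "norm (a n * of_nat (Suc n) powr (-(z+1))) \<le> real (Suc n) powr (- Re z - 1)" by simp
  qed
  also have "\<dots> \<le> real N powr (- Re z) * (1 / (- Re z) + 1 / real N)"
    by (rule powr_partial_bound) (use z in auto)
  finally show ?thesis .
qed

text \<open>Cauchy's formula is applied to g and to the partial sum S, each multiplied by N^z and
  the kernel. On the right semicircle the tail bound N^(- Re z) / Re z is cancelled by these
  factors. As S is entire, its left contour may be the semicircle, where the partial-sum bound is
  cancelled likewise; g continues only slightly to the left, so its contour is a polygon near the
  axis, whose integral decays like 1 / ln N. The constant C depends on R.\<close>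

lemma newman_estimate:
  fixes a :: "nat \<Rightarrow> complex"
  assumes bnd: "\<And>n. norm (a n) \<le> 1"
    and U: "open U" "{z. Re z \<ge> 0} \<subseteq> U" "g holomorphic_on U"
    and eq: "\<And>z. Re z > 0 \<Longrightarrow> (\<lambda>n. a n * of_nat (Suc n) powr (-(z+1))) sums g z"
    and R: "R > 0"
  obtains C where "C \<ge> 0" "\<And>N. N \<ge> 2 \<Longrightarrow>
    norm (g 0 - (\<Sum>n<N. a n / of_nat (Suc n))) \<le> 2 / R + 1 / real N + C / ln (real N)"
proof -
  let ?c = "part_circlepath 0 R (-pi/2) (pi/2)"
  let ?l = "part_circlepath 0 R (pi/2) (3*pi/2)"
  define K where "K = (\<lambda>z::complex. (1 + z\<^sup>2 / of_real (R\<^sup>2)) / z)"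
  define S where "S = (\<lambda>N z. \<Sum>n<N. a n * of_nat (Suc n) powr (-(z+1)))"
  have "compact (cbox (Complex 0 (-(R+1))) (Complex (R+1) (R+1)))" by (rule compact_cbox)
  moreover have "cbox (Complex 0 (-(R+1))) (Complex (R+1) (R+1)) \<subseteq> U"
    using U(2) by (auto simp: in_cbox_complex_iff)
  \<comment> \<open>Compactness yields a uniform margin e by which g continues to the left of the
    imaginary axis along the segment in question; the convex box V uses this margin.\<close>
  ultimately obtain e where e: "e > 0" "(\<Union>x\<in>cbox (Complex 0 (-(R+1))) (Complex (R+1) (R+1)). ball x e) \<subseteq> U"
    using compact_subset_open_imp_ball_epsilon_subset U(1) by metis
  define V where "V = box (Complex (-e) (-(R+1))) (Complex (R+1) (R+1))"
  have V: "convex V" "open V" by (simp_all add: V_def open_box)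
  have VU: "V \<subseteq> U"
  proof
    fix z assume z: "z \<in> V"
    show "z \<in> U"
    proof (cases "Re z \<ge> 0")
      case True thus ?thesis using U(2) by auto
    next
      case False
      have "\<i> * Im z \<in> cbox (Complex 0 (-(R+1))) (Complex (R+1) (R+1))"
        using z R by (auto simp: V_def in_box_complex_iff in_cbox_complex_iff)
      moreover have "dist (\<i> * Im z) z = \<bar>Re z\<bar>"
        by (simp add: dist_norm cmod_def)
      hence "z \<in> ball (\<i> * Im z) e" using False z by (auto simp: V_def in_box_complex_iff)
      ultimately show ?thesis using e(2) by blast
    qed
  qed
  \<comment> \<open>The vertex of the polygon lies to the left of 0, so the contour avoids the pole
    of the kernel while staying inside V.\<close>
  define b where "b = - complex_of_real (e/2)"
  define p where "p = linepath (\<i> * of_real R) b +++ linepath b (- \<i> * of_real R)"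
  have pp: "valid_path p" "pathstart p = \<i> * of_real R" "pathfinish p = - \<i> * of_real R"
    by (simp_all add: p_def)
  have bV: "b \<in> V" "\<i> * of_real R \<in> V" "- \<i> * of_real R \<in> V" "0 \<in> V"
    using e R by (auto simp: V_def b_def in_box_complex_iff)
  have pV: "closed_segment (\<i> * of_real R) b \<subseteq> V" "closed_segment b (- \<i> * of_real R) \<subseteq> V"
    by (rule closed_segment_subset[OF bV(2,1) V(1)], rule closed_segment_subset[OF bV(1,3) V(1)])
  have pR: "closed_segment (\<i> * of_real R) b \<subseteq> - \<real>\<^sub>\<ge>\<^sub>0" "closed_segment b (- \<i> * of_real R) \<subseteq> - \<real>\<^sub>\<ge>\<^sub>0"
  proof -
    show "closed_segment (\<i> * of_real R) b \<subseteq> - \<real>\<^sub>\<ge>\<^sub>0"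
      using e R by (auto simp: closed_segment_def b_def complex_nonneg_Reals_iff)
    show "closed_segment b (- \<i> * of_real R) \<subseteq> - \<real>\<^sub>\<ge>\<^sub>0"
      using e R by (auto simp: closed_segment_def b_def complex_nonneg_Reals_iff)
  qed
  have pim: "path_image p = closed_segment (\<i> * of_real R) b \<union> closed_segment b (- \<i> * of_real R)"
    by (simp add: p_def path_image_join)
  have cV: "path_image ?c \<subseteq> V"
  proof
    fix z assume "z \<in> path_image ?c"
    from right_half_circle[OF this R] have "norm z = R" "Re z \<ge> 0" .
    moreover have "\<bar>Re z\<bar> \<le> norm z" "\<bar>Im z\<bar> \<le> norm z" by (rule abs_Re_le_cmod abs_Im_le_cmod)+
    ultimately show "z \<in> V" using e by (auto simp: V_def in_box_complex_iff)
  qed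
  have lR: "path_image ?l \<subseteq> - \<real>\<^sub>\<ge>\<^sub>0"
  proof
    fix z assume "z \<in> path_image ?l"
    from left_half_circle[OF this R] R show "z \<in> - \<real>\<^sub>\<ge>\<^sub>0"
      by (auto simp: complex_nonneg_Reals_iff cmod_def)
  qed
  have lends: "pathstart ?l = \<i> * of_real R" "pathfinish ?l = - \<i> * of_real R"
  proof -
    have "cis (3 * pi / 2) = cis (-(pi/2)) * cis (2 * pi)" unfolding cis_mult by simp
    thus "pathstart ?l = \<i> * of_real R" "pathfinish ?l = - \<i> * of_real R"
      using cis_conv_exp[of "pi/2"] cis_conv_exp[of "3*pi/2"] by simp_all
  qed
  have gV: "g holomorphic_on V" by (rule holomorphic_on_subset[OF U(3) VU])
  have Kz: "K (\<i> * of_real R) = 0" "K (- \<i> * of_real R) = 0"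
    using R by (auto simp: K_def power_mult_distrib)
  have hK: "(\<lambda>z. g z * K z) holomorphic_on V - {0}"
    unfolding K_def using R by (intro holomorphic_intros holomorphic_on_subset[OF gV]) auto
  have oV: "open (V - {0})" using V by auto
  have sV: "closed_segment (\<i> * of_real R) b \<subseteq> V - {0}" "closed_segment b (- \<i> * of_real R) \<subseteq> V - {0}"
    using pV pR by (auto simp del: mult_minus_left)
  have rV: "Re (\<i> * of_real R) \<le> 0" "Re b \<le> 0" "Re (- \<i> * of_real R) \<le> 0"
    using e by (auto simp: b_def)
  have zV: "g (\<i> * of_real R) * K (\<i> * of_real R) = 0" "g (- \<i> * of_real R) * K (- \<i> * of_real R) = 0"
    unfolding Kz by simp_all
  obtain C where C: "C \<ge> 0"
    "\<And>L. L > 0 \<Longrightarrow> norm (contour_integral p (\<lambda>z. g z * K z * exp (z * of_real L))) \<le> C / L"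
    unfolding p_def using newman_left_integral_bound[OF hK oV sV zV rV] by blast
  show ?thesis
  proof (rule that)
    fix N :: nat assume N: "N \<ge> 2"
    define L where "L = ln (real N)"
    have L: "L > 0" using N by (simp add: L_def)
    define E where "E = (\<lambda>z::complex. exp (z * of_real L))"
    have nE: "norm (E z) = real N powr (Re z)" for z
      using N unfolding E_def L_def powr_def norm_exp_eq_Re by simp
    have hE: "E holomorphic_on A" for A unfolding E_def by (intro holomorphic_intros)
    have hS: "S N holomorphic_on A" for A unfolding S_def by (intro holomorphic_intros)
    have f1: "contour_integral ?c (\<lambda>z. g z * E z * K z) + contour_integral p (\<lambda>z. g z * E z * K z) = 2 * of_real pi * \<i> * (g 0 * E 0)"
      unfolding K_def using pR pV pim
      by (intro newman_contour_formula[OF R pp _ V _ cV bV(4), of "\<lambda>z. g z * E z"] holomorphic_intros gV hE) auto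
    have f2: "contour_integral ?c (\<lambda>z. S N z * E z * K z) + contour_integral ?l (\<lambda>z. S N z * E z * K z) = 2 * of_real pi * \<i> * (S N 0 * E 0)"
      unfolding K_def
      by (intro newman_contour_formula[OF R _ lends lR, of UNIV "\<lambda>z. S N z * E z"] holomorphic_intros hS hE) auto
    have E0: "E 0 = 1" by (simp add: E_def)
    show "norm (g 0 - (\<Sum>n<N. a n / of_nat (Suc n))) \<le> 2 / R + 1 / real N + C / ln (real N)"
    proof -
      have hK': "K holomorphic_on - {0}"
        unfolding K_def using R by (intro holomorphic_intros) auto
      have c0: "path_image ?c \<subseteq> V - {0}" and l0: "path_image ?l \<subseteq> - {0}"
        using cV right_half_circle[OF _ R] left_half_circle[OF _ R] R by fastforce+
      have cc: "(\<lambda>z. f z * E z * K z) contour_integrable_on ?c" if "f holomorphic_on V" for f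
        by (intro contour_integrable_continuous_part_circlepath holomorphic_on_imp_continuous_on holomorphic_intros
              hE holomorphic_on_subset[OF that] holomorphic_on_subset[OF hK']) (use c0 in auto)
      have cl: "(\<lambda>z. f z * E z * K z) contour_integrable_on ?l" if "f holomorphic_on UNIV" for f
        by (intro contour_integrable_continuous_part_circlepath holomorphic_on_imp_continuous_on holomorphic_intros
              hE holomorphic_on_subset[OF that] holomorphic_on_subset[OF hK']) (use l0 in auto)
      define A where "A = contour_integral ?c (\<lambda>z. (g z - S N z) * E z * K z)"
      define B where "B = contour_integral p (\<lambda>z. g z * E z * K z)"
      define D where "D = contour_integral ?l (\<lambda>z. S N z * E z * K z)"
      have "A = contour_integral ?c (\<lambda>z. g z * E z * K z - S N z * E z * K z)"
        by (simp add: A_def algebra_simps)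
      also have "\<dots> = contour_integral ?c (\<lambda>z. g z * E z * K z) - contour_integral ?c (\<lambda>z. S N z * E z * K z)"
        by (rule contour_integral_diff[OF cc[OF gV] cc[OF hS]])
      finally have main: "2 * of_real pi * \<i> * (g 0 - S N 0) = A + B - D"
        unfolding right_diff_distrib f1[unfolded E0 mult_1_right, symmetric] f2[unfolded E0 mult_1_right, symmetric] B_def D_def by simp
      have nA: "norm A \<le> (2 / R\<^sup>2) * R * \<bar>pi/2 - (-pi/2)\<bar>"
        unfolding A_def
      proof (rule contour_integral_bound_part_circlepath)
        show "(\<lambda>z. (g z - S N z) * E z * K z) contour_integrable_on ?c"
          by (rule cc) (intro holomorphic_intros gV hS)
        fix z assume "z \<in> path_image ?c"
        note z = right_half_circle[OF this R]
        have nK: "norm (K z) = 2 * Re z / R\<^sup>2"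
          unfolding K_def using newman_kernel_norm[OF z(1) R] z(2) by simp
        show "norm ((g z - S N z) * E z * K z) \<le> 2 / R\<^sup>2"
        proof (cases "Re z = 0")
          case True
          thus ?thesis using nK by simp
        next
          case False
          have "norm (g z - S N z) \<le> real N powr (- Re z) / Re z"
            unfolding S_def by (rule dirichlet_tail_bound[OF bnd eq]) (use False z N in auto)
          hence "norm ((g z - S N z) * E z * K z) \<le> (real N powr (- Re z) / Re z) * real N powr (Re z) * (2 * Re z / R\<^sup>2)"
            unfolding norm_mult nE nK using z by (intro mult_right_mono) auto
          also have "\<dots> = 2 / R\<^sup>2" using False N by (simp add: powr_minus field_simps)
          finally show ?thesis .
        qed
      qed (use R in auto)
      have nD: "norm D \<le> (2 / R\<^sup>2 + 2 / (R * N)) * R * \<bar>3*pi/2 - pi/2\<bar>"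
        unfolding D_def
      proof (rule contour_integral_bound_part_circlepath)
        show "(\<lambda>z. S N z * E z * K z) contour_integrable_on ?l" by (rule cl[OF hS])
        fix z assume "z \<in> path_image ?l"
        note z = left_half_circle[OF this R]
        have nK: "norm (K z) = 2 * (- Re z) / R\<^sup>2"
          unfolding K_def using newman_kernel_norm[OF z(1) R] z(2) by simp
        show "norm (S N z * E z * K z) \<le> 2 / R\<^sup>2 + 2 / (R * N)"
        proof (cases "Re z = 0")
          case True
          thus ?thesis using nK R by simp
        next
          case False
          have "norm (S N z) \<le> real N powr (- Re z) * (1 / (- Re z) + 1 / real N)"
            unfolding S_def by (rule dirichlet_partial_bound[OF bnd]) (use False z N in auto)
          hence "norm (S N z * E z * K z) \<le> real N powr (- Re z) * (1 / (- Re z) + 1 / real N) * real N powr (Re z) * (2 * (- Re z) / R\<^sup>2)"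
            unfolding norm_mult nE nK using z(2) by (intro mult_right_mono divide_nonneg_nonneg) auto
          also have "\<dots> = 2 / R\<^sup>2 + 2 * (- Re z) / (R\<^sup>2 * N)" using False N R by (simp add: powr_minus field_simps)
          also have "2 * (- Re z) / (R\<^sup>2 * N) \<le> 2 * R / (R\<^sup>2 * N)"
            using abs_Re_le_cmod[of z] z R by (intro divide_right_mono) auto
          also have "\<dots> = 2 / (R * N)" using R by (simp add: power2_eq_square field_simps)
          finally show ?thesis by simp
        qed
      qed (use R in auto)
      have nB: "norm B \<le> C / L"
        unfolding B_def E_def using C(2)[OF L] by (simp add: mult_ac)
      have "2 * pi * norm (g 0 - S N 0) = norm (2 * of_real pi * \<i> * (g 0 - S N 0))"
        by (simp add: norm_mult)
      also have "\<dots> \<le> norm A + norm B + norm D"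
        unfolding main by (metis norm_triangle_ineq norm_triangle_ineq4 order_trans add_right_mono)
      finally have 1: "2 * pi * norm (g 0 - S N 0) \<le> norm A + norm B + norm D" .
      have 2: "norm A \<le> (2 / R) * pi"
        using nA R by (simp add: power2_eq_square)
      have "(2 / R\<^sup>2 + 2 / (R * N)) * R = 2 / R + 2 / N"
        using R by (simp add: power2_eq_square field_simps)
      moreover have "\<bar>3*pi/2 - pi/2\<bar> = pi" by simp
      ultimately have 3: "norm D \<le> (2 / R + 2 / N) * pi" using nD by simp
      have "2 * pi * norm (g 0 - S N 0) \<le> 2 * pi * (2 / R + 1 / N + (C / L) / (2 * pi))"
      proof -
        have "2 * pi * (2 / R + 1 / N + (C / L) / (2 * pi)) = (2 / R) * pi + (2 / R + 2 / N) * pi + C / L"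
          using R by (simp add: field_simps)
        thus ?thesis using 1 2 3 nB by linarith
      qed
      hence "norm (g 0 - S N 0) \<le> 2 / R + 1 / N + (C / L) / (2 * pi)"
        by (subst (asm) mult_le_cancel_left_pos) auto
      moreover have "(C / L) / (2 * pi) \<le> (C / L) / 1"
        using C(1) L pi_ge_two by (intro divide_left_mono) auto
      moreover have "S N 0 = (\<Sum>n<N. a n / of_nat (Suc n))"
        unfolding S_def by (intro sum.cong refl) (simp add: powr_minus field_simps del: of_nat_Suc)
      ultimately show ?thesis by (simp add: L_def)
    qed
  qed (rule C)
qed

theorem newman_dirichlet_sums:
  fixes a :: "nat \<Rightarrow> complex"
  assumes bnd: "\<And>n. norm (a n) \<le> 1"
    and U: "open U" "{z. Re z \<ge> 0} \<subseteq> U" "g holomorphic_on U"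
    and eq: "\<And>z. Re z > 0 \<Longrightarrow> (\<lambda>n. a n * of_nat (Suc n) powr (-(z+1))) sums g z"
  shows "(\<lambda>n. a n / of_nat (Suc n)) sums g 0"
  unfolding sums_def
proof (rule metric_LIMSEQ_I)
  fix r :: real assume r: "r > 0"
  \<comment> \<open>The radius R = 4 / r makes the nonvanishing error 2 / R equal to r / 2.\<close>
  obtain C where C: "C \<ge> 0" "\<And>N. N \<ge> 2 \<Longrightarrow>
    norm (g 0 - (\<Sum>n<N. a n / of_nat (Suc n))) \<le> 2 / (4 / r) + 1 / real N + C / ln (real N)"
    by (rule newman_estimate[OF assms, of "4 / r"]) (use r in auto)
  have "(\<lambda>N. 2 / (4 / r) + 1 / real N + C / ln (real N)) \<longlonglongrightarrow> 2 / (4 / r) + 0 + 0"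
    by (intro tendsto_add tendsto_const lim_1_over_n tendsto_divide_0[OF tendsto_const]
          filterlim_at_top_imp_at_infinity filterlim_compose[OF ln_at_top filterlim_real_sequentially])
  moreover have "2 / (4 / r) + 0 + 0 < r" using r by (simp add: field_simps)
  ultimately have "eventually (\<lambda>N. 2 / (4 / r) + 1 / real N + C / ln (real N) < r) sequentially"
    by (rule order_tendstoD)
  hence "eventually (\<lambda>N. dist (\<Sum>n<N. a n / of_nat (Suc n)) (g 0) < r) sequentially"
    using eventually_ge_at_top[of 2]
  proof eventually_elim
    case (elim N)
    thus ?case using C(2)[of N] by (simp add: dist_norm norm_minus_commute)
  qed
  thus "\<exists>no. \<forall>n\<ge>no. dist (\<Sum>n<n. a n / of_nat (Suc n)) (g 0) < r"
    by (simp add: eventually_at_top_linorder)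
qed

section \<open>Primes in residue classes\<close>

text \<open>This is o(N), stated with an additive constant so that it holds for every N, in
  particular at the arguments N div k of the hyperbola method.\<close>

definition sublinear :: "(nat \<Rightarrow> 'a :: real_normed_vector) \<Rightarrow> bool" where
  "sublinear f \<longleftrightarrow> (\<forall>e>0. \<exists>C. \<forall>N. norm (f N) \<le> e * real N + C)"

lemma sublinearD:
  assumes "sublinear f" "e > 0"
  obtains C where "C \<ge> 0" "\<And>N. norm (f N) \<le> e * real N + C"
proof -
  obtain C where C: "\<And>N. norm (f N) \<le> e * real N + C" using assms unfolding sublinear_def by blast
  have "C \<ge> 0" using C[of 0] norm_ge_zero[of "f 0"] by (simp del: norm_ge_zero)
  thus ?thesis using C by (rule that)
qed

lemma sublinearI_tendsto:
  assumes "(\<lambda>N. norm (f N) / real N) \<longlonglongrightarrow> 0"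
  shows "sublinear f"
  unfolding sublinear_def
proof (intro allI impI)
  fix e :: real assume e: "e > 0"
  from order_tendstoD(2)[OF assms e] obtain N0 where N0: "\<And>N. N \<ge> N0 \<Longrightarrow> norm (f N) / real N < e"
    unfolding eventually_at_top_linorder by blast
  have "norm (f N) \<le> e * real N + (\<Sum>n\<le>N0. norm (f n))" for N
  proof (cases "N \<le> N0")
    case True
    have "norm (f N) \<le> (\<Sum>n\<le>N0. norm (f n))" by (rule member_le_sum) (use True in auto)
    thus ?thesis using e by (simp add: add_increasing)
  next
    case False
    hence "norm (f N) \<le> e * real N" using N0[of N] by (simp add: divide_less_eq)
    moreover have "(\<Sum>n\<le>N0. norm (f n)) \<ge> 0" by (intro sum_nonneg) auto
    ultimately show ?thesis by linarith
  qed
  thus "\<exists>C. \<forall>N. norm (f N) \<le> e * real N + C" by blast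
qed

lemma sublinear_imp_tendsto:
  assumes "sublinear f"
  shows "(\<lambda>N. norm (f N) / real N) \<longlonglongrightarrow> 0"
proof (rule LIMSEQ_I)
  fix r :: real assume r: "r > 0"
  obtain C where C: "C \<ge> 0" "\<And>N. norm (f N) \<le> (r / 2) * real N + C"
    using sublinearD[OF assms, of "r / 2"] r by auto
  obtain N0 :: nat where N0: "real N0 > 2 * C / r" using reals_Archimedean2 by blast
  have "norm (norm (f N) / real N - 0) < r" if N: "N \<ge> Suc N0" for N
  proof -
    have "real N0 < real N" using N by simp
    hence "2 * C / r < real N" using N0 by linarith
    hence "C < (r / 2) * real N" using r by (simp add: field_simps)
    hence "norm (f N) < r * real N" using C(2)[of N] by (simp add: field_simps)
    thus ?thesis using N by (simp add: divide_less_eq)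
  qed
  thus "\<exists>no. \<forall>n\<ge>no. norm (norm (f n) / real n - 0) < r" by blast
qed

lemma sublinear_add:
  assumes "sublinear f" "sublinear g"
  shows "sublinear (\<lambda>N. f N + g N)"
  unfolding sublinear_def
proof (intro allI impI)
  fix e :: real assume "e > 0"
  hence e: "e / 2 > 0" by simp
  obtain C where C: "\<And>N. norm (f N) \<le> (e / 2) * real N + C" using sublinearD[OF assms(1) e] by blast
  obtain D where D: "\<And>N. norm (g N) \<le> (e / 2) * real N + D" using sublinearD[OF assms(2) e] by blast
  have "norm (f N + g N) \<le> e * real N + (C + D)" for N
    using norm_triangle_ineq[of "f N" "g N"] C[of N] D[of N] by (simp add: field_simps)
  thus "\<exists>C. \<forall>N. norm (f N + g N) \<le> e * real N + C" by blast
qed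

lemma sublinear_mono:
  assumes "sublinear f" "\<And>N. norm (g N) \<le> norm (f N)"
  shows "sublinear g"
  using assms order_trans unfolding sublinear_def by meson

lemma cesaro_mean:
  fixes t :: "nat \<Rightarrow> complex"
  assumes "t \<longlonglongrightarrow> l"
  shows "(\<lambda>N. (\<Sum>n<N. t n) / of_nat N) \<longlonglongrightarrow> l"
proof -
  have sub: "sublinear (\<lambda>N. \<Sum>n<N. t n - l)"
    unfolding sublinear_def
  proof (intro allI impI)
    fix e :: real assume e: "e > 0"
    obtain N0 where N0: "\<And>N. N \<ge> N0 \<Longrightarrow> norm (t N - l) < e"
      using LIMSEQ_D[OF assms e] by blast
    have "norm (\<Sum>n<N. t n - l) \<le> e * real N + (\<Sum>n<N0. norm (t n - l))" for N
    proof -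
      have "norm (\<Sum>n<N. t n - l) \<le> (\<Sum>n<N. e + (if n < N0 then norm (t n - l) else 0))"
        by (intro sum_norm_le) (use N0 e in \<open>auto intro: less_imp_le\<close>)
      also have "\<dots> = e * real N + (\<Sum>n<N. if n < N0 then norm (t n - l) else 0)" by (simp add: sum.distrib)
      also have "(\<Sum>n<N. if n < N0 then norm (t n - l) else 0) = (\<Sum>n\<in>{..<N} \<inter> {..<N0}. norm (t n - l))"
        by (subst sum.inter_restrict) auto
      also have "\<dots> \<le> (\<Sum>n<N0. norm (t n - l))" by (intro sum_mono2) auto
      finally show ?thesis by simp
    qed
    thus "\<exists>C. \<forall>N. norm (\<Sum>n<N. t n - l) \<le> e * real N + C" by blast
  qed
  have "(\<lambda>N. (\<Sum>n<N. t n - l) / of_nat N) \<longlonglongrightarrow> 0"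
    by (rule tendsto_norm_zero_cancel) (use sublinear_imp_tendsto[OF sub] in \<open>simp add: norm_divide\<close>)
  hence "(\<lambda>N. (\<Sum>n<N. t n - l) / of_nat N + l) \<longlonglongrightarrow> 0 + l" by (intro tendsto_add tendsto_const)
  moreover have "eventually (\<lambda>N. (\<Sum>n<N. t n - l) / of_nat N + l = (\<Sum>n<N. t n) / of_nat N) sequentially"
    using eventually_gt_at_top[of 0]
    by eventually_elim (simp add: sum_subtractf diff_divide_distrib)
  ultimately show ?thesis by (simp add: tendsto_cong)
qed

text \<open>Kronecker's lemma. With t the partial sums of the convergent series, the sum of the a n
  is N t(N) minus the sum of the t n; after division by N both parts tend to l.\<close>

lemma kronecker:
  fixes a :: "nat \<Rightarrow> complex"
  assumes "(\<lambda>n. a n / of_nat (Suc n)) sums l"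
  shows "sublinear (\<lambda>N. \<Sum>n<N. a n)"
proof -
  define t where "t = (\<lambda>N. \<Sum>n<N. a n / of_nat (Suc n))"
  have t: "t \<longlonglongrightarrow> l" using assms unfolding sums_def t_def .
  have eq: "(\<Sum>n<N. a n) = of_nat N * t N - (\<Sum>n<N. t n)" for N
  proof (induction N)
    case (Suc N)
    have "of_nat (Suc N) * t (Suc N) = of_nat (Suc N) * t N + a N"
      by (simp add: t_def distrib_left del: of_nat_Suc)
    thus ?case using Suc by (simp add: algebra_simps)
  qed simp
  have "(\<lambda>N. t N - (\<Sum>n<N. t n) / of_nat N) \<longlonglongrightarrow> l - l"
    by (intro tendsto_diff t cesaro_mean)
  hence "(\<lambda>N. norm (t N - (\<Sum>n<N. t n) / of_nat N)) \<longlonglongrightarrow> 0" by (simp add: tendsto_norm_zero)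
  moreover have "eventually (\<lambda>N. norm (t N - (\<Sum>n<N. t n) / of_nat N) = norm (\<Sum>n<N. a n) / real N) sequentially"
    using eventually_gt_at_top[of 0]
  proof eventually_elim
    case (elim N)
    have "t N - (\<Sum>n<N. t n) / of_nat N = (\<Sum>n<N. a n) / of_nat N" using elim by (simp add: eq diff_divide_distrib)
    thus ?case by (simp add: norm_divide)
  qed
  ultimately show ?thesis by (intro sublinearI_tendsto) (simp add: tendsto_cong)
qed

section \<open>From the Moebius function to the primes, twisted by a nonprincipal character\<close>

theorem mu_dchar_sublinear:
  assumes \<xi>: "m > 0" "dchar m \<xi>" "\<xi> \<noteq> principal_dchar m"
  shows "sublinear (\<lambda>N. \<Sum>n=1..N. \<xi> n * mu n)"
proof -
  note f = bounded_cmult_dchar[OF \<xi>(1,2)]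
  note hol = Lser_holomorphic(1)[OF dchar_Lser_bound[OF \<xi>]]
  \<comment> \<open>The reciprocal of the L-series is holomorphic here; by
    \<open>Lser_nonzero\<close> the translate U contains the whole closed half-plane Re z \<ge> 0,
    as Newman's theorem requires.\<close>
  define V where "V = {s. Re s > 0} \<inter> Lser \<xi> -` (- {0})"
  define U where "U = (\<lambda>z. 1 + z) -` V"
  have oV: "open V" unfolding V_def
    by (intro continuous_open_preimage holomorphic_on_imp_continuous_on[OF hol] open_Re_gt) auto
  have oU: "open U" unfolding U_def by (intro open_vimage oV continuous_intros)
  have hV: "(\<lambda>s. inverse (Lser \<xi> s)) holomorphic_on V"
    by (intro holomorphic_intros holomorphic_on_subset[OF hol]) (auto simp: V_def)
  have hU: "(\<lambda>z. inverse (Lser \<xi> (1 + z))) holomorphic_on U"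
  proof -
    have "((\<lambda>s. inverse (Lser \<xi> s)) \<circ> (\<lambda>z. 1 + z)) holomorphic_on U"
      by (rule holomorphic_on_compose_gen[OF _ hV]) (auto simp: U_def intro!: holomorphic_intros)
    thus ?thesis by (simp add: o_def)
  qed
  have "(\<lambda>n. (\<xi> (Suc n) * mu (Suc n)) / of_nat (Suc n)) sums inverse (Lser \<xi> (1 + 0))"
  proof (rule newman_dirichlet_sums[OF _ oU _ hU])
    show "norm (\<xi> (Suc n) * mu (Suc n)) \<le> 1" for n
      by (rule norm_mult_le_1[OF bounded_cmultD(3)[OF f]]) (simp add: abs_mu_le)
    show "{z. Re z \<ge> 0} \<subseteq> U"
      using Lser_nonzero[OF \<xi>] by (auto simp: U_def V_def)
    fix z :: complex assume z: "Re z > 0"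
    hence s: "Re (z + 1) > 1" by simp
    have "(\<lambda>n. (\<xi> (Suc n) * mu (Suc n)) * of_nat (Suc n) powr (-(z + 1))) sums dser (\<lambda>n. \<xi> n * mu n) (z + 1)"
    proof (rule dser_sums[OF _ s])
      fix n :: nat assume n: "n > 0"
      show "norm (\<xi> n * mu n) \<le> 1 + ln (real n)"
        by (rule norm_mult_le_1[OF bounded_cmultD(3)[OF f]]) (use abs_mu_le[of n] n in \<open>auto intro: order_trans[of _ 1]\<close>)
    qed
    moreover have "Lser \<xi> (1 + z) = dser \<xi> (z + 1)"
      unfolding add.commute[of 1 z] by (rule Lser_eq_dser[OF dchar_Lser_bound[OF \<xi>]]) (use z in simp)
    moreover have "dser (\<lambda>n. \<xi> n * mu n) (z + 1) = inverse (dser \<xi> (z + 1))"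
      using dser_cmult_inverse[OF f s] by (metis inverse_unique mult.commute)
    ultimately show "(\<lambda>n. (\<xi> (Suc n) * mu (Suc n)) * of_nat (Suc n) powr (-(z + 1))) sums inverse (Lser \<xi> (1 + z))"
      by metis
  qed
  from kronecker[OF this] show ?thesis by (simp only: One_nat_def sum.atLeast1_atMost_eq)
qed

lemma sum_inverse_sqrt_le: "(\<Sum>d=1..n. 1 / sqrt (real d)) \<le> 2 * sqrt (real n)"
proof (induction n)
  case (Suc n)
  define u v where "u = sqrt (real n)" and "v = sqrt (real (Suc n))"
  have uv: "u \<ge> 0" "v > 0" "v\<^sup>2 = u\<^sup>2 + 1" by (simp_all add: u_def v_def)
  have "0 \<le> (v - u)\<^sup>2" by simp
  hence "1 \<le> 2 * v * (v - u)" using uv(3) by (simp add: power2_eq_square algebra_simps)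
  hence "1 / v \<le> 2 * (v - u)" using uv(2) by (simp add: divide_le_eq mult_ac)
  thus ?case using Suc by (simp add: u_def v_def)
qed simp

lemma ln_le_2_sqrt: "x > 0 \<Longrightarrow> ln x \<le> 2 * sqrt x"
  using ln_bound[of "sqrt x"] by (simp add: ln_sqrt)

text \<open>Partial summation would give O(ln n); the square root is a convenient weakening, because
  its values at N / d are summed over d by \<open>sum_inverse_sqrt_le\<close>.\<close>

lemma dchar_ln_sum_bound:
  assumes \<xi>: "m > 0" "dchar m \<xi>" "\<xi> \<noteq> principal_dchar m"
  shows "norm (\<Sum>k=1..n. \<xi> k * ln (real k)) \<le> 4 * (real m + 1) * sqrt (real n)"
proof (cases n)
  case (Suc N)
  have "norm (\<Sum>k<Suc N. ln (real (Suc k)) *\<^sub>R \<xi> (Suc k)) \<le> 2 * (real m + 1) * ln (real (Suc N))"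
    by (rule abel_increasing) (auto intro: dchar_Lser_bound[OF \<xi>] simp del: of_nat_Suc)
  also have "\<dots> \<le> 2 * (real m + 1) * (2 * sqrt (real (Suc N)))"
    by (intro mult_left_mono ln_le_2_sqrt) auto
  also have "\<dots> = 4 * (real m + 1) * sqrt (real (Suc N))" by simp
  finally show ?thesis
    unfolding One_nat_def sum.atLeast1_atMost_eq Suc by (simp add: scaleR_conv_of_real mult.commute del: of_nat_Suc)
qed simp

text \<open>Dirichlet's hyperbola method, with the cut at B placed on the second factor.\<close>

lemma hyperbola_split:
  fixes a b :: "nat \<Rightarrow> 'a :: comm_ring_1"
  shows "(\<Sum>n=1..N. dconv a b n) = (\<Sum>k=1..min B N. b k * (\<Sum>d=1..N div k. a d))
    + (\<Sum>d=1..N. a d * (\<Sum>k\<in>{B<..N div d}. b k))"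
proof -
  define f where "f = (\<lambda>d k. if k \<le> B then a d * b k else 0)"
  define g where "g = (\<lambda>d k. if k \<le> B then 0 else a d * b k)"
  have "(\<Sum>n=1..N. dconv a b n) = (\<Sum>n=1..N. \<Sum>p\<in>divpairs n. f (fst p) (snd p)) + (\<Sum>n=1..N. \<Sum>p\<in>divpairs n. g (fst p) (snd p))"
    unfolding dconv_def sum.distrib[symmetric] by (intro sum.cong refl) (simp add: f_def g_def)
  also have "(\<Sum>n=1..N. \<Sum>p\<in>divpairs n. g (fst p) (snd p)) = (\<Sum>d=1..N. \<Sum>k=1..N div d. g d k)"
    by (rule sum_divpairs)
  also have "\<dots> = (\<Sum>d=1..N. a d * (\<Sum>k\<in>{B<..N div d}. b k))"
    unfolding sum_distrib_left g_def by (intro sum.cong refl sum.mono_neutral_cong_right) auto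
  also have "(\<Sum>n=1..N. \<Sum>p\<in>divpairs n. f (fst p) (snd p)) = (\<Sum>n=1..N. \<Sum>p\<in>divpairs n. f (snd p) (fst p))"
    by (intro sum.cong refl sum.reindex_bij_witness[of _ "\<lambda>p. (snd p, fst p)" "\<lambda>p. (snd p, fst p)"]) (auto simp: divpairs_def mult.commute)
  also have "\<dots> = (\<Sum>k=1..N. \<Sum>d=1..N div k. f d k)" by (rule sum_divpairs[of "\<lambda>x y. f y x"])
  also have "\<dots> = (\<Sum>k=1..min B N. b k * (\<Sum>d=1..N div k. a d))"
    unfolding sum_distrib_left f_def by (intro sum.mono_neutral_cong_right) (auto simp: mult.commute intro!: sum.cong)
  finally show ?thesis .
qed

text \<open>The coefficients are the convolution of \<xi> mu with \<xi> ln. For second factor k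
  \<le> B, finitely many o(N) sums of \<xi> mu are used. For k > B the sums of \<xi> ln are O(sqrt
  n), and as d runs up to N / B this contributes O(N / sqrt B), small once B is large.\<close>

theorem mangoldt_dchar_sublinear:
  assumes \<xi>: "m > 0" "dchar m \<xi>" "\<xi> \<noteq> principal_dchar m"
  shows "sublinear (\<lambda>N. \<Sum>n=1..N. \<xi> n * mangoldt n)"
  unfolding sublinear_def
proof (intro allI impI)
  fix e :: real assume e: "e > 0"
  note f = bounded_cmult_dchar[OF \<xi>(1,2)]
  define K where "K = 4 * (real m + 1)"
  have K: "K > 0" by (simp add: K_def)
  define a where "a = (\<lambda>n. \<xi> n * mu n)"
  define b where "b = (\<lambda>n. \<xi> n * ln (real n))"
  have na: "norm (a n) \<le> 1" for n unfolding a_def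
    by (rule norm_mult_le_1[OF bounded_cmultD(3)[OF f]]) (simp add: abs_mu_le)
  \<comment> \<open>This makes the factor 4 K / sqrt B of the second part at most e / 2; E is chosen
    below so that B ln B E is at most e / 2 in the first part.\<close>
  obtain B :: nat where "real B > (8 * K / e)\<^sup>2" using reals_Archimedean2 by blast
  hence B: "sqrt (real B) > 8 * K / e" "B > 0"
    using real_less_rsqrt by (auto intro: Nat.gr0I simp: not_less[symmetric])
  define E where "E = e / (2 * (real B * ln (real B) + 1))"
  have lB: "ln (real B) \<ge> 0" using B(2) by simp
  hence "E > 0" using e by (simp add: E_def add_nonneg_pos)
  then obtain C where C: "C \<ge> 0" "\<And>N. norm (\<Sum>n=1..N. a n) \<le> E * real N + C"
    using sublinearD[OF mu_dchar_sublinear[OF \<xi>, folded a_def]] by blast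
  have main: "norm (\<Sum>n=1..N. \<xi> n * mangoldt n) \<le> e * real N + real B * ln (real B) * C" for N
  proof -
    have conv: "\<xi> n * mangoldt n = dconv a b n" if "n \<in> {1..N}" for n
    proof -
      have "dconv a b n = \<xi> n * dconv (\<lambda>n. of_real (mu n)) (\<lambda>n. of_real (ln (real n))) n"
        unfolding a_def b_def by (rule dconv_mult_completely[OF bounded_cmultD(1)[OF f]])
      also have "dconv (\<lambda>n. of_real (mu n)) (\<lambda>n. of_real (ln (real n))) n = complex_of_real (mangoldt n)"
        unfolding dconv_of_real using dconv_mu_ln[of n] that by simp
      finally show ?thesis by simp
    qed
    have eq: "(\<Sum>n=1..N. \<xi> n * mangoldt n) = (\<Sum>k=1..min B N. b k * (\<Sum>d=1..N div k. a d))
      + (\<Sum>d=1..N. a d * (\<Sum>k\<in>{B<..N div d}. b k))"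
      using hyperbola_split[of a b N B] conv by simp
    have "norm (\<Sum>k=1..min B N. b k * (\<Sum>d=1..N div k. a d)) \<le> (\<Sum>k=1..min B N. ln (real B) * (E * real N + C))"
    proof (rule sum_norm_le)
      fix k assume k: "k \<in> {1..min B N}"
      have "norm (b k) \<le> ln (real k)" unfolding b_def
        by (rule norm_mult_le_1[OF bounded_cmultD(3)[OF f]]) (use k in simp)
      also have "\<dots> \<le> ln (real B)" using k by simp
      finally have 1: "norm (b k) \<le> ln (real B)" .
      have "norm (\<Sum>d=1..N div k. a d) \<le> E * real (N div k) + C" by (rule C(2))
      also have "\<dots> \<le> E * real N + C" using \<open>E > 0\<close> by simp
      finally show "norm (b k * (\<Sum>d=1..N div k. a d)) \<le> ln (real B) * (E * real N + C)"
        unfolding norm_mult using 1 lB by (intro mult_mono) auto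
    qed
    also have "\<dots> \<le> real B * (ln (real B) * (E * real N + C))"
      using lB C(1) \<open>E > 0\<close> by (simp add: mult_right_mono)
    also have "\<dots> = (real B * ln (real B) * E) * real N + real B * ln (real B) * C" by (simp add: algebra_simps)
    also have "real B * ln (real B) * E \<le> e / 2"
      using e lB by (simp add: E_def divide_le_eq add_nonneg_pos)
    finally have part1: "norm (\<Sum>k=1..min B N. b k * (\<Sum>d=1..N div k. a d)) \<le> e / 2 * real N + real B * ln (real B) * C"
      by (simp add: mult_right_mono)
    have T: "norm (\<Sum>k=1..n. b k) \<le> K * sqrt (real n)" for n
      unfolding b_def K_def by (rule dchar_ln_sum_bound[OF \<xi>])
    have tail: "norm (\<Sum>k\<in>{B<..n}. b k) \<le> 2 * K * sqrt (real n)" for n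
    proof (cases "B < n")
      case True
      have "(\<Sum>k=1..n. b k) = (\<Sum>k=1..B. b k) + (\<Sum>k\<in>{B<..n}. b k)"
        using True by (subst sum.union_disjoint[symmetric]) (auto intro!: sum.cong)
      hence "norm (\<Sum>k\<in>{B<..n}. b k) = norm ((\<Sum>k=1..n. b k) - (\<Sum>k=1..B. b k))" by simp
      also have "\<dots> \<le> norm (\<Sum>k=1..n. b k) + norm (\<Sum>k=1..B. b k)" by (rule norm_triangle_ineq4)
      also have "\<dots> \<le> K * sqrt (real n) + K * sqrt (real B)" by (intro add_mono T)
      also have "K * sqrt (real B) \<le> K * sqrt (real n)" using K True by (intro mult_left_mono) auto
      finally show ?thesis by simp
    qed (use K in auto)
    define D where "D = N div B"
    have D: "real D \<le> real N / real B" unfolding D_def by (rule of_nat_div_le_of_nat)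
    \<comment> \<open>For d > N div B the inner range is empty. Restricting d to D is what produces
      the gain of sqrt B.\<close>
    have "(\<Sum>d=1..N. a d * (\<Sum>k\<in>{B<..N div d}. b k)) = (\<Sum>d=1..D. a d * (\<Sum>k\<in>{B<..N div d}. b k))"
    proof (rule sum.mono_neutral_right)
      show "{1..D} \<subseteq> {1..N}" using div_le_dividend[of N B] by (auto simp: D_def intro: order_trans)
      show "\<forall>d\<in>{1..N} - {1..D}. a d * (\<Sum>k\<in>{B<..N div d}. b k) = 0"
      proof
        fix d assume d: "d \<in> {1..N} - {1..D}"
        hence "N div B < d" by (auto simp: D_def)
        hence "N < d * B" using B(2) by (simp add: div_less_iff_less_mult)
        hence "N div d < Suc B" using d by (simp add: div_less_iff_less_mult mult.commute)
        thus "a d * (\<Sum>k\<in>{B<..N div d}. b k) = 0" by simp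
      qed
    qed simp
    also have "norm \<dots> \<le> (\<Sum>d=1..D. 2 * K * sqrt (real N) * (1 / sqrt (real d)))"
    proof (rule sum_norm_le)
      fix d assume d: "d \<in> {1..D}"
      have "norm (a d * (\<Sum>k\<in>{B<..N div d}. b k)) \<le> 2 * K * sqrt (real (N div d))"
        by (rule norm_mult_le_1[OF na tail])
      also have "\<dots> \<le> 2 * K * sqrt (real N / real d)"
        using K by (intro mult_left_mono real_sqrt_le_mono) (auto simp: of_nat_div_le_of_nat)
      finally show "norm (a d * (\<Sum>k\<in>{B<..N div d}. b k)) \<le> 2 * K * sqrt (real N) * (1 / sqrt (real d))"
        by (simp add: real_sqrt_divide)
    qed
    also have "\<dots> \<le> 2 * K * sqrt (real N) * (2 * sqrt (real D))"
      unfolding sum_distrib_left[symmetric] using K by (intro mult_left_mono sum_inverse_sqrt_le) auto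
    also have "\<dots> \<le> 2 * K * sqrt (real N) * (2 * sqrt (real N / real B))"
      using K D by (intro mult_left_mono real_sqrt_le_mono) auto
    also have "\<dots> = (4 * K / sqrt (real B)) * real N"
      by (simp add: real_sqrt_divide)
    also have "\<dots> \<le> (e / 2) * real N"
    proof (rule mult_right_mono)
      have "8 * K < e * sqrt (real B)" using B(1) e by (simp add: divide_less_eq mult.commute)
      thus "4 * K / sqrt (real B) \<le> e / 2" using B(2) by (simp add: divide_le_eq)
    qed simp
    finally have part2: "norm (\<Sum>d=1..N. a d * (\<Sum>k\<in>{B<..N div d}. b k)) \<le> e / 2 * real N" .
    have "norm (\<Sum>n=1..N. \<xi> n * mangoldt n) \<le> norm (\<Sum>k=1..min B N. b k * (\<Sum>d=1..N div k. a d)) + norm (\<Sum>d=1..N. a d * (\<Sum>k\<in>{B<..N div d}. b k))"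
      unfolding eq by (rule norm_triangle_ineq)
    thus ?thesis using part1 part2 by (simp add: field_simps)
  qed
  show "\<exists>C. \<forall>N. norm (\<Sum>n=1..N. \<xi> n * mangoldt n) \<le> e * real N + C" using main by blast
qed

text \<open>Only proper prime powers p^k contribute; they have p \<le> sqrt N and k \<le> log 2 N,
  so there are O(sqrt N ln N) of them, each of weight at most ln N.\<close>

lemma prime_power_mangoldt_sublinear: "sublinear (\<lambda>N. \<Sum>n | n \<in> {1..N} \<and> \<not> prime n. mangoldt n :: real)"
proof -
  have bound: "norm (\<Sum>n | n \<in> {1..N} \<and> \<not> prime n. mangoldt n :: real) \<le> (sqrt (real N) + 1) * (log 2 (real N) + 1) * ln (real N)"
    if N: "N \<ge> 1" for N
  proof -
    define A where "A = {n\<in>{1..N}. primepow n \<and> \<not> prime n}"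
    define P where "P = {..nat \<lfloor>sqrt (real N)\<rfloor>} \<times> {..nat \<lfloor>log 2 (real N)\<rfloor>}"
    have "A \<subseteq> (\<lambda>(p, k). p ^ k) ` P"
    proof
      fix n assume n: "n \<in> A"
      then obtain p k where pk: "prime p" "k > 0" "n = p ^ k" by (auto simp: A_def primepow_def)
      have "k \<noteq> 1" using n pk by (auto simp: A_def)
      hence k: "k \<ge> 2" using pk by simp
      have nN: "p ^ k \<le> N" using n pk by (auto simp: A_def)
      have "p\<^sup>2 \<le> p ^ k" using k prime_gt_0_nat[OF pk(1)] by (intro power_increasing) auto
      hence "p\<^sup>2 \<le> N" using nN by linarith
      hence "real p ^ 2 \<le> real N" by (metis of_nat_le_iff of_nat_power)
      hence "real p \<le> sqrt (real N)" by (rule real_le_rsqrt)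
      hence 1: "p \<le> nat \<lfloor>sqrt (real N)\<rfloor>" by (simp add: le_nat_floor)
      have "2 ^ k \<le> p ^ k" using prime_ge_2_nat[OF pk(1)] by (intro power_mono) auto
      hence "2 ^ k \<le> N" using nN by linarith
      hence "(2::real) ^ k \<le> real N" by (metis of_nat_le_iff of_nat_power of_nat_numeral)
      hence "2 powr real k \<le> real N" by (simp add: powr_realpow)
      hence "real k \<le> log 2 (real N)" using N by (subst le_log_iff) auto
      hence 2: "k \<le> nat \<lfloor>log 2 (real N)\<rfloor>" by (simp add: le_nat_floor)
      show "n \<in> (\<lambda>(p, k). p ^ k) ` P" using 1 2 pk(3) by (auto simp: P_def)
    qed
    hence "card A \<le> card P" by (rule surj_card_le[rotated]) (simp add: P_def)
    also have "card P = Suc (nat \<lfloor>sqrt (real N)\<rfloor>) * Suc (nat \<lfloor>log 2 (real N)\<rfloor>)" by (simp add: P_def)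
    finally have "real (card A) \<le> real (Suc (nat \<lfloor>sqrt (real N)\<rfloor>)) * real (Suc (nat \<lfloor>log 2 (real N)\<rfloor>))"
      by (metis of_nat_le_iff of_nat_mult)
    also have "\<dots> \<le> (sqrt (real N) + 1) * (log 2 (real N) + 1)"
    proof (intro mult_mono)
      have "0 \<le> log 2 (real N)" using N by simp
      thus "real (Suc (nat \<lfloor>log 2 (real N)\<rfloor>)) \<le> log 2 (real N) + 1" using of_int_floor_le[of "log 2 (real N)"] by simp
      show "real (Suc (nat \<lfloor>sqrt (real N)\<rfloor>)) \<le> sqrt (real N) + 1" using of_int_floor_le[of "sqrt (real N)"] by simp
    qed auto
    finally have cA: "real (card A) \<le> (sqrt (real N) + 1) * (log 2 (real N) + 1)" .
    have "(\<Sum>n | n \<in> {1..N} \<and> \<not> prime n. mangoldt n :: real) = (\<Sum>n\<in>A. mangoldt n)"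
      by (rule sum.mono_neutral_right) (auto simp: A_def mangoldt_def)
    also have "norm \<dots> \<le> real (card A) * ln (real N)"
    proof -
      have "norm (\<Sum>n\<in>A. mangoldt n :: real) \<le> (\<Sum>n\<in>A. ln (real N))"
      proof (rule sum_norm_le)
        fix n assume n: "n \<in> A"
        hence "norm (mangoldt n :: real) \<le> ln (real n)" using mangoldt_le[of n] by (simp add: A_def mangoldt_nonneg)
        also have "\<dots> \<le> ln (real N)" using n by (simp add: A_def)
        finally show "norm (mangoldt n :: real) \<le> ln (real N)" .
      qed
      thus ?thesis by simp
    qed
    also have "\<dots> \<le> (sqrt (real N) + 1) * (log 2 (real N) + 1) * ln (real N)"
      using cA N by (intro mult_right_mono) auto
    finally show ?thesis .
  qed
  have lim: "(\<lambda>N. (sqrt (real N) + 1) * (log 2 (real N) + 1) * ln (real N) / real N) \<longlonglongrightarrow> 0"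
    by real_asymp
  show ?thesis
  proof (rule sublinearI_tendsto, rule tendsto_sandwich[OF _ _ tendsto_const lim])
    show "\<forall>\<^sub>F N in sequentially. norm (\<Sum>n | n \<in> {1..N} \<and> \<not> prime n. mangoldt n :: real) / real N
        \<le> (sqrt (real N) + 1) * (log 2 (real N) + 1) * ln (real N) / real N"
      using eventually_ge_at_top[of 1] by eventually_elim (intro divide_right_mono bound, auto)
  qed (auto intro!: always_eventually)
qed

lemma sum_mangoldt_split:
  fixes c :: "nat \<Rightarrow> 'a :: {real_normed_algebra_1, comm_ring_1}"
  shows "(\<Sum>n=1..N. c n * mangoldt n) = (\<Sum>p | prime p \<and> p \<le> N. c p * of_real (ln (real p))) + (\<Sum>n | n \<in> {1..N} \<and> \<not> prime n. c n * mangoldt n)"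
proof -
  have "{1..N} = {p. prime p \<and> p \<le> N} \<union> {n. n \<in> {1..N} \<and> \<not> prime n}"
    using prime_ge_1_nat by auto
  hence "(\<Sum>n=1..N. c n * mangoldt n) = (\<Sum>n\<in>{p. prime p \<and> p \<le> N} \<union> {n. n \<in> {1..N} \<and> \<not> prime n}. c n * mangoldt n)"
    by (rule sum.cong) (rule refl)
  also have "\<dots> = (\<Sum>p | prime p \<and> p \<le> N. c p * mangoldt p) + (\<Sum>n | n \<in> {1..N} \<and> \<not> prime n. c n * mangoldt n)"
    by (rule sum.union_disjoint) auto
  finally show ?thesis by (simp add: mangoldt_prime)
qed

theorem theta_dchar_sublinear:
  assumes \<xi>: "m > 0" "dchar m \<xi>" "\<xi> \<noteq> principal_dchar m"
  shows "sublinear (\<lambda>N. \<Sum>p | prime p \<and> p \<le> N. \<xi> p * ln (real p))"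
proof -
  note f = bounded_cmult_dchar[OF \<xi>(1,2)]
  have "sublinear (\<lambda>N. - (\<Sum>n | n \<in> {1..N} \<and> \<not> prime n. \<xi> n * mangoldt n))"
  proof (rule sublinear_mono[OF prime_power_mangoldt_sublinear])
    fix N
    have "norm (\<Sum>n | n \<in> {1..N} \<and> \<not> prime n. \<xi> n * mangoldt n) \<le> (\<Sum>n | n \<in> {1..N} \<and> \<not> prime n. mangoldt n :: real)"
      by (intro sum_norm_le norm_mult_le_1[OF bounded_cmultD(3)[OF f]]) (simp add: mangoldt_nonneg)
    thus "norm (- (\<Sum>n | n \<in> {1..N} \<and> \<not> prime n. \<xi> n * mangoldt n)) \<le> norm (\<Sum>n | n \<in> {1..N} \<and> \<not> prime n. mangoldt n :: real)" by simp
  qed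
  from sublinear_add[OF mangoldt_dchar_sublinear[OF \<xi>] this] show ?thesis
    unfolding sum_mangoldt_split by simp
qed

section \<open>Upper bound sieve\<close>

text \<open>The deviation changes by O(k^(-3/2)) from k - 1 to k, hence stays bounded. The constant
  6 in the majorant is 4 + 2, from the two parts of the increment after ln k \<le> 2 sqrt k.\<close>

lemma sum_ln_div_bounded: "\<exists>C. \<forall>n. \<bar>(\<Sum>k=1..n. ln (real k) / real k) - (ln (real n))\<^sup>2 / 2\<bar> \<le> C"
proof -
  define f where "f = (\<lambda>n. 6 * real (Suc n) powr (-(3/2)))"
  have fs: "summable f" unfolding f_def by (intro summable_mult summable_Suc_powr) simp
  have f0: "f n \<ge> 0" for n by (simp add: f_def)
  define D where "D = (\<lambda>n. (\<Sum>k=1..Suc n. ln (real k) / real k) - (ln (real (Suc n)))\<^sup>2 / 2)"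
  have step: "\<bar>D (Suc n) - D n\<bar> \<le> f (Suc n)" for n
  proof -
    define k where "k = real (Suc (Suc n))"
    have k: "k \<ge> 2" by (simp add: k_def)
    have k1: "real (Suc n) = k - 1" by (simp add: k_def)
    define u where "u = ln k - ln (k - 1)"
    have D: "D (Suc n) - D n = (1 / k - u) * ln k + u\<^sup>2 / 2"
    proof -
      have s: "(\<Sum>j=1..Suc (Suc n). ln (real j) / real j) = (\<Sum>j=1..Suc n. ln (real j) / real j) + ln k / k"
        by (simp add: k_def)
      have "D (Suc n) - D n = ln k / k - (ln k)\<^sup>2 / 2 + (ln (k - 1))\<^sup>2 / 2"
        unfolding D_def s k1 k_def[symmetric] by simp
      also have "\<dots> = (1 / k - u) * ln k + u\<^sup>2 / 2"
        unfolding u_def by (simp add: power2_eq_square algebra_simps add_divide_distrib diff_divide_distrib)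
      finally show ?thesis .
    qed
    have "ln (k / (k - 1)) \<le> k / (k - 1) - 1" using k by (intro ln_le_minus_one) auto
    hence u1: "u \<le> 1 / (k - 1)" unfolding u_def using k by (simp add: ln_div field_simps)
    have "ln ((k - 1) / k) \<le> (k - 1) / k - 1" using k by (intro ln_le_minus_one) auto
    hence u2: "1 / k \<le> u" unfolding u_def using k by (simp add: ln_div field_simps)
    have lnk: "0 \<le> ln k" using k by simp
    have u0: "0 \<le> u" using u2 k by (smt (verit) divide_nonneg_nonneg)
    have p1: "0 \<le> (u - 1 / k) * ln k" using u2 lnk by simp
    have p2: "(1 / k - u) * ln k = - ((u - 1 / k) * ln k)" by (simp add: algebra_simps)
    have "\<bar>D (Suc n) - D n\<bar> \<le> (u - 1 / k) * ln k + u\<^sup>2 / 2"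
      unfolding D p2 using p1 zero_le_power2[of u] by linarith
    also have "\<dots> \<le> (1 / (k - 1) - 1 / k) * (2 * sqrt k) + (1 / (k - 1))\<^sup>2 / 2"
      using u0 u1 u2 lnk k by (intro add_mono mult_mono divide_right_mono power_mono ln_le_2_sqrt) auto
    finally have a: "\<bar>D (Suc n) - D n\<bar> \<le> (1 / (k - 1) - 1 / k) * (2 * sqrt k) + (1 / (k - 1))\<^sup>2 / 2" .
    have "1 / (k - 1) - 1 / k = 1 / (k * (k - 1))" using k by (simp add: field_simps)
    also have "\<dots> \<le> 2 / k\<^sup>2" using k by (simp add: field_simps power2_eq_square)
    finally have b: "(1 / (k - 1) - 1 / k) * (2 * sqrt k) \<le> 2 / k\<^sup>2 * (2 * sqrt k)"
      using k by (intro mult_right_mono) auto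
    have "1 / (k - 1) \<le> 2 / k" using k by (simp add: field_simps)
    hence "(1 / (k - 1))\<^sup>2 \<le> (2 / k)\<^sup>2" using k by (intro power_mono) auto
    hence c: "(1 / (k - 1))\<^sup>2 / 2 \<le> 2 / k\<^sup>2 * 1" by (simp add: power_divide)
    have d: "2 / k\<^sup>2 * 1 \<le> 2 / k\<^sup>2 * sqrt k" using k by (intro mult_left_mono) auto
    have "\<bar>D (Suc n) - D n\<bar> \<le> 2 / k\<^sup>2 * (2 * sqrt k) + 2 / k\<^sup>2 * sqrt k"
      using a b c d by linarith
    also have "\<dots> = 6 * (k powr (1/2) / k powr 2)"
      using k by (simp add: powr_half_sqrt field_simps)
    also have "k powr (1/2) / k powr 2 = k powr (-(3/2))" by (simp flip: powr_diff)
    finally show ?thesis by (simp add: f_def k_def)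
  qed
  have "\<bar>D n\<bar> \<le> \<bar>D 0\<bar> + (\<Sum>i<Suc n. f i)" for n
  proof (induction n)
    case (Suc n)
    have "\<bar>D (Suc n)\<bar> \<le> \<bar>D n\<bar> + \<bar>D (Suc n) - D n\<bar>" by linarith
    thus ?case using Suc step[of n] by simp
  qed (use f0 in simp)
  moreover have "(\<Sum>i<Suc n. f i) \<le> suminf f" for n
    by (intro sum_le_suminf fs) (use f0 in auto)
  ultimately have *: "\<bar>D n\<bar> \<le> \<bar>D 0\<bar> + suminf f" for n by (meson add_left_mono order_trans)
  show ?thesis
  proof (intro exI allI)
    fix n show "\<bar>(\<Sum>k=1..n. ln (real k) / real k) - (ln (real n))\<^sup>2 / 2\<bar> \<le> \<bar>D 0\<bar> + suminf f"
    proof (cases n)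
      case 0
      have "suminf f \<ge> 0" by (intro suminf_nonneg fs f0)
      thus ?thesis using 0 by simp
    next
      case (Suc k)
      thus ?thesis using *[of k] unfolding D_def by simp
    qed
  qed
qed

text \<open>This writes (ln y)^2, up to O(1), as a sum over k of a function of y / k divided by k, a
  form that Moebius inversion undoes. Subtracting Euler's constant cancels the term linear in ln
  y.\<close>

lemma ln_squared_expansion:
  obtains K where "K \<ge> 0" "\<And>y. y \<ge> 1 \<Longrightarrow>
    \<bar>(ln y)\<^sup>2 - (\<Sum>k=1..nat \<lfloor>y\<rfloor>. (1 / real k) * (2 * ln (y / real k) - 2 * euler_mascheroni))\<bar> \<le> K"
proof -
  obtain C where C: "\<And>n. \<bar>(\<Sum>k=1..n. ln (real k) / real k) - (ln (real n))\<^sup>2 / 2\<bar> \<le> C"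
    using sum_ln_div_bounded by blast
  have C0: "C \<ge> 0" using C[of 0] by simp
  define g :: real where "g = euler_mascheroni"
  show ?thesis
  proof (rule that[of "2 * C + 4 + 2 * g\<^sup>2 + 8 + 8 * \<bar>g\<bar>"])
    show "0 \<le> 2 * C + 4 + 2 * g\<^sup>2 + 8 + 8 * \<bar>g\<bar>" using C0 by simp
    fix y :: real assume y: "y \<ge> 1"
    define n where "n = nat \<lfloor>y\<rfloor>"
    have n: "real n \<le> y" "y < real n + 1" "n \<ge> 1" using y unfolding n_def by (simp_all add: le_nat_iff le_floor_iff)
    define H where "H = (\<Sum>k=1..n. 1 / real k)"
    define Q where "Q = (\<Sum>k=1..n. ln (real k) / real k)"
    define L where "L = ln y"
    have L: "0 \<le> L" "L \<le> y" using y ln_bound[of y] by (auto simp: L_def)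
    have Hh: "H = harm n" by (simp add: H_def harm_def inverse_eq_divide)
    have d1: "0 \<le> ln (real n + 1) - L" "ln (real n + 1) - L \<le> 1 / real n" "0 \<le> L - ln (real n)" "L - ln (real n) \<le> 1 / real n"
    proof -
      have "ln ((real n + 1) / real n) \<le> (real n + 1) / real n - 1" using n by (intro ln_le_minus_one) auto
      hence "ln (real n + 1) - ln (real n) \<le> 1 / real n" using n by (simp add: ln_div field_simps)
      moreover have "ln (real n) \<le> L" "L \<le> ln (real n + 1)" using n y by (auto simp: L_def)
      ultimately show "0 \<le> ln (real n + 1) - L" "ln (real n + 1) - L \<le> 1 / real n" "0 \<le> L - ln (real n)" "L - ln (real n) \<le> 1 / real n" by linarith+
    qed
    have "g \<in> {harm n - ln (real (Suc n)) + inverse (real (2 * (n + 1)))..harm n - ln (real (Suc n)) + inverse (real (2 * n))}"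
      unfolding g_def by (rule euler_mascheroni_bounds[OF n(3)])
    moreover have "inverse (real (2 * (n + 1))) \<ge> 0" "inverse (real (2 * n)) \<le> 1 / real n" using n by (auto simp: field_simps)
    moreover have "ln (real (Suc n)) = ln (real n + 1)" by (simp add: add.commute)
    ultimately have hg: "g \<ge> H - ln (real n + 1)" "g \<le> H - ln (real n + 1) + 1 / real n" unfolding Hh atLeastAtMost_iff by linarith+
    have n1: "real n \<ge> 1" using n(3) by simp
    have y2: "y \<le> 2 * real n" using n(2) n1 by linarith
    define d where "d = H - L - g"
    have "\<bar>d\<bar> \<le> 1 / real n" unfolding d_def using hg d1 by linarith
    also have "\<dots> \<le> 2 / y" using y2 n(3) y by (simp add: field_simps)
    finally have d: "\<bar>d\<bar> \<le> 2 / y" .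
    have Ld: "\<bar>L * d\<bar> \<le> 2"
    proof -
      have "\<bar>L * d\<bar> \<le> y * (2 / y)" unfolding abs_mult using L d y by (intro mult_mono) auto
      thus ?thesis using y by simp
    qed
    have gd: "\<bar>g * d\<bar> \<le> 2 * \<bar>g\<bar>"
    proof -
      have "2 / y \<le> 2" using y by (simp add: field_simps)
      hence "\<bar>g\<bar> * \<bar>d\<bar> \<le> \<bar>g\<bar> * 2" using d by (intro mult_left_mono) auto
      thus ?thesis by (simp add: abs_mult)
    qed
    have LL: "\<bar>L\<^sup>2 - (ln (real n))\<^sup>2\<bar> \<le> 4"
    proof -
      have l0: "ln (real n) \<ge> 0" using n by simp
      have "L\<^sup>2 - (ln (real n))\<^sup>2 = (L - ln (real n)) * (L + ln (real n))" by (simp add: power2_eq_square algebra_simps)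
      also have "\<bar>\<dots>\<bar> \<le> (2 / y) * (2 * y)"
      proof -
        have "1 / real n \<le> 2 / y" using y2 n(3) y by (simp add: field_simps)
        hence "\<bar>L - ln (real n)\<bar> \<le> 2 / y" "\<bar>L + ln (real n)\<bar> \<le> 2 * y" using d1 L l0 by linarith+
        thus ?thesis unfolding abs_mult using y by (intro mult_mono) auto
      qed
      finally show ?thesis using y by simp
    qed
    have "(\<Sum>k=1..n. (1 / real k) * (2 * ln (y / real k) - 2 * g)) = (\<Sum>k=1..n. (2 * L - 2 * g) * (1 / real k) - 2 * (ln (real k) / real k))"
      using y by (intro sum.cong refl) (simp add: L_def ln_div field_simps)
    also have "\<dots> = (2 * L - 2 * g) * H - 2 * Q"
      by (simp add: sum_subtractf sum_distrib_left H_def Q_def)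
    also have "\<dots> = 2 * (L - g) * (L + g + d) - 2 * Q" by (simp add: d_def)
    finally have "L\<^sup>2 - (\<Sum>k=1..n. (1 / real k) * (2 * ln (y / real k) - 2 * g)) = 2 * (Q - (ln (real n))\<^sup>2 / 2) - (L\<^sup>2 - (ln (real n))\<^sup>2) + 2 * g\<^sup>2 - 2 * (L * d) + 2 * (g * d)"
      by (simp add: power2_eq_square algebra_simps)
    moreover have "\<bar>Q - (ln (real n))\<^sup>2 / 2\<bar> \<le> C" unfolding Q_def by (rule C)
    ultimately have "\<bar>L\<^sup>2 - (\<Sum>k=1..n. (1 / real k) * (2 * ln (y / real k) - 2 * g))\<bar> \<le> 2 * C + 4 + 2 * g\<^sup>2 + 4 + 4 * \<bar>g\<bar>"
      using LL Ld gd zero_le_power2[of g] unfolding abs_le_iff by argo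
    thus "\<bar>(ln y)\<^sup>2 - (\<Sum>k=1..nat \<lfloor>y\<rfloor>. (1 / real k) * (2 * ln (y / real k) - 2 * euler_mascheroni))\<bar> \<le> 2 * C + 4 + 2 * g\<^sup>2 + 8 + 8 * \<bar>g\<bar>"
      unfolding L_def n_def g_def by simp
  qed
qed

section \<open>Selberg's weights: main term and error\<close>

lemma nat_floor_divide: "nat \<lfloor>x / real d\<rfloor> = nat \<lfloor>x\<rfloor> div d"
  using floor_divide_real_eq_div[of "int d" x] by (simp add: nat_div_distrib')

text \<open>The main term left by Selberg's weights in the class of 1 modulo q. Coprimality appears
  because multiples of d meet that class only when d is coprime to q.\<close>

definition musum :: "nat \<Rightarrow> real \<Rightarrow> real" where
  "musum q x = (\<Sum>d | d \<in> {1..nat \<lfloor>x\<rfloor>} \<and> coprime d q. mu d / real d * (ln (x / real d))\<^sup>2)"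

text \<open>After inserting \<open>ln_squared_expansion\<close> and grouping by j = d k, the
  convolution of \<open>mu\<close> with 1 keeps only j = 1, worth 2 ln x minus twice Euler's
  constant. The bounded errors, weighted by 1 / d, add K times a harmonic sum.\<close>

lemma musum_1_bound:
  obtains K where "K \<ge> 0" "\<And>x. x \<ge> 1 \<Longrightarrow> \<bar>musum 1 x\<bar> \<le> K * (1 + ln x)"
proof -
  obtain K where K: "K \<ge> 0" "\<And>y. y \<ge> 1 \<Longrightarrow>
    \<bar>(ln y)\<^sup>2 - (\<Sum>k=1..nat \<lfloor>y\<rfloor>. (1 / real k) * (2 * ln (y / real k) - 2 * euler_mascheroni))\<bar> \<le> K"
    using ln_squared_expansion by blast
  define g :: real where "g = euler_mascheroni"
  define P where "P = (\<lambda>y. \<Sum>k=1..nat \<lfloor>y\<rfloor>. (1 / real k) * (2 * ln (y / real k) - 2 * g))"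
  show ?thesis
  proof (rule that[of "2 * K + 2 + 2 * \<bar>g\<bar>"])
    show "0 \<le> 2 * K + 2 + 2 * \<bar>g\<bar>" using K(1) by simp
    fix x :: real assume x: "x \<ge> 1"
    define N where "N = nat \<lfloor>x\<rfloor>"
    have N: "N \<ge> 1" "real N \<le> x" using x unfolding N_def by (simp_all add: le_nat_iff le_floor_iff)
    have "musum 1 x = (\<Sum>d=1..N. mu d / real d * (ln (x / real d))\<^sup>2)"
      unfolding musum_def N_def by (rule sum.cong) auto
    also have "\<dots> = (\<Sum>d=1..N. mu d / real d * P (x / real d)) + (\<Sum>d=1..N. mu d / real d * ((ln (x / real d))\<^sup>2 - P (x / real d)))"
      by (simp add: sum.distrib[symmetric] algebra_simps)
    also have "(\<Sum>d=1..N. mu d / real d * P (x / real d)) = 2 * ln x - 2 * g"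
    proof -
      have "(\<Sum>d=1..N. mu d / real d * P (x / real d)) = (\<Sum>d=1..N. \<Sum>k=1..N div d. mu d / real d * ((1 / real k) * (2 * ln (x / real d / real k) - 2 * g)))"
        unfolding P_def sum_distrib_left nat_floor_divide N_def ..
      also have "\<dots> = (\<Sum>j=1..N. \<Sum>p\<in>divpairs j. mu (fst p) / real (fst p) * ((1 / real (snd p)) * (2 * ln (x / real (fst p) / real (snd p)) - 2 * g)))"
        by (rule sum_divpairs[symmetric])
      also have "\<dots> = (\<Sum>j=1..N. (1 / real j) * (2 * ln (x / real j) - 2 * g) * dconv mu (\<lambda>_. 1) j)"
        unfolding dconv_def sum_distrib_left
        by (intro sum.cong refl) (auto simp: divpairs_def)
      also have "\<dots> = (\<Sum>j\<in>{1::nat}. 2 * ln x - 2 * g)"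
        by (rule sum.mono_neutral_cong_right) (use N dconv_mu_1 in auto)
      finally show ?thesis by simp
    qed
    finally have eq: "musum 1 x = 2 * ln x - 2 * g + (\<Sum>d=1..N. mu d / real d * ((ln (x / real d))\<^sup>2 - P (x / real d)))" .
    have "\<bar>\<Sum>d=1..N. mu d / real d * ((ln (x / real d))\<^sup>2 - P (x / real d))\<bar> \<le> (\<Sum>d=1..N. 1 / real d * K)"
    proof (intro order_trans[OF sum_abs] sum_mono)
      fix d assume d: "d \<in> {1..N}"
      have "real d \<le> x" using d N by auto
      hence "1 \<le> x / real d" using d by (simp add: field_simps)
      hence "\<bar>(ln (x / real d))\<^sup>2 - P (x / real d)\<bar> \<le> K" unfolding P_def g_def by (rule K(2))
      thus "\<bar>mu d / real d * ((ln (x / real d))\<^sup>2 - P (x / real d))\<bar> \<le> 1 / real d * K"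
        unfolding abs_mult using abs_mu_le[of d] by (intro mult_mono) (auto simp: divide_right_mono)
    qed
    also have "\<dots> = K * harm N" by (simp add: harm_def sum_distrib_left inverse_eq_divide)
    also have "harm N \<le> 1 + ln x"
    proof -
      have "harm N - ln (real N) \<le> harm 1 - ln (real 1)"
        using decseqD[OF decseq_harm_diff_ln, of 0 "N - 1"] N by simp
      moreover have "ln (real N) \<le> ln x" using N by simp
      ultimately show ?thesis by (simp add: harm_def)
    qed
    finally have b: "\<bar>\<Sum>d=1..N. mu d / real d * ((ln (x / real d))\<^sup>2 - P (x / real d))\<bar> \<le> K * (1 + ln x)"
      using K(1) by (simp add: mult_left_mono)
    have l0: "ln x \<ge> 0" using x by simp
    have "\<bar>musum 1 x\<bar> \<le> 2 * ln x + 2 * \<bar>g\<bar> + K * (1 + ln x)" unfolding eq using b l0 by linarith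
    also have "\<dots> \<le> (2 * K + 2 + 2 * \<bar>g\<bar>) * (1 + ln x)"
      using l0 K(1) mult_nonneg_nonneg[of "\<bar>g\<bar>" "ln x"] mult_nonneg_nonneg[of K "ln x"] by (simp add: algebra_simps)
    finally show "\<bar>musum 1 x\<bar> \<le> (2 * K + 2 + 2 * \<bar>g\<bar>) * (1 + ln x)" .
  qed
qed

text \<open>The terms with d = q e vanish if q divides e, and otherwise carry mu(q e) = - mu(e),
  reproducing the same sum at x / q.\<close>

lemma musum_prime_recursion:
  assumes q: "prime q" and x: "x \<ge> 1"
  shows "musum q x = musum 1 x + musum q (x / real q) / real q"
proof -
  define N where "N = nat \<lfloor>x\<rfloor>"
  define F where "F = (\<lambda>d. mu d / real d * (ln (x / real d))\<^sup>2)"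
  have cop: "coprime d q \<longleftrightarrow> \<not> q dvd d" for d
  proof
    assume c: "coprime d q"
    have u: "\<not> is_unit q" using q not_prime_unit by blast
    show "\<not> q dvd d"
    proof
      assume "q dvd d"
      from not_coprimeI[OF this dvd_refl u] c show False by (rule notE)
    qed
  next
    show "\<not> q dvd d \<Longrightarrow> coprime d q" using prime_imp_coprime[OF q, of d] by (simp add: coprime_commute)
  qed
  have "musum 1 x = (\<Sum>d=1..N. F d)" unfolding musum_def N_def F_def by (rule sum.cong) auto
  also have "\<dots> = (\<Sum>d\<in>{d. d \<in> {1..N} \<and> coprime d q} \<union> {d. d \<in> {1..N} \<and> q dvd d}. F d)"
    by (rule sum.cong[OF _ refl]) (use cop in blast)
  also have "\<dots> = (\<Sum>d | d \<in> {1..N} \<and> coprime d q. F d) + (\<Sum>d | d \<in> {1..N} \<and> q dvd d. F d)"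
  proof (rule sum.union_disjoint)
    show "{d. d \<in> {1..N} \<and> coprime d q} \<inter> {d. d \<in> {1..N} \<and> q dvd d} = {}" using cop by blast
  qed simp_all
  also have "(\<Sum>d | d \<in> {1..N} \<and> coprime d q. F d) = musum q x" by (simp add: musum_def N_def F_def)
  also have "(\<Sum>d | d \<in> {1..N} \<and> q dvd d. F d) = (\<Sum>e=1..N div q. F (q * e))"
  proof (rule sum.reindex_bij_witness[where i="\<lambda>e. q * e" and j="\<lambda>d. d div q"])
    have q0: "q > 0" using q by (rule prime_gt_0_nat)
    fix e assume e: "e \<in> {1..N div q}"
    hence "q * e \<le> N" using q0 by (simp add: less_eq_div_iff_mult_less_eq mult.commute)
    thus "q * e \<in> {d. d \<in> {1..N} \<and> q dvd d}" using e q0 by (auto simp: Suc_le_eq)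
    show "q * e div q = e" using q0 by simp
  next
    have q0: "q > 0" using q by (rule prime_gt_0_nat)
    fix d assume d: "d \<in> {d. d \<in> {1..N} \<and> q dvd d}"
    then obtain e where e: "d = q * e" by auto
    have "e > 0" using d e by (auto intro: Nat.gr0I)
    moreover have "d div q \<le> N div q" using d by (intro div_le_mono) auto
    ultimately show "d div q \<in> {1..N div q}" using e q0 by auto
  qed auto
  also have "\<dots> = (\<Sum>e | e \<in> {1..N div q} \<and> coprime e q. - (1 / real q) * (mu e / real e * (ln (x / real q / real e))\<^sup>2))"
  proof (rule sum.mono_neutral_cong_right)
    show "\<forall>e\<in>{1..N div q} - {e. e \<in> {1..N div q} \<and> coprime e q}. F (q * e) = 0"
    proof
      fix e assume "e \<in> {1..N div q} - {e. e \<in> {1..N div q} \<and> coprime e q}"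
      hence "q dvd e" using cop by blast
      thus "F (q * e) = 0" by (simp add: F_def mu_prime_mult[OF q])
    qed
    fix e assume "e \<in> {e. e \<in> {1..N div q} \<and> coprime e q}"
    hence "\<not> q dvd e" using cop by blast
    thus "F (q * e) = - (1 / real q) * (mu e / real e * (ln (x / real q / real e))\<^sup>2)"
      by (simp add: F_def mu_prime_mult[OF q])
  qed auto
  also have "\<dots> = - (musum q (x / real q) / real q)"
    unfolding musum_def nat_floor_divide N_def by (simp add: sum_divide_distrib sum_negf mult.commute)
  finally show ?thesis by simp
qed

text \<open>Iterating the recursion gives at most a geometric series of ratio 1/q \<le> 1/2, so
  doubling the constant for q = 1 suffices uniformly in q.\<close>

lemma musum_bound:
  obtains K where "K \<ge> 0" "\<And>q x. x \<ge> 1 \<Longrightarrow> q = 1 \<or> prime q \<Longrightarrow> \<bar>musum q x\<bar> \<le> K * (1 + ln x)"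
proof -
  obtain K where K: "K \<ge> 0" "\<And>x. x \<ge> 1 \<Longrightarrow> \<bar>musum 1 x\<bar> \<le> K * (1 + ln x)" using musum_1_bound by blast
  have pr: "\<bar>musum q x\<bar> \<le> 2 * K * (1 + ln x)" if q: "prime q" and x: "x \<ge> 1" for q x
    using x
  proof (induction "nat \<lfloor>x\<rfloor>" arbitrary: x rule: less_induct)
    case less
    have q2: "real q \<ge> 2" using prime_ge_2_nat[OF q] by simp
    have l0: "ln x \<ge> 0" using less.prems by simp
    have "\<bar>musum q (x / real q) / real q\<bar> \<le> K * (1 + ln x)"
    proof (cases "x / real q \<ge> 1")
      case False
      hence "nat \<lfloor>x / real q\<rfloor> = 0" by simp
      hence "musum q (x / real q) = 0" unfolding musum_def by simp
      thus ?thesis using K(1) l0 by simp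
    next
      case True
      have "nat \<lfloor>x\<rfloor> \<ge> 1" using less.prems by (simp add: le_nat_iff le_floor_iff)
      hence "nat \<lfloor>x / real q\<rfloor> < nat \<lfloor>x\<rfloor>" unfolding nat_floor_divide using prime_ge_2_nat[OF q] less.prems by (intro div_less_dividend) auto
      from less.hyps[OF this True] have "\<bar>musum q (x / real q)\<bar> \<le> 2 * K * (1 + ln (x / real q))" .
      also have "\<dots> \<le> 2 * K * (1 + ln x)"
        using K(1) q2 less.prems True by (intro mult_left_mono) (auto simp: field_simps)
      finally have "\<bar>musum q (x / real q)\<bar> / real q \<le> (2 * K * (1 + ln x)) / 2"
        using q2 K(1) l0 by (intro frac_le) auto
      thus ?thesis using q2 by simp
    qed
    thus ?case unfolding musum_prime_recursion[OF q less.prems]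
      using K(2)[OF less.prems] by linarith
  qed
  show ?thesis
  proof (rule that[of "2 * K"])
    fix q :: nat and x :: real assume x: "x \<ge> 1" and q: "q = 1 \<or> prime q"
    have "K * (1 + ln x) \<le> 2 * K * (1 + ln x)" using K(1) x by (intro mult_right_mono) auto
    thus "\<bar>musum q x\<bar> \<le> 2 * K * (1 + ln x)" using q pr[OF _ x] K(2)[OF x] by auto
  qed (use K in auto)
qed

lemma card_residue_class:
  assumes q: "q > 0"
  shows "\<bar>real (card {k \<in> {1..M}. [k = c] (mod q)}) - real M / real q\<bar> \<le> 1"
proof -
  let ?A = "{k \<in> {1..M}. [k = c] (mod q)}"
  have "inj_on (\<lambda>k. k div q) ?A"
  proof (rule inj_onI)
    fix x y assume *: "x \<in> ?A" "y \<in> ?A" "x div q = y div q"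
    hence "x mod q = y mod q" by (simp add: Cong.cong_def)
    with *(3) show "x = y" by (metis div_mult_mod_eq)
  qed
  moreover have "(\<lambda>k. k div q) ` ?A \<subseteq> {..M div q}" by (auto intro: div_le_mono)
  ultimately have "card ?A \<le> card {..M div q}" by (rule card_inj_on_le) simp
  hence "real (card ?A) \<le> real (M div q) + 1" by simp
  also have "\<dots> \<le> real M / real q + 1" using of_nat_div_le_of_nat[of M q] by simp
  finally have upper: "real (card ?A) \<le> real M / real q + 1" .
  \<comment> \<open>The representative is taken in {1..q}, because the counted interval starts at
    1.\<close>
  define r where "r = (if c mod q = 0 then q else c mod q)"
  have r: "1 \<le> r" "r \<le> q" "r mod q = c mod q" using q by (auto simp: r_def less_imp_le)
  have "inj_on (\<lambda>j. q * j + r) {..<M div q}" using q by (auto simp: inj_on_def)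
  moreover have "(\<lambda>j. q * j + r) ` {..<M div q} \<subseteq> ?A"
  proof
    fix k assume "k \<in> (\<lambda>j. q * j + r) ` {..<M div q}"
    then obtain j where j: "k = q * j + r" "j < M div q" by auto
    have "k \<le> q * Suc j" using j r by simp
    also have "\<dots> \<le> q * (M div q)" using j(2) by (intro mult_le_mono2) simp
    also have "\<dots> \<le> M" by simp
    finally have "k \<le> M" .
    moreover have "[k = c] (mod q)" using r(3) j(1) by (simp add: Cong.cong_def)
    ultimately show "k \<in> ?A" using j(1) r(1) by simp
  qed
  ultimately have "card {..<M div q} \<le> card ?A" by (rule card_inj_on_le) simp
  hence "real (M div q) \<le> real (card ?A)" by simp
  moreover have "real M / real q - 1 \<le> real (M div q)"
  proof -
    have "M < q * Suc (M div q)" using dividend_less_times_div[OF q, of M] by simp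
    hence "real M < real q * (real (M div q) + 1)" by (metis of_nat_Suc of_nat_less_iff of_nat_mult add.commute)
    thus ?thesis using q by (simp add: divide_le_eq field_simps)
  qed
  ultimately show ?thesis using upper by linarith
qed

text \<open>Inverting d modulo q turns the condition into one residue class for k. One unit of error
  comes from counting that class, at most one more from replacing N div d by N / d.\<close>

lemma card_multiples_residue_class:
  assumes q: "q > 0" and cop: "coprime d q" and d: "d > 0"
  shows "\<bar>real (card {k \<in> {1..N div d}. [d * k = 1] (mod q)}) - real N / (real d * real q)\<bar> \<le> 2"
proof -
  obtain c where c: "[d * c = 1] (mod q)" using cong_solve_coprime_nat[OF cop] by auto
  have "[d * k = 1] (mod q) \<longleftrightarrow> [k = c] (mod q)" for k
  proof -
    have "[d * k = 1] (mod q) \<longleftrightarrow> [d * k = d * c] (mod q)" using c by (metis cong_sym cong_trans)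
    also have "\<dots> \<longleftrightarrow> [k = c] (mod q)" using cop by (rule cong_mult_lcancel_nat)
    finally show ?thesis .
  qed
  hence "{k \<in> {1..N div d}. [d * k = 1] (mod q)} = {k \<in> {1..N div d}. [k = c] (mod q)}" by simp
  hence 1: "\<bar>real (card {k \<in> {1..N div d}. [d * k = 1] (mod q)}) - real (N div d) / real q\<bar> \<le> 1"
    using card_residue_class[OF q] by simp
  have "N < d * Suc (N div d)" using dividend_less_times_div[OF d, of N] by simp
  hence "real N < real d * (real (N div d) + 1)" by (metis of_nat_Suc of_nat_less_iff of_nat_mult add.commute)
  hence "real N / real d - 1 \<le> real (N div d)" using d by (simp add: divide_le_eq field_simps)
  hence "(real N / real d - 1) / real q \<le> real (N div d) / real q" by (rule divide_right_mono) simp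
  moreover have "real (N div d) / real q \<le> real N / real d / real q"
    by (rule divide_right_mono[OF of_nat_div_le_of_nat]) simp
  moreover have "1 / real q \<le> 1" using q by simp
  ultimately have "\<bar>real (N div d) / real q - real N / (real d * real q)\<bar> \<le> 1"
    by (simp add: diff_divide_distrib)
  thus ?thesis using 1 by linarith
qed

text \<open>The weight is the one from Selberg's proof of his symmetry formula.\<close>

lemma sieve_weight_lower_bound:
  assumes n: "1 \<le> n" "n \<le> N"
  shows "mangoldt n * ln (real N) \<le> (\<Sum>p\<in>divpairs n. mu (fst p) * (ln (real N / real (fst p)))\<^sup>2)"
proof -
  define L where "L = ln (real N / real n)"
  have L: "L \<ge> 0" "L = ln (real N) - ln (real n)" using n by (auto simp: L_def ln_div)
  have n0: "n > 0" using n by simp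
  have "(\<Sum>p\<in>divpairs n. mu (fst p) * (ln (real N / real (fst p)))\<^sup>2) = dconv mu (\<lambda>e. L\<^sup>2 + (2 * L * ln (real e) + (ln (real e))\<^sup>2)) n"
    unfolding dconv_def
  proof (rule sum.cong[OF refl])
    fix p assume p: "p \<in> divpairs n"
    hence "real n = real (fst p) * real (snd p)" "fst p > 0" "snd p > 0"
      using n0 by (auto simp: divpairs_def intro: Nat.gr0I)
    hence "ln (real N / real (fst p)) = L + ln (real (snd p))"
      using n by (simp add: L(2) ln_div ln_mult)
    thus "mu (fst p) * (ln (real N / real (fst p)))\<^sup>2 = mu (fst p) * (L\<^sup>2 + (2 * L * ln (real (snd p)) + (ln (real (snd p)))\<^sup>2))"
      by (simp add: power2_sum)
  qed
  also have "\<dots> = dconv mu (\<lambda>e. L\<^sup>2 * 1) n + (dconv mu (\<lambda>e. 2 * L * ln (real e)) n + dconv mu (\<lambda>e. (ln (real e))\<^sup>2) n)"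
    by (simp add: dconv_add_right)
  also have "dconv mu (\<lambda>e. L\<^sup>2 * 1) n = L\<^sup>2 * dconv mu (\<lambda>_. 1) n"
    unfolding dconv_def sum_distrib_left by (simp add: mult_ac)
  also have "dconv mu (\<lambda>e. 2 * L * ln (real e)) n = 2 * L * dconv mu (\<lambda>e. ln (real e)) n"
    unfolding dconv_def sum_distrib_left by (simp add: mult_ac)
  finally have eq: "(\<Sum>p\<in>divpairs n. mu (fst p) * (ln (real N / real (fst p)))\<^sup>2) =
    L\<^sup>2 * dconv mu (\<lambda>_. 1) n + (2 * L * mangoldt n + (ln n * mangoldt n + dconv mangoldt mangoldt n))"
    unfolding dconv_mu_ln[OF n0] dconv_mu_ln_squared[OF n0] .
  have "L\<^sup>2 * dconv mu (\<lambda>_. 1) n \<ge> 0" unfolding dconv_mu_1[OF n0] by simp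
  moreover have "dconv mangoldt mangoldt n \<ge> (0::real)" unfolding dconv_def by (intro sum_nonneg) (simp add: mangoldt_nonneg)
  moreover have "L * mangoldt n \<ge> (0::real)" using L by (simp add: mangoldt_nonneg)
  moreover have "mangoldt n * ln (real N) = L * mangoldt n + ln n * mangoldt n" unfolding L(2) by (simp add: algebra_simps)
  ultimately show ?thesis unfolding eq by linarith
qed

lemma ln_squared_le_sqrt: "x \<ge> 1 \<Longrightarrow> (ln x)\<^sup>2 \<le> 16 * sqrt x"
proof -
  assume x: "x \<ge> (1::real)"
  have "ln (sqrt x) \<le> 2 * sqrt (sqrt x)" by (rule ln_le_2_sqrt) (use x in simp)
  hence "ln x \<le> 4 * sqrt (sqrt x)" using x by (simp add: ln_sqrt)
  hence "(ln x)\<^sup>2 \<le> (4 * sqrt (sqrt x))\<^sup>2" using x by (intro power_mono) auto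
  thus ?thesis using x by (simp add: power_mult_distrib)
qed

text \<open>The weight majorises mangoldt(n) ln N, and exchanging summations leaves, for each d, a
  count of multiples of d in the class with error at most 2. The errors total 64 N, because (ln (N /
  d))^2 \<le> 16 sqrt (N / d) and the sum of 1 / sqrt d contributes another factor 2.\<close>

lemma sieve_upper_bound:
  assumes q: "q > 0" and N: "N \<ge> 1"
  shows "(\<Sum>n | n \<in> {1..N} \<and> [n = 1] (mod q). mangoldt n) * ln (real N) \<le> real N / real q * \<bar>musum q (real N)\<bar> + 64 * real N"
proof -
  define f where "f = (\<lambda>d. mu d * (ln (real N / real d))\<^sup>2)"
  define I where "I = (\<lambda>n. if [n = 1] (mod q) then 1 else 0 :: real)"
  have "(\<Sum>n | n \<in> {1..N} \<and> [n = 1] (mod q). mangoldt n) * ln (real N) = (\<Sum>n=1..N. I n * (mangoldt n * ln (real N)))"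
    unfolding sum_distrib_right I_def by (rule sum.mono_neutral_cong_left) auto
  also have "\<dots> \<le> (\<Sum>n=1..N. I n * (\<Sum>p\<in>divpairs n. f (fst p)))"
    unfolding f_def by (intro sum_mono mult_left_mono sieve_weight_lower_bound) (auto simp: I_def)
  also have "\<dots> = (\<Sum>n=1..N. \<Sum>p\<in>divpairs n. f (fst p) * I (fst p * snd p))"
    unfolding sum_distrib_left by (intro sum.cong refl) (auto simp: divpairs_def)
  also have "\<dots> = (\<Sum>d=1..N. \<Sum>k=1..N div d. f d * I (d * k))" by (rule sum_divpairs)
  also have "\<dots> = (\<Sum>d=1..N. f d * real (card {k \<in> {1..N div d}. [d * k = 1] (mod q)}))"
  proof (rule sum.cong[OF refl])
    fix d
    have "(\<Sum>k=1..N div d. I (d * k)) = (\<Sum>k\<in>{k \<in> {1..N div d}. [d * k = 1] (mod q)}. 1)"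
      unfolding I_def by (rule sum.mono_neutral_cong_right) auto
    thus "(\<Sum>k=1..N div d. f d * I (d * k)) = f d * real (card {k \<in> {1..N div d}. [d * k = 1] (mod q)})"
      by (simp add: sum_distrib_left[symmetric])
  qed
  also have "\<dots> = (\<Sum>d | d \<in> {1..N} \<and> coprime d q. f d * real (card {k \<in> {1..N div d}. [d * k = 1] (mod q)}))"
  proof (rule sum.mono_neutral_right)
    show "\<forall>d\<in>{1..N} - {d. d \<in> {1..N} \<and> coprime d q}. f d * real (card {k \<in> {1..N div d}. [d * k = 1] (mod q)}) = 0"
    proof
      fix d assume "d \<in> {1..N} - {d. d \<in> {1..N} \<and> coprime d q}"
      hence nc: "\<not> coprime d q" by blast
      have "\<not> [d * k = 1] (mod q)" for k
      proof
        assume "[d * k = 1] (mod q)"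
        from cong_imp_coprime[OF cong_sym[OF this]] have "coprime (d * k) q" by simp
        thus False using nc by simp
      qed
      hence "{k \<in> {1..N div d}. [d * k = 1] (mod q)} = {}" by blast
      thus "f d * real (card {k \<in> {1..N div d}. [d * k = 1] (mod q)}) = 0" by simp
    qed
  qed auto
  also have "\<dots> \<le> (\<Sum>d | d \<in> {1..N} \<and> coprime d q. f d * (real N / (real d * real q)) + 2 * \<bar>f d\<bar>)"
  proof (rule sum_mono)
    fix d assume d: "d \<in> {d. d \<in> {1..N} \<and> coprime d q}"
    define c where "c = real (card {k \<in> {1..N div d}. [d * k = 1] (mod q)})"
    have c: "\<bar>c - real N / (real d * real q)\<bar> \<le> 2"
      unfolding c_def by (rule card_multiples_residue_class[OF q]) (use d in auto)
    have "f d * (c - real N / (real d * real q)) \<le> \<bar>f d\<bar> * \<bar>c - real N / (real d * real q)\<bar>"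
      by (metis abs_ge_self abs_mult)
    also have "\<dots> \<le> \<bar>f d\<bar> * 2" using c by (intro mult_left_mono) auto
    finally show "f d * real (card {k \<in> {1..N div d}. [d * k = 1] (mod q)}) \<le> f d * (real N / (real d * real q)) + 2 * \<bar>f d\<bar>"
      unfolding c_def[symmetric] by (simp add: algebra_simps)
  qed
  also have "\<dots> = (\<Sum>d | d \<in> {1..N} \<and> coprime d q. f d * (real N / (real d * real q))) + 2 * (\<Sum>d | d \<in> {1..N} \<and> coprime d q. \<bar>f d\<bar>)"
    by (simp add: sum.distrib sum_distrib_left)
  also have "(\<Sum>d | d \<in> {1..N} \<and> coprime d q. f d * (real N / (real d * real q))) = real N / real q * musum q (real N)"
    unfolding musum_def sum_distrib_left f_def by (intro sum.cong) (auto simp: field_simps)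
  also have "\<dots> \<le> real N / real q * \<bar>musum q (real N)\<bar>" by (intro mult_left_mono) auto
  also have "(\<Sum>d | d \<in> {1..N} \<and> coprime d q. \<bar>f d\<bar>) \<le> 32 * real N"
  proof -
    have "(\<Sum>d | d \<in> {1..N} \<and> coprime d q. \<bar>f d\<bar>) \<le> (\<Sum>d=1..N. \<bar>f d\<bar>)" by (rule sum_mono2) auto
    also have "\<dots> \<le> (\<Sum>d=1..N. 16 * sqrt (real N) * (1 / sqrt (real d)))"
    proof (rule sum_mono)
      fix d assume d: "d \<in> {1..N}"
      have "\<bar>f d\<bar> \<le> 1 * (16 * sqrt (real N / real d))"
        unfolding f_def abs_mult using abs_mu_le d by (intro mult_mono) (auto intro!: ln_squared_le_sqrt)
      thus "\<bar>f d\<bar> \<le> 16 * sqrt (real N) * (1 / sqrt (real d))" by (simp add: real_sqrt_divide)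
    qed
    also have "\<dots> \<le> 16 * sqrt (real N) * (2 * sqrt (real N))"
      unfolding sum_distrib_left[symmetric] by (intro mult_left_mono sum_inverse_sqrt_le) auto
    finally show ?thesis by simp
  qed
  finally show ?thesis by simp
qed

text \<open>Division of the sieve bound by ln N: the main term, of size (N / q) ln N, becomes N / q,
  and the counting errors become N / ln N. The constant is uniform in q, as the tail estimate
  demands; q = 1 yields Chebyshev's bound.\<close>

theorem brun_titchmarsh_weak:
  obtains K where "K \<ge> 0" "\<And>q N. N \<ge> 2 \<Longrightarrow> q = 1 \<or> prime q \<Longrightarrow>
    (\<Sum>n | n \<in> {1..N} \<and> [n = 1] (mod q). mangoldt n) \<le> K * (real N / real q + real N / ln (real N))"
proof -
  obtain K where K: "K \<ge> 0" "\<And>q x. x \<ge> 1 \<Longrightarrow> q = 1 \<or> prime q \<Longrightarrow> \<bar>musum q x\<bar> \<le> K * (1 + ln x)"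
    using musum_bound by blast
  show ?thesis
  proof (rule that[of "3 * K + 64"])
    fix q N :: nat assume N: "N \<ge> 2" and q: "q = 1 \<or> prime q"
    have q0: "q > 0" using q prime_gt_0_nat by auto
    have "ln 2 \<le> ln (real N)" using N by simp
    \<comment> \<open>This turns 1 + ln N into at most 3 ln N.\<close>
    hence l: "ln (real N) \<ge> 1 / 2" using ln2_ge_two_thirds by simp
    define P where "P = (\<Sum>n | n \<in> {1..N} \<and> [n = 1] (mod q). mangoldt n :: real)"
    have "P * ln (real N) \<le> real N / real q * \<bar>musum q (real N)\<bar> + 64 * real N"
      unfolding P_def by (rule sieve_upper_bound[OF q0]) (use N in simp)
    also have "\<dots> \<le> real N / real q * (K * (1 + ln (real N))) + 64 * real N"
      using N by (intro add_mono mult_left_mono K(2) q) auto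
    also have "\<dots> \<le> real N / real q * (K * (3 * ln (real N))) + 64 * real N"
      using K(1) l by (intro add_mono mult_left_mono) auto
    finally have "P \<le> (real N / real q * (K * (3 * ln (real N))) + 64 * real N) / ln (real N)"
      using l by (simp add: pos_le_divide_eq)
    also have "\<dots> = 3 * K * (real N / real q) + 64 * (real N / ln (real N))"
      using l by (simp add: add_divide_distrib)
    also have "\<dots> \<le> (3 * K + 64) * (real N / real q) + (3 * K + 64) * (real N / ln (real N))"
      using K(1) l by (intro add_mono mult_right_mono) auto
    finally show "(\<Sum>n | n \<in> {1..N} \<and> [n = 1] (mod q). mangoldt n) \<le> (3 * K + 64) * (real N / real q + real N / ln (real N))"
      unfolding P_def by (simp add: distrib_left)
  qed (use K in auto)
qed

section \<open>Chebyshev and Mertens estimates\<close>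

lemma chebyshev_upper:
  obtains K where "K \<ge> 0" "\<And>N. (\<Sum>n=1..N. mangoldt n) \<le> K * real N"
proof -
  obtain K where K: "K \<ge> 0" "\<And>q N. N \<ge> 2 \<Longrightarrow> q = 1 \<or> prime q \<Longrightarrow>
    (\<Sum>n | n \<in> {1..N} \<and> [n = 1] (mod q). mangoldt n) \<le> K * (real N / real q + real N / ln (real N))"
    using brun_titchmarsh_weak by blast
  show ?thesis
  proof (rule that[of "3 * K"])
    fix N :: nat
    show "(\<Sum>n=1..N. mangoldt n) \<le> 3 * K * real N"
    proof (cases "N \<ge> 2")
      case True
      have "ln 2 \<le> ln (real N)" using True by simp
      hence l: "ln (real N) \<ge> 1 / 2" using ln2_ge_two_thirds by simp
      have "(\<Sum>n=1..N. mangoldt n) = (\<Sum>n | n \<in> {1..N} \<and> [n = 1] (mod 1). mangoldt n :: real)" by (rule sum.cong) auto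
      also have "\<dots> \<le> K * (real N / real 1 + real N / ln (real N))" by (rule K(2)[OF True]) simp
      also have "\<dots> \<le> K * (real N + real N / (1 / 2))"
        using K(1) l by (intro mult_left_mono add_mono divide_left_mono) auto
      finally show ?thesis by simp
    next
      case False
      hence "N = 0 \<or> N = 1" by auto
      thus ?thesis using K(1) by auto
    qed
  qed (use K in auto)
qed

lemma sum_ln_bounds:
  "(\<Sum>n=1..N. ln (real n)) \<le> real N * ln (real N)" "real N * ln (real N) - real N \<le> (\<Sum>n=1..N. ln (real n))"
proof -
  have "(\<Sum>n=1..N. ln (real n)) \<le> (\<Sum>n=1..N. ln (real N))" by (intro sum_mono) auto
  thus "(\<Sum>n=1..N. ln (real n)) \<le> real N * ln (real N)" by simp
  show "real N * ln (real N) - real N \<le> (\<Sum>n=1..N. ln (real n))"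
  proof (induction N)
    case (Suc N)
    show ?case
    proof (cases "N = 0")
      case False
      have "ln (real (Suc N) / real N) \<le> real (Suc N) / real N - 1" using False by (intro ln_le_minus_one) auto
      hence "ln (real (Suc N)) - ln (real N) \<le> 1 / real N" using False by (simp add: ln_div field_simps del: of_nat_Suc)
      hence "real N * (ln (real (Suc N)) - ln (real N)) \<le> 1" using False by (simp add: field_simps del: of_nat_Suc)
      thus ?thesis using Suc by (simp add: algebra_simps)
    qed simp
  qed simp
qed

text \<open>The logarithm of N factorial equals the sum of mangoldt(d) times N div d. Replacing N
  div d by N / d costs at most the sum of mangoldt(d), which is O(N).\<close>

lemma mertens:
  obtains K where "K \<ge> 0" "\<And>N. N \<ge> 1 \<Longrightarrow> \<bar>(\<Sum>n=1..N. mangoldt n / real n) - ln (real N)\<bar> \<le> K"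
proof -
  obtain K where K: "K \<ge> 0" "\<And>N. (\<Sum>n=1..N. mangoldt n) \<le> K * real N" using chebyshev_upper by blast
  show ?thesis
  proof (rule that[of "K + 1"])
    fix N :: nat assume N: "N \<ge> 1"
    define T where "T = (\<Sum>n=1..N. ln (real n))"
    define S where "S = (\<Sum>n=1..N. mangoldt n / real n :: real)"
    have "T = (\<Sum>n=1..N. dconv mangoldt (\<lambda>_. 1) n)" unfolding T_def by (intro sum.cong refl) (simp add: dconv_mangoldt_1)
    also have "\<dots> = (\<Sum>d=1..N. mangoldt d * real (N div d))" unfolding sum_dconv by simp
    finally have T: "T = (\<Sum>d=1..N. mangoldt d * real (N div d))" .
    have NS: "real N * S = (\<Sum>d=1..N. mangoldt d * (real N / real d))" unfolding S_def sum_distrib_left by (simp add: mult_ac)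
    have "T \<le> real N * S" unfolding T NS
      by (intro sum_mono mult_left_mono of_nat_div_le_of_nat) (simp add: mangoldt_nonneg)
    hence "real N * (ln (real N) - 1) \<le> real N * S" using sum_ln_bounds(2)[of N] by (simp add: T_def algebra_simps)
    hence 1: "ln (real N) - 1 \<le> S" using N by simp
    have "real N * S \<le> (\<Sum>d=1..N. mangoldt d * (real (N div d) + 1))"
      unfolding NS
    proof (intro sum_mono mult_left_mono)
      fix d assume d: "d \<in> {1..N}"
      have "N < d * Suc (N div d)" using dividend_less_times_div[of d N] d by simp
      hence "real N < real d * (real (N div d) + 1)" by (metis of_nat_Suc of_nat_less_iff of_nat_mult add.commute)
      thus "real N / real d \<le> real (N div d) + 1" using d by (simp add: divide_le_eq mult.commute)
    qed (simp add: mangoldt_nonneg)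
    also have "\<dots> = T + (\<Sum>d=1..N. mangoldt d)" unfolding T by (simp add: algebra_simps sum.distrib)
    also have "\<dots> \<le> real N * ln (real N) + K * real N" using sum_ln_bounds(1)[of N] K(2)[of N] by (simp add: T_def)
    finally have "real N * S \<le> real N * (ln (real N) + K)" by (simp add: algebra_simps)
    hence 2: "S \<le> ln (real N) + K" using N by simp
    show "\<bar>(\<Sum>n=1..N. mangoldt n / real n) - ln (real N)\<bar> \<le> K + 1"
      unfolding S_def[symmetric] using 1 2 K(1) by linarith
  qed (use K in simp)
qed

text \<open>R is so large that ln R exceeds the two Mertens errors by 1. Hence mangoldt(n) / n sums
  to at least 1 over (N div R, N], and mangoldt(n) itself to at least N div R. Prime powers take
  away at most N / (2 R) plus a constant, and for large N the rounding and the constants take at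
  most another N / (4 R).\<close>

lemma chebyshev_lower_interval:
  obtains R N0 :: nat where "R \<ge> 1" "\<And>N. N \<ge> N0 \<Longrightarrow> N div R \<ge> 1 \<and>
     real N / (4 * real R) \<le> (\<Sum>p | prime p \<and> p \<in> {N div R<..N}. ln (real p))"
proof -
  obtain K where K: "K \<ge> 0" "\<And>N. N \<ge> 1 \<Longrightarrow> \<bar>(\<Sum>n=1..N. mangoldt n / real n) - ln (real N)\<bar> \<le> K" using mertens by blast
  obtain R :: nat where R: "real R > exp (2 * K + 1)" using reals_Archimedean2 by blast
  have R0: "real R > 0" using R exp_gt_zero less_trans by blast
  hence R1: "R \<ge> 1" by simp
  have lR: "ln (real R) \<ge> 2 * K + 1" using R R0 by (metis exp_le_cancel_iff exp_ln less_imp_le)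
  define r where "r = (\<lambda>N. \<Sum>n | n \<in> {1..N} \<and> \<not> prime n. mangoldt n :: real)"
  have r: "sublinear r" using prime_power_mangoldt_sublinear unfolding r_def .
  obtain C where C: "C \<ge> 0" "\<And>N. norm (r N) \<le> (1 / (2 * real R)) * real N + C"
    by (rule sublinearD[OF r, of "1 / (2 * real R)"]) (use R0 in auto)
  obtain N0 :: nat where N0: "real N0 > 4 * real R * (C + 1)" using reals_Archimedean2 by blast
  show ?thesis
  proof (rule that[of R "N0 + R", OF R1])
    fix N assume N: "N \<ge> N0 + R"
    define M where "M = N div R"
    have M: "M \<ge> 1" unfolding M_def using N R1 by (simp add: less_eq_div_iff_mult_less_eq)
    have MN: "M \<le> N" unfolding M_def by simp
    have "real M \<le> real N / real R" unfolding M_def by (rule of_nat_div_le_of_nat)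
    hence "real R \<le> real N / real M" using R0 M by (simp add: field_simps)
    hence "ln (real R) \<le> ln (real N / real M)" using R0 M N R1 by (subst ln_le_cancel_iff) auto
    also have "\<dots> = ln (real N) - ln (real M)" using M N R1 by (simp add: ln_div)
    finally have "ln (real N) - ln (real M) \<ge> 2 * K + 1" using lR by linarith
    moreover have "N \<ge> 1" using M MN by linarith
    ultimately have "(\<Sum>n=1..N. mangoldt n / real n) - (\<Sum>n=1..M. mangoldt n / real n) \<ge> (1::real)"
      using K(2)[of N] K(2)[OF M] by linarith
    moreover have "(\<Sum>n=1..N. mangoldt n / real n) = (\<Sum>n=1..M. mangoldt n / real n) + (\<Sum>n\<in>{M<..N}. mangoldt n / real n :: real)"
      using MN by (subst sum.union_disjoint[symmetric]) (auto intro!: sum.cong)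
    ultimately have "1 \<le> (\<Sum>n\<in>{M<..N}. mangoldt n / real n :: real)" by linarith
    also have "\<dots> \<le> (\<Sum>n\<in>{M<..N}. mangoldt n / real M)"
      using M by (intro sum_mono divide_left_mono) (auto simp: mangoldt_nonneg)
    also have "\<dots> = (\<Sum>n\<in>{M<..N}. mangoldt n) / real M" by (simp add: sum_divide_distrib)
    finally have 1: "real M \<le> (\<Sum>n\<in>{M<..N}. mangoldt n)" using M by (simp add: le_divide_eq)
    have "{M<..N} = {p. prime p \<and> p \<in> {M<..N}} \<union> {n. n \<in> {M<..N} \<and> \<not> prime n}" by blast
    hence "(\<Sum>n\<in>{M<..N}. mangoldt n :: real) = (\<Sum>n\<in>{p. prime p \<and> p \<in> {M<..N}} \<union> {n. n \<in> {M<..N} \<and> \<not> prime n}. mangoldt n)"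
      by (rule sum.cong) (rule refl)
    also have "\<dots> = (\<Sum>p | prime p \<and> p \<in> {M<..N}. mangoldt p) + (\<Sum>n | n \<in> {M<..N} \<and> \<not> prime n. mangoldt n)"
      by (rule sum.union_disjoint) auto
    also have "(\<Sum>p | prime p \<and> p \<in> {M<..N}. mangoldt p :: real) = (\<Sum>p | prime p \<and> p \<in> {M<..N}. ln (real p))"
      by (rule sum.cong) auto
    also have "(\<Sum>n | n \<in> {M<..N} \<and> \<not> prime n. mangoldt n :: real) \<le> r N"
      unfolding r_def by (rule sum_mono2) (auto simp: mangoldt_nonneg)
    finally have 2: "(\<Sum>n\<in>{M<..N}. mangoldt n) \<le> (\<Sum>p | prime p \<and> p \<in> {M<..N}. ln (real p)) + r N" by simp
    have "N < R * Suc M" unfolding M_def using dividend_less_times_div[of R N] R1 by simp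
    hence "real N < real R * (real M + 1)" by (metis of_nat_Suc of_nat_less_iff of_nat_mult add.commute)
    hence 3: "real N / real R - 1 \<le> real M" using R0 by (simp add: divide_le_eq field_simps)
    have 4: "r N \<le> real N / real R / 2 + C" using C(2)[of N] by simp
    have "real N0 \<le> real N" using N by simp
    hence "4 * real R * (C + 1) \<le> real N" using N0 by linarith
    hence 5: "C + 1 \<le> real N / real R / 4" using R0 by (simp add: field_simps)
    define t where "t = real N / real R"
    have "t / 4 \<le> (\<Sum>p | prime p \<and> p \<in> {M<..N}. ln (real p))"
      using 1 2 3[folded t_def] 4[folded t_def] 5[folded t_def] by linarith
    hence "real N / real R / 4 \<le> (\<Sum>p | prime p \<and> p \<in> {M<..N}. ln (real p))" unfolding t_def .
    thus "N div R \<ge> 1 \<and> real N / (4 * real R) \<le> (\<Sum>p | prime p \<and> p \<in> {N div R<..N}. ln (real p))"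
      using M unfolding M_def by (simp add: mult.commute)
  qed
qed

section \<open>Means over the primes\<close>

definition wfun :: "nat \<Rightarrow> nat \<Rightarrow> nat \<Rightarrow> real" where
  "wfun k r p = real p ^ k * (real p - 1) ^ r"

text \<open>The weight per unit of ln p. It increases for r \<ge> 1, so partial summation can be run
  against sums of ln p.\<close>

definition gfun :: "nat \<Rightarrow> nat \<Rightarrow> nat \<Rightarrow> real" where
  "gfun k r n = wfun k r n / ln (real n)"

definition wsum :: "nat \<Rightarrow> nat \<Rightarrow> nat \<Rightarrow> real" where
  "wsum k r N = (\<Sum>p | prime p \<and> p \<le> N. wfun k r p)"

lemma wfun_nonneg: "n \<ge> 1 \<Longrightarrow> wfun k r n \<ge> 0"
  by (simp add: wfun_def)

lemma wfun_prime_pos: "prime p \<Longrightarrow> wfun k r p > 0"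
  using prime_gt_1_nat[of p] by (simp add: wfun_def)

lemma gfun_nonneg: "n \<ge> 2 \<Longrightarrow> gfun k r n \<ge> 0"
  by (simp add: gfun_def wfun_nonneg)

lemma wfun_eq_gfun: "n \<ge> 2 \<Longrightarrow> wfun k r n = gfun k r n * ln (real n)"
  by (simp add: gfun_def)

lemma minus_1_div_ln_mono:
  fixes x y :: real
  assumes "1 < x" "x \<le> y"
  shows "(x - 1) / ln x \<le> (y - 1) / ln y"
proof -
  have lx: "ln x > 0" "ln y > 0" using assms by auto
  have "ln (y / x) \<le> y / x - 1" using assms by (intro ln_le_minus_one) auto
  hence 1: "ln y - ln x \<le> (y - x) / x" using assms by (simp add: ln_div field_simps)
  have "ln (1 / x) \<le> 1 / x - 1" using assms by (intro ln_le_minus_one) auto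
  hence 2: "(x - 1) / x \<le> ln x" using assms by (simp add: ln_div field_simps)
  have "(x - 1) * (ln y - ln x) \<le> (x - 1) * ((y - x) / x)" using 1 assms by (intro mult_left_mono) auto
  also have "\<dots> = (x - 1) / x * (y - x)" by simp
  also have "\<dots> \<le> ln x * (y - x)" using 2 assms by (intro mult_right_mono) auto
  finally have "(x - 1) * ln y \<le> (y - 1) * ln x" by (simp add: algebra_simps)
  thus ?thesis using lx by (simp add: field_simps)
qed

lemma gfun_mono:
  assumes r: "r \<ge> 1" and mn: "2 \<le> m" "m \<le> n"
  shows "gfun k r m \<le> gfun k r n"
proof -
  obtain s where s: "r = Suc s" using r by (cases r) auto
  have eq: "gfun k r x = real x ^ k * (real x - 1) ^ s * ((real x - 1) / ln (real x))" for x
    by (simp add: gfun_def wfun_def s)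
  show ?thesis unfolding eq
    by (intro mult_mono power_mono minus_1_div_ln_mono) (use mn in auto)
qed

text \<open>The primes in (N div R, N] alone suffice: there p - 1 \<ge> N div R \<ge> N / (2 R), so
  each weight loses only a constant factor against the weight at N.\<close>

lemma wsum_lower_bound:
  obtains c N0 where "c > 0" "N0 \<ge> 2" "\<And>N. N \<ge> N0 \<Longrightarrow> c * real N * gfun k r N \<le> wsum k r N"
proof -
  obtain R N0 :: nat where R: "R \<ge> 1" and N0: "\<And>N. N \<ge> N0 \<Longrightarrow> N div R \<ge> 1 \<and>
     real N / (4 * real R) \<le> (\<Sum>p | prime p \<and> p \<in> {N div R<..N}. ln (real p))"
    using chebyshev_lower_interval by blast
  define c where "c = 1 / ((2 * real R) ^ (k + r) * (4 * real R))"
  show ?thesis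
  proof (rule that[of c "max 2 N0"])
    show "c > 0" using R by (simp add: c_def)
    fix N assume N: "N \<ge> max 2 N0"
    define M where "M = N div R"
    have M: "M \<ge> 1" and th: "real N / (4 * real R) \<le> (\<Sum>p | prime p \<and> p \<in> {M<..N}. ln (real p))"
      unfolding M_def using N0[of N] N by auto
    have l: "ln (real N) > 0" using N by simp
    have "N < R * Suc M" unfolding M_def using dividend_less_times_div[of R N] R by simp
    also have "\<dots> \<le> R * (2 * M)" using M by (intro mult_le_mono2) simp
    finally have "real N \<le> real (R * (2 * M))" by linarith
    hence NM: "real N / (2 * real R) \<le> real M" using R by (simp add: field_simps)
    have "c * real N * gfun k r N = (real N / (4 * real R)) * (wfun k r N / (2 * real R) ^ (k + r)) / ln (real N)"
      unfolding c_def gfun_def by (simp add: field_simps)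
    also have "\<dots> \<le> (real N / (4 * real R)) * (real M ^ (k + r)) / ln (real N)"
    proof (intro divide_right_mono mult_left_mono)
      have "wfun k r N \<le> real N ^ k * real N ^ r" unfolding wfun_def using N by (intro mult_left_mono power_mono) auto
      hence "wfun k r N / (2 * real R) ^ (k + r) \<le> real N ^ (k + r) / (2 * real R) ^ (k + r)"
        using R by (intro divide_right_mono) (auto simp: power_add)
      also have "\<dots> = (real N / (2 * real R)) ^ (k + r)" by (simp add: power_divide)
      also have "\<dots> \<le> real M ^ (k + r)" using NM R by (intro power_mono) auto
      finally show "wfun k r N / (2 * real R) ^ (k + r) \<le> real M ^ (k + r)" .
    qed (use l R in auto)
    also have "\<dots> \<le> (\<Sum>p | prime p \<and> p \<in> {M<..N}. ln (real p)) * (real M ^ (k + r)) / ln (real N)"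
      using th l by (intro divide_right_mono mult_right_mono) auto
    also have "\<dots> = (\<Sum>p | prime p \<and> p \<in> {M<..N}. real M ^ (k + r) * (ln (real p) / ln (real N)))"
      unfolding sum_distrib_right sum_divide_distrib by (intro sum.cong refl) simp
    also have "\<dots> \<le> (\<Sum>p | prime p \<and> p \<in> {M<..N}. wfun k r p)"
    proof (rule sum_mono)
      fix p assume p: "p \<in> {p. prime p \<and> p \<in> {M<..N}}"
      have "real M ^ (k + r) * (ln (real p) / ln (real N)) \<le> real M ^ (k + r) * 1"
        using p l prime_gt_0_nat[of p] by (intro mult_left_mono) (auto simp: divide_le_eq)
      also have "\<dots> = real M ^ k * real M ^ r" by (simp add: power_add)
      also have "\<dots> \<le> real p ^ k * (real p - 1) ^ r" using p by (intro mult_mono power_mono) auto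
      finally show "real M ^ (k + r) * (ln (real p) / ln (real N)) \<le> wfun k r p" by (simp add: wfun_def)
    qed
    also have "\<dots> \<le> wsum k r N"
      unfolding wsum_def using wfun_prime_pos by (intro sum_mono2) (auto intro: less_imp_le)
    finally show "c * real N * gfun k r N \<le> wsum k r N" .
  qed simp
qed

lemma wsum_pos: "N \<ge> 2 \<Longrightarrow> wsum k r N > 0"
proof -
  assume N: "N \<ge> 2"
  have "wfun k r 2 \<le> wsum k r N"
    unfolding wsum_def using N by (intro member_le_sum) (auto intro: less_imp_le[OF wfun_prime_pos])
  thus ?thesis using wfun_prime_pos[of 2 k r] by simp
qed

section \<open>Weighted equidistribution of the primes in residue classes\<close>

definition negligible :: "nat \<Rightarrow> nat \<Rightarrow> (nat \<Rightarrow> 'a :: real_normed_vector) \<Rightarrow> bool" where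
  "negligible k r f \<longleftrightarrow> (\<forall>e>0. eventually (\<lambda>N. norm (f N) \<le> e * wsum k r N) sequentially)"

text \<open>Partial summation with the increasing factor \<open>gfun\<close> bounds the sum by
  gfun(N) times o(N), and N gfun(N) is O(wsum(N)) by \<open>wsum_lower_bound\<close>.\<close>

lemma negligible_dchar_sum:
  assumes r: "r \<ge> 1" and \<xi>: "m > 0" "dchar m \<xi>" "\<xi> \<noteq> principal_dchar m"
  shows "negligible k r (\<lambda>N. \<Sum>p | prime p \<and> p \<le> N. wfun k r p *\<^sub>R \<xi> p)"
proof -
  define Th where "Th = (\<lambda>N. \<Sum>p | prime p \<and> p \<le> N. \<xi> p * ln (real p))"
  have Th: "sublinear Th" unfolding Th_def by (rule theta_dchar_sublinear[OF \<xi>])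
  \<comment> \<open>The shift by 2 starts the sequence at the smallest prime, from where
    \<open>gfun\<close> is known to be nonnegative and increasing.\<close>
  define a where "a = (\<lambda>n. if prime (n + 2) then \<xi> (n + 2) * of_real (ln (real (n + 2))) else 0)"
  have shift: "(\<Sum>n<Suc M. if prime (n + 2) then h (n + 2) else 0) = (\<Sum>p | prime p \<and> p \<le> M + 2. h p)" for M and h :: "nat \<Rightarrow> complex"
  proof -
    have "(\<Sum>n<Suc M. if prime (n + 2) then h (n + 2) else 0) = (\<Sum>n | n < Suc M \<and> prime (n + 2). h (n + 2))"
      by (rule sum.mono_neutral_cong_right) auto
    also have "\<dots> = (\<Sum>p | prime p \<and> p \<le> M + 2. h p)"
    proof (rule sum.reindex_bij_witness[where i="\<lambda>p. p - 2" and j="\<lambda>n. n + 2"])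
      fix p assume p: "p \<in> {p. prime p \<and> p \<le> M + 2}"
      hence "p \<ge> 2" by (auto dest: prime_ge_2_nat)
      thus *: "p - 2 + 2 = p" by simp
      show "p - 2 \<in> {n. n < Suc M \<and> prime (n + 2)}" unfolding mem_Collect_eq * using p by auto
    qed auto
    finally show ?thesis .
  qed
  have aTh: "(\<Sum>j<Suc n. a j) = Th (n + 2)" for n
    unfolding a_def Th_def by (rule shift)
  show ?thesis
    unfolding negligible_def
  proof (intro allI impI)
    fix e :: real assume e: "e > 0"
    obtain c N0 where c: "c > 0" "N0 \<ge> 2" "\<And>N. N \<ge> N0 \<Longrightarrow> c * real N * gfun k r N \<le> wsum k r N"
      using wsum_lower_bound by blast
    have "e * c / 4 > 0" using e c by simp
    then obtain C where C: "C \<ge> 0" "\<And>N. norm (Th N) \<le> e * c / 4 * real N + C" using sublinearD[OF Th] by blast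
    obtain N1 :: nat where N1: "real N1 > 4 * C / (e * c)" using reals_Archimedean2 by blast
    show "eventually (\<lambda>N. norm (\<Sum>p | prime p \<and> p \<le> N. wfun k r p *\<^sub>R \<xi> p) \<le> e * wsum k r N) sequentially"
      using eventually_ge_at_top[of "max N0 N1"]
    proof eventually_elim
      case (elim N)
      obtain M where M: "N = M + 2" using elim c(2) by (metis add.commute le_Suc_ex le_trans max.bounded_iff)
      have "norm (\<Sum>n<Suc M. gfun k r (n + 2) *\<^sub>R a n) \<le> 2 * (e * c / 4 * real N + C) * gfun k r (M + 2)"
      proof (rule abel_increasing)
        show "norm (\<Sum>j<n. a j) \<le> e * c / 4 * real N + C" if n: "n \<le> Suc M" for n
        proof (cases n)
          case 0
          thus ?thesis using e c C(1) by simp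
        next
          case (Suc n')
          have "norm (\<Sum>j<n. a j) \<le> e * c / 4 * real (n' + 2) + C" unfolding Suc aTh by (rule C(2))
          also have "\<dots> \<le> e * c / 4 * real N + C" using e c n Suc M by (intro add_mono mult_left_mono) auto
          finally show ?thesis .
        qed
        show "gfun k r (n + 2) \<le> gfun k r (Suc n + 2)" for n by (rule gfun_mono[OF r]) auto
        show "0 \<le> gfun k r (0 + 2)" by (rule gfun_nonneg) simp
      qed
      also have "(\<Sum>n<Suc M. gfun k r (n + 2) *\<^sub>R a n) = (\<Sum>n<Suc M. if prime (n + 2) then wfun k r (n + 2) *\<^sub>R \<xi> (n + 2) else 0)"
      proof (rule sum.cong[OF refl])
        fix n
        have "wfun k r (n + 2) = gfun k r (n + 2) * ln (real (n + 2))" by (rule wfun_eq_gfun) simp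
        thus "gfun k r (n + 2) *\<^sub>R a n = (if prime (n + 2) then wfun k r (n + 2) *\<^sub>R \<xi> (n + 2) else 0)"
          by (simp add: a_def scaleR_conv_of_real)
      qed
      also have "\<dots> = (\<Sum>p | prime p \<and> p \<le> N. wfun k r p *\<^sub>R \<xi> p)" unfolding M by (rule shift)
      also have "2 * (e * c / 4 * real N + C) * gfun k r (M + 2) \<le> e * (c * real N * gfun k r N)"
      proof -
        have "real N1 \<le> real N" using elim by simp
        hence "4 * C / (e * c) < real N" using N1 by linarith
        hence CN: "4 * C \<le> e * c * real N" using e c(1) by (simp add: field_simps)
        define t where "t = e * c * real N"
        have "e * c / 4 * real N = t / 4" by (simp add: t_def)
        moreover have "2 * (t / 4 + C) \<le> t" using CN[folded t_def] C(1) by (simp add: field_simps)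
        ultimately have "2 * (e * c / 4 * real N + C) \<le> e * c * real N" by (simp only: t_def)
        hence "2 * (e * c / 4 * real N + C) * gfun k r N \<le> e * c * real N * gfun k r N"
          using elim c(2) by (intro mult_right_mono gfun_nonneg) auto
        thus ?thesis by (simp add: M mult_ac)
      qed
      also have "\<dots> \<le> e * wsum k r N" using e c(3)[of N] elim by (intro mult_left_mono) auto
      finally show ?case .
    qed
  qed
qed

lemma wsum_at_top: "r \<ge> 1 \<Longrightarrow> filterlim (wsum k r) at_top sequentially"
proof -
  assume r: "r \<ge> 1"
  obtain c N0 where c: "c > 0" "N0 \<ge> 2" "\<And>N. N \<ge> N0 \<Longrightarrow> c * real N * gfun k r N \<le> wsum k r N"
    using wsum_lower_bound by blast
  have g2: "gfun k r 2 > 0" by (simp add: gfun_def wfun_def)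
  have "filterlim (\<lambda>N. c * gfun k r 2 * real N) at_top sequentially"
    using c(1) g2 by (intro filterlim_tendsto_pos_mult_at_top[OF tendsto_const] filterlim_real_sequentially) auto
  thus ?thesis
  proof (rule filterlim_at_top_mono)
    show "eventually (\<lambda>N. c * gfun k r 2 * real N \<le> wsum k r N) sequentially"
      using eventually_ge_at_top[of N0]
    proof eventually_elim
      case (elim N)
      have "gfun k r 2 \<le> gfun k r N" using elim c(2) by (intro gfun_mono[OF r]) auto
      hence "c * real N * gfun k r 2 \<le> c * real N * gfun k r N" using c(1) by (intro mult_left_mono) auto
      thus ?case using c(3)[OF elim] by (simp add: mult_ac)
    qed
  qed
qed

text \<open>The mean is taken over the primes up to N; \<open>has_mean_imp_nth_prime_limit\<close>
  converts it to the first N primes.\<close>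

definition has_mean :: "nat \<Rightarrow> nat \<Rightarrow> (nat \<Rightarrow> real) \<Rightarrow> real \<Rightarrow> bool" where
  "has_mean k r F l \<longleftrightarrow> (\<lambda>N. (\<Sum>p | prime p \<and> p \<le> N. wfun k r p * F p) / wsum k r N) \<longlonglongrightarrow> l"

lemma has_mean_add: "has_mean k r F a \<Longrightarrow> has_mean k r G b \<Longrightarrow> has_mean k r (\<lambda>p. F p + G p) (a + b)"
  unfolding has_mean_def by (drule (1) tendsto_add) (simp add: distrib_left sum.distrib add_divide_distrib)

lemma has_mean_cmult: "has_mean k r F a \<Longrightarrow> has_mean k r (\<lambda>p. c * F p) (c * a)"
  unfolding has_mean_def by (drule tendsto_mult_left[of _ _ _ c]) (simp add: sum_distrib_left mult_ac)

lemma has_mean_sum: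
  assumes "finite A" "\<And>i. i \<in> A \<Longrightarrow> has_mean k r (F i) (a i)"
  shows "has_mean k r (\<lambda>p. \<Sum>i\<in>A. F i p) (\<Sum>i\<in>A. a i)"
  using assms
proof (induction A rule: finite_induct)
  case empty
  thus ?case by (simp add: has_mean_def)
next
  case (insert x A)
  thus ?case using has_mean_add[of k r "F x" "a x" "\<lambda>p. \<Sum>i\<in>A. F i p"] by simp
qed

text \<open>Means survive approximation when the weighted error is small against the total weight.
  This serves twice: for truncating multiplicities and for truncating the set of primes q.\<close>

lemma has_mean_approx:
  assumes "\<And>e. e > 0 \<Longrightarrow> \<exists>F' l'. has_mean k r F' l' \<and> \<bar>l' - l\<bar> \<le> e \<and>
     eventually (\<lambda>N. \<bar>\<Sum>p | prime p \<and> p \<le> N. wfun k r p * (F p - F' p)\<bar> \<le> e * wsum k r N) sequentially"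
  shows "has_mean k r F l"
  unfolding has_mean_def
proof (rule tendstoI)
  fix e :: real assume "e > 0"
  hence e: "e / 4 > 0" by simp
  obtain F' l' where F': "has_mean k r F' l'" "\<bar>l' - l\<bar> \<le> e / 4"
    "eventually (\<lambda>N. \<bar>\<Sum>p | prime p \<and> p \<le> N. wfun k r p * (F p - F' p)\<bar> \<le> e / 4 * wsum k r N) sequentially"
    using assms[OF e] by blast
  have "eventually (\<lambda>N. dist ((\<Sum>p | prime p \<and> p \<le> N. wfun k r p * F' p) / wsum k r N) l' < e / 4) sequentially"
    using F'(1) e unfolding has_mean_def by (rule tendstoD)
  thus "eventually (\<lambda>N. dist ((\<Sum>p | prime p \<and> p \<le> N. wfun k r p * F p) / wsum k r N) l < e) sequentially"
    using F'(3) eventually_ge_at_top[of 2]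
  proof eventually_elim
    case (elim N)
    define A where "A = (\<Sum>p | prime p \<and> p \<le> N. wfun k r p * F p) / wsum k r N"
    define B where "B = (\<Sum>p | prime p \<and> p \<le> N. wfun k r p * F' p) / wsum k r N"
    have W: "wsum k r N > 0" by (rule wsum_pos) (use elim in simp)
    have "A - B = (\<Sum>p | prime p \<and> p \<le> N. wfun k r p * (F p - F' p)) / wsum k r N"
      unfolding A_def B_def by (simp add: right_diff_distrib sum_subtractf diff_divide_distrib)
    hence "\<bar>A - B\<bar> \<le> e / 4" using elim(2) W by (simp add: abs_divide divide_le_eq)
    moreover have "\<bar>B - l'\<bar> < e / 4" using elim(1) by (simp add: B_def dist_real_def)
    ultimately have "\<bar>A - l\<bar> < e" using F'(2) \<open>e > 0\<close> by linarith
    thus ?case by (simp add: A_def dist_real_def)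
  qed
qed

lemma prime_cong_1_iff: "prime (p::nat) \<Longrightarrow> [p = 1] (mod d) \<longleftrightarrow> d dvd p - 1"
  using prime_ge_1_nat[of p] cong_altdef_nat[of 1 p d] by simp

text \<open>The indicator of p congruent to 1 modulo d is the average of all characters. The
  nonprincipal ones are negligible, and the principal one misses only the primes dividing d.\<close>

theorem has_mean_divides:
  assumes r: "r \<ge> 1" and d: "d > 0"
  shows "has_mean k r (\<lambda>p. if d dvd p - 1 then 1 else 0) (1 / real (totient d))"
proof -
  define X where "X = {\<xi>. dchar d \<xi>} - {principal_dchar d}"
  have fX: "finite X" unfolding X_def using finite_dchars[OF d] by simp
  define W where "W = wsum k r"
  define S where "S = (\<lambda>\<xi> N. \<Sum>p | prime p \<and> p \<le> N. wfun k r p *\<^sub>R (\<xi> p :: complex))"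
  have tot: "totient d > 0" using d by simp
  have lim0: "(\<lambda>N. S \<xi> N / of_real (W N)) \<longlonglongrightarrow> 0" if "\<xi> \<in> X" for \<xi>
  proof (rule tendstoI)
    fix e :: real assume e: "e > 0"
    have "e / 2 > 0" using e by simp
    have neg: "negligible k r (S \<xi>)" unfolding S_def
      by (rule negligible_dchar_sum[OF r d]) (use that in \<open>auto simp: X_def\<close>)
    from neg[unfolded negligible_def, rule_format, OF \<open>e / 2 > 0\<close>]
    have "eventually (\<lambda>N. norm (S \<xi> N) \<le> (e / 2) * W N) sequentially" unfolding W_def .
    thus "eventually (\<lambda>N. dist (S \<xi> N / of_real (W N)) 0 < e) sequentially"
      using eventually_ge_at_top[of 2]
    proof eventually_elim
      case (elim N)
      have "W N > 0" unfolding W_def by (rule wsum_pos) (use elim in simp)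
      moreover have "(e / 2) * W N < e * W N" using e \<open>W N > 0\<close> by simp
      ultimately show ?case using elim by (simp add: norm_divide divide_less_eq)
    qed
  qed
  have lim1: "(\<lambda>N. S (principal_dchar d) N / of_real (W N)) \<longlonglongrightarrow> 1"
  proof -
    \<comment> \<open>A fixed bound for the weight of the primes dividing d, negligible since the
      total weight tends to infinity.\<close>
    define B where "B = (\<Sum>p | prime p \<and> p \<le> d. wfun k r p)"
    have bd: "\<bar>Re (S (principal_dchar d) N) - W N\<bar> \<le> B" and im: "S (principal_dchar d) N = of_real (Re (S (principal_dchar d) N))" for N
    proof -
      define c where "c = (\<lambda>p. if coprime p d then 1 else 0 :: real)"
      have Sc: "S (principal_dchar d) N = of_real (\<Sum>p | prime p \<and> p \<le> N. wfun k r p * c p)"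
        unfolding S_def of_real_sum by (intro sum.cong refl) (simp add: principal_dchar_def c_def scaleR_conv_of_real)
      thus "S (principal_dchar d) N = of_real (Re (S (principal_dchar d) N))" by simp
      have "W N - Re (S (principal_dchar d) N) = (\<Sum>p | prime p \<and> p \<le> N. wfun k r p * (1 - c p))"
        unfolding Sc W_def wsum_def by (simp add: right_diff_distrib sum_subtractf)
      also have "\<dots> = (\<Sum>p | prime p \<and> p \<le> N \<and> p dvd d. wfun k r p)"
      proof (rule sum.mono_neutral_cong_right)
        show "\<forall>p\<in>{p. prime p \<and> p \<le> N} - {p. prime p \<and> p \<le> N \<and> p dvd d}. wfun k r p * (1 - c p) = 0"
          using prime_imp_coprime by (auto simp: c_def)
        fix p assume "p \<in> {p. prime p \<and> p \<le> N \<and> p dvd d}"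
        hence "\<not> coprime p d" using not_prime_unit coprime_common_divisor[of p d p] by auto
        thus "wfun k r p * (1 - c p) = wfun k r p" by (simp add: c_def)
      qed auto
      finally have eq: "W N - Re (S (principal_dchar d) N) = (\<Sum>p | prime p \<and> p \<le> N \<and> p dvd d. wfun k r p)" .
      have "(\<Sum>p | prime p \<and> p \<le> N \<and> p dvd d. wfun k r p) \<ge> 0"
        by (intro sum_nonneg) (auto intro: less_imp_le[OF wfun_prime_pos])
      moreover have "(\<Sum>p | prime p \<and> p \<le> N \<and> p dvd d. wfun k r p) \<le> B"
        unfolding B_def using d by (intro sum_mono2) (auto intro: less_imp_le[OF wfun_prime_pos] dest: dvd_imp_le)
      ultimately show "\<bar>Re (S (principal_dchar d) N) - W N\<bar> \<le> B" using eq by linarith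
    qed
    have "(\<lambda>N. B / W N) \<longlonglongrightarrow> 0"
      unfolding W_def by (intro tendsto_divide_0[OF tendsto_const] filterlim_at_top_imp_at_infinity wsum_at_top[OF r])
    moreover have "eventually (\<lambda>N. norm (Re (S (principal_dchar d) N) / W N - 1) \<le> B / W N) sequentially"
      using eventually_ge_at_top[of 2]
    proof eventually_elim
      case (elim N)
      have W: "W N > 0" unfolding W_def by (rule wsum_pos[OF elim])
      have "Re (S (principal_dchar d) N) / W N - 1 = (Re (S (principal_dchar d) N) - W N) / W N" using W by (simp add: field_simps)
      thus ?case using bd[of N] W by (simp add: abs_divide divide_right_mono)
    qed
    ultimately have "(\<lambda>N. Re (S (principal_dchar d) N) / W N - 1) \<longlonglongrightarrow> 0"
      by (rule Lim_null_comparison[rotated])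
    hence "(\<lambda>N. Re (S (principal_dchar d) N) / W N) \<longlonglongrightarrow> 1" by (rule LIM_zero_cancel)
    hence "(\<lambda>N. complex_of_real (Re (S (principal_dchar d) N) / W N)) \<longlonglongrightarrow> of_real 1" by (rule tendsto_of_real)
    moreover have "complex_of_real (Re (S (principal_dchar d) N) / W N) = S (principal_dchar d) N / of_real (W N)" for N
      unfolding of_real_divide im[symmetric] ..
    ultimately show ?thesis by (simp only: of_real_1)
  qed
  have "(\<lambda>N. (S (principal_dchar d) N / of_real (W N) + (\<Sum>\<xi>\<in>X. S \<xi> N / of_real (W N))) / of_nat (totient d))
     \<longlonglongrightarrow> (1 + (\<Sum>\<xi>\<in>X. 0)) / of_nat (totient d)"
    using tot by (intro tendsto_divide tendsto_add tendsto_sum lim0 lim1 tendsto_const) auto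
  moreover have "(S (principal_dchar d) N / of_real (W N) + (\<Sum>\<xi>\<in>X. S \<xi> N / of_real (W N))) / of_nat (totient d)
     = complex_of_real ((\<Sum>p | prime p \<and> p \<le> N. wfun k r p * (if d dvd p - 1 then 1 else 0)) / W N)" for N
  proof -
    have "S (principal_dchar d) N + (\<Sum>\<xi>\<in>X. S \<xi> N) = (\<Sum>\<xi> | dchar d \<xi>. S \<xi> N)"
      unfolding X_def using finite_dchars[OF d] dchar_principal[OF d] by (subst sum.remove[of _ "principal_dchar d"]) auto
    also have "\<dots> = (\<Sum>p | prime p \<and> p \<le> N. wfun k r p *\<^sub>R (\<Sum>\<xi> | dchar d \<xi>. \<xi> p))"
      unfolding S_def scaleR_sum_right by (rule sum.swap)
    also have "\<dots> = (\<Sum>p | prime p \<and> p \<le> N. of_real (wfun k r p * (if d dvd p - 1 then 1 else 0)) * of_nat (totient d))"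
      by (intro sum.cong refl) (auto simp: sum_dchars[OF d] prime_cong_1_iff[unfolded One_nat_def] scaleR_conv_of_real)
    also have "\<dots> = of_real (\<Sum>p | prime p \<and> p \<le> N. wfun k r p * (if d dvd p - 1 then 1 else 0)) * of_nat (totient d)"
      unfolding of_real_sum sum_distrib_right ..
    finally have "S (principal_dchar d) N + (\<Sum>\<xi>\<in>X. S \<xi> N) = of_real (\<Sum>p | prime p \<and> p \<le> N. wfun k r p * (if d dvd p - 1 then 1 else 0)) * of_nat (totient d)" .
    thus ?thesis using tot
      unfolding sum_divide_distrib[symmetric] add_divide_distrib[symmetric] by simp
  qed
  ultimately have "(\<lambda>N. complex_of_real ((\<Sum>p | prime p \<and> p \<le> N. wfun k r p * (if d dvd p - 1 then 1 else 0)) / W N)) \<longlonglongrightarrow> of_real (1 / real (totient d))"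
    by simp
  hence "(\<lambda>N. (\<Sum>p | prime p \<and> p \<le> N. wfun k r p * (if d dvd p - 1 then 1 else 0)) / W N) \<longlonglongrightarrow> 1 / real (totient d)"
    by (simp only: tendsto_of_real_iff)
  thus ?thesis unfolding has_mean_def W_def .
qed

section \<open>Means of products of local factors\<close>

text \<open>The extra modulus d carries the induction: expanding the factor of one prime q replaces
  d by d q^j, and coprimality makes both the divisibility condition and the totient
  multiplicative.\<close>

lemma has_mean_product_truncated:
  assumes r: "r \<ge> 1" and A: "finite A" "\<And>q. q \<in> A \<Longrightarrow> prime q"
    and d: "d > 0" "\<And>q. q \<in> A \<Longrightarrow> coprime d q"
  shows "has_mean k r (\<lambda>p. (if d dvd p - 1 then 1 else 0) * (\<Prod>q\<in>A. \<Sum>j\<le>K. g q j * (if q ^ j dvd p - 1 then 1 else 0)))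
    (1 / real (totient d) * (\<Prod>q\<in>A. \<Sum>j\<le>K. g q j / real (totient (q ^ j))))"
  using A d
proof (induction A arbitrary: d rule: finite_induct)
  case empty
  thus ?case using has_mean_divides[OF r] by simp
next
  case (insert q A)
  have q: "prime q" "coprime d q" using insert.prems by auto
  define P where "P = (\<lambda>p. \<Prod>q\<in>A. \<Sum>j\<le>K. g q j * (if q ^ j dvd p - 1 then 1 else 0))"
  define E where "E = (\<Prod>q\<in>A. \<Sum>j\<le>K. g q j / real (totient (q ^ j)))"
  have IH: "has_mean k r (\<lambda>p. (if d * q ^ j dvd p - 1 then 1 else 0) * P p) (1 / real (totient (d * q ^ j)) * E)" for j
    unfolding P_def E_def
  proof (rule insert.IH)
    show "prime x" if "x \<in> A" for x using insert.prems that by auto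
    show "0 < d * q ^ j" using insert.prems q prime_gt_0_nat by auto
    fix x assume x: "x \<in> A"
    have "prime x" "x \<noteq> q" using insert.prems insert.hyps x by auto
    hence "coprime q x" using primes_coprime[OF q(1)] by blast
    thus "coprime (d * q ^ j) x" using insert.prems(3)[of x] x by simp
  qed
  have "has_mean k r (\<lambda>p. \<Sum>j\<le>K. g q j * ((if d * q ^ j dvd p - 1 then 1 else 0) * P p))
     (\<Sum>j\<le>K. g q j * (1 / real (totient (d * q ^ j)) * E))"
    by (intro has_mean_sum has_mean_cmult IH) simp
  moreover have "(\<Sum>j\<le>K. g q j * ((if d * q ^ j dvd p - 1 then 1 else 0) * P p)) =
     (if d dvd p - 1 then 1 else 0) * (\<Prod>q\<in>insert q A. \<Sum>j\<le>K. g q j * (if q ^ j dvd p - 1 then 1 else 0))" for p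
  proof -
    have dvd: "d * q ^ j dvd p - 1 \<longleftrightarrow> d dvd p - 1 \<and> q ^ j dvd p - 1" for j
    proof
      show "d * q ^ j dvd p - 1 \<Longrightarrow> d dvd p - 1 \<and> q ^ j dvd p - 1" by (auto dest: dvd_mult_left dvd_mult_right)
      show "d dvd p - 1 \<and> q ^ j dvd p - 1 \<Longrightarrow> d * q ^ j dvd p - 1" using q(2) by (intro divides_mult) auto
    qed
    have "(\<Prod>q\<in>insert q A. \<Sum>j\<le>K. g q j * (if q ^ j dvd p - 1 then 1 else 0)) = (\<Sum>j\<le>K. g q j * (if q ^ j dvd p - 1 then 1 else 0)) * P p"
      unfolding P_def using insert.hyps by simp
    moreover have "(\<Sum>j\<le>K. g q j * ((if d * q ^ j dvd p - 1 then 1 else 0) * P p)) =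
      (if d dvd p - 1 then 1 else 0) * ((\<Sum>j\<le>K. g q j * (if q ^ j dvd p - 1 then 1 else 0)) * P p)"
      unfolding dvd sum_distrib_left sum_distrib_right by (intro sum.cong refl) simp
    ultimately show ?thesis by simp
  qed
  moreover have "(\<Sum>j\<le>K. g q j * (1 / real (totient (d * q ^ j)) * E)) =
     1 / real (totient d) * (\<Prod>q\<in>insert q A. \<Sum>j\<le>K. g q j / real (totient (q ^ j)))"
  proof -
    have "totient (d * q ^ j) = totient d * totient (q ^ j)" for j
      by (rule totient_mult_coprime) (use q(2) in simp)
    hence "(\<Sum>j\<le>K. g q j * (1 / real (totient (d * q ^ j)) * E)) = (\<Sum>j\<le>K. 1 / real (totient d) * ((g q j / real (totient (q ^ j))) * E))"
      by (intro sum.cong refl) simp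
    also have "\<dots> = 1 / real (totient d) * ((\<Sum>j\<le>K. g q j / real (totient (q ^ j))) * E)"
      unfolding sum_distrib_left sum_distrib_right ..
    also have "(\<Sum>j\<le>K. g q j / real (totient (q ^ j))) * E = (\<Prod>q\<in>insert q A. \<Sum>j\<le>K. g q j / real (totient (q ^ j)))"
      unfolding E_def using insert.hyps by simp
    finally show ?thesis .
  qed
  ultimately show ?case by simp
qed

text \<open>A function of the multiplicity of q in n is the sum of its increments over the j with
  q^j dividing n. This expresses local factors by divisibility conditions, whose means are
  known.\<close>

definition increment :: "(nat \<Rightarrow> real) \<Rightarrow> nat \<Rightarrow> real" where
  "increment h j = (if j = 0 then h 0 else h j - h (j - 1))"

lemma sum_increment: "(\<Sum>j\<le>m. increment h j) = h m"
  by (induction m) (auto simp: increment_def)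

lemma truncated_local_factor:
  assumes q: "prime (q::nat)" and n: "n > 0"
  shows "(\<Sum>j\<le>K. increment h j * (if q ^ j dvd n then 1 else 0)) = h (min K (multiplicity q n))"
proof -
  have "q ^ j dvd n \<longleftrightarrow> j \<le> multiplicity q n" for j
    by (rule power_dvd_iff_le_multiplicity) (use q n not_prime_unit in auto)
  hence "(\<Sum>j\<le>K. increment h j * (if q ^ j dvd n then 1 else 0)) = (\<Sum>j\<le>min K (multiplicity q n). increment h j)"
    by (intro sum.mono_neutral_cong_right) auto
  thus ?thesis by (simp add: sum_increment)
qed

text \<open>E q is the expected value of h q at the multiplicity of q when q^j divides p - 1 with
  frequency 1 / totient(q^j). Convergence of h q makes truncation at a large exponent uniformly
  harmless, and the bound 1 / q on 1 - h q v controls the discarded primes.\<close>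

locale local_factors =
  fixes h :: "nat \<Rightarrow> nat \<Rightarrow> real" and E :: "nat \<Rightarrow> real"
  assumes h0: "\<And>q. h q 0 = 1"
    and h_range: "\<And>q v. prime q \<Longrightarrow> h q v \<ge> 0 \<and> h q v \<le> 1 \<and> 1 - h q v \<le> 1 / real q"
    and h_conv: "\<And>q. prime q \<Longrightarrow> convergent (h q)"
    and E: "\<And>q. prime q \<Longrightarrow> (\<lambda>j. increment (h q) j / real (totient (q ^ j))) sums E q"
begin

text \<open>Multiplicities are capped at K, which changes each factor by at most e'. As all factors
  lie in [0, 1], the product changes by at most the sum of these changes.\<close>

lemma has_mean_finite_product:
  assumes r: "r \<ge> 1" and A: "finite A" "\<And>q. q \<in> A \<Longrightarrow> prime q"
  shows "has_mean k r (\<lambda>p. \<Prod>q\<in>A. h q (multiplicity q (p - 1))) (\<Prod>q\<in>A. E q)"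
proof (rule has_mean_approx)
  fix e :: real assume e: "e > 0"
  \<comment> \<open>The + 1 keeps the denominator positive when A is empty.\<close>
  define e' where "e' = e / (real (card A) + 1)"
  have e': "e' > 0" using e by (simp add: e'_def)
  define EK where "EK = (\<lambda>K. \<Prod>q\<in>A. \<Sum>j\<le>K. increment (h q) j / real (totient (q ^ j)))"
  have "EK \<longlonglongrightarrow> (\<Prod>q\<in>A. E q)"
    unfolding EK_def using A E by (intro tendsto_prod) (auto simp: sums_def_le)
  hence ev1: "eventually (\<lambda>K. dist (EK K) (\<Prod>q\<in>A. E q) < e) sequentially" using e by (rule tendstoD)
  have ev2: "eventually (\<lambda>K. \<forall>q\<in>A. \<forall>v\<ge>K. \<bar>h q v - h q K\<bar> < e') sequentially"
  proof (rule eventually_ball_finite[OF A(1)], rule ballI)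
    fix q assume "q \<in> A"
    hence "Cauchy (h q)" using h_conv A(2) by (simp add: convergent_Cauchy)
    then obtain M where M: "\<And>m n. m \<ge> M \<Longrightarrow> n \<ge> M \<Longrightarrow> norm (h q m - h q n) < e'"
      using CauchyD[OF _ e'] by blast
    show "eventually (\<lambda>K. \<forall>v\<ge>K. \<bar>h q v - h q K\<bar> < e') sequentially"
      using eventually_ge_at_top[of M] by eventually_elim (use M in auto)
  qed
  obtain K where K: "dist (EK K) (\<Prod>q\<in>A. E q) < e" "\<And>q v. q \<in> A \<Longrightarrow> v \<ge> K \<Longrightarrow> \<bar>h q v - h q K\<bar> < e'"
    using eventually_happens[OF eventually_conj[OF ev1 ev2]] by auto
  define F' where "F' = (\<lambda>p. \<Prod>q\<in>A. \<Sum>j\<le>K. increment (h q) j * (if q ^ j dvd p - 1 then 1 else 0))"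
  have "has_mean k r F' (EK K)"
    using has_mean_product_truncated[OF r A, where d = 1 and K = K and g = "\<lambda>q. increment (h q)"] unfolding F'_def EK_def by simp
  moreover have "\<bar>EK K - (\<Prod>q\<in>A. E q)\<bar> \<le> e" using K(1) by (simp add: dist_real_def)
  moreover have "\<bar>\<Sum>p | prime p \<and> p \<le> N. wfun k r p * ((\<Prod>q\<in>A. h q (multiplicity q (p - 1))) - F' p)\<bar> \<le> e * wsum k r N" for N
  proof -
    have "\<bar>\<Sum>p | prime p \<and> p \<le> N. wfun k r p * ((\<Prod>q\<in>A. h q (multiplicity q (p - 1))) - F' p)\<bar> \<le> (\<Sum>p | prime p \<and> p \<le> N. wfun k r p * e)"
    proof (intro order_trans[OF sum_abs] sum_mono)
      fix p assume "p \<in> {p. prime p \<and> p \<le> N}"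
      hence p: "prime p" by simp
      hence n: "p - 1 > 0" using prime_gt_1_nat[of p] by simp
      have F': "F' p = (\<Prod>q\<in>A. h q (min K (multiplicity q (p - 1))))"
        unfolding F'_def by (intro prod.cong refl truncated_local_factor A n)
      have "norm ((\<Prod>q\<in>A. h q (multiplicity q (p - 1))) - F' p) \<le> (\<Sum>q\<in>A. norm (h q (multiplicity q (p - 1)) - h q (min K (multiplicity q (p - 1)))))"
        unfolding F' using h_range A(2) by (intro norm_prod_diff) auto
      also have "\<dots> \<le> (\<Sum>q\<in>A. e')"
      proof (rule sum_mono)
        fix q assume "q \<in> A"
        thus "norm (h q (multiplicity q (p - 1)) - h q (min K (multiplicity q (p - 1)))) \<le> e'"
          using K(2)[of q "multiplicity q (p - 1)"] e' by (cases "K \<le> multiplicity q (p - 1)") (auto simp: min_def)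
      qed
      also have "\<dots> \<le> e" unfolding e'_def using e by (simp add: field_simps)
      finally show "\<bar>wfun k r p * ((\<Prod>q\<in>A. h q (multiplicity q (p - 1))) - F' p)\<bar> \<le> wfun k r p * e"
        using wfun_prime_pos[OF p, of k r] by (simp add: abs_mult)
    qed
    thus ?thesis by (simp add: wsum_def sum_distrib_left mult.commute)
  qed
  ultimately show "\<exists>F' l'. has_mean k r F' l' \<and> \<bar>l' - (\<Prod>q\<in>A. E q)\<bar> \<le> e \<and>
     eventually (\<lambda>N. \<bar>\<Sum>p | prime p \<and> p \<le> N. wfun k r p * ((\<Prod>q\<in>A. h q (multiplicity q (p - 1))) - F' p)\<bar> \<le> e * wsum k r N) sequentially"
    by (intro exI[of _ F'] exI[of _ "EK K"] conjI always_eventually allI)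
qed

end

section \<open>The contribution of large prime factors of p - 1\<close>

lemma sum_inverse_squares_tail:
  assumes "a \<ge> 1"
  shows "(\<Sum>q\<in>{a<..b}. 1 / real q ^ 2) \<le> 1 / real a"
proof (cases "a \<le> b")
  case True
  have "(\<Sum>q\<in>{a<..b}. 1 / real q ^ 2) \<le> 1 / real a - 1 / real b"
    using True
  proof (induction b rule: dec_induct)
    case (step b)
    have b: "b > 0" using step assms by simp
    have "1 / real (Suc b) ^ 2 \<le> 1 / (real b * real (Suc b))"
      unfolding power2_eq_square using b by (intro divide_left_mono mult_right_mono) auto
    also have "\<dots> = 1 / real b - 1 / real (Suc b)" using b by (simp add: field_simps)
    finally have 1: "1 / real (Suc b) ^ 2 \<le> 1 / real b - 1 / real (Suc b)" .
    have "{a<..Suc b} = insert (Suc b) {a<..b}" using step by auto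
    hence "(\<Sum>q\<in>{a<..Suc b}. 1 / real q ^ 2) = 1 / real (Suc b) ^ 2 + (\<Sum>q\<in>{a<..b}. 1 / real q ^ 2)" by simp
    thus ?case using 1 step.IH by linarith
  qed simp
  thus ?thesis by (smt (verit) divide_nonneg_nonneg of_nat_0_le_iff)
qed simp

text \<open>The first bound passes on the sieve estimate, for small q; the second counts all
  multiples of q below N, for large q.\<close>

lemma theta_class_bounds:
  assumes N: "N \<ge> 2" and q: "prime q"
    and K: "(\<Sum>n | n \<in> {1..N} \<and> [n = 1] (mod q). mangoldt n) \<le> B"
  shows "(\<Sum>p | prime p \<and> p \<le> N \<and> q dvd p - 1. ln (real p)) \<le> B"
    and "(\<Sum>p | prime p \<and> p \<le> N \<and> q dvd p - 1. ln (real p)) \<le> ln (real N) * (real N / real q)"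
proof -
  have "(\<Sum>p | prime p \<and> p \<le> N \<and> q dvd p - 1. ln (real p)) = (\<Sum>p | prime p \<and> p \<le> N \<and> q dvd p - 1. mangoldt p)"
    by (rule sum.cong) auto
  also have "\<dots> \<le> (\<Sum>n | n \<in> {1..N} \<and> [n = 1] (mod q). mangoldt n)"
  proof (rule sum_mono2)
    show "{p. prime p \<and> p \<le> N \<and> q dvd p - 1} \<subseteq> {n. n \<in> {1..N} \<and> [n = 1] (mod q)}"
      using prime_cong_1_iff prime_ge_1_nat by auto
  qed (auto simp: mangoldt_nonneg)
  finally show "(\<Sum>p | prime p \<and> p \<le> N \<and> q dvd p - 1. ln (real p)) \<le> B" using K by linarith
  have q0: "q > 0" using q by (rule prime_gt_0_nat)
  define X where "X = {p. prime p \<and> p \<le> N \<and> q dvd p - 1}"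
  have fX: "finite X" unfolding X_def by simp
  have "inj_on (\<lambda>p. (p - 1) div q) X"
  proof (rule inj_onI)
    fix x y assume *: "x \<in> X" "y \<in> X" "(x - 1) div q = (y - 1) div q"
    hence "x - 1 = y - 1" unfolding X_def by (metis (mono_tags, lifting) dvd_mult_div_cancel mem_Collect_eq)
    moreover have "x \<ge> 1" "y \<ge> 1" using * prime_ge_1_nat by (auto simp: X_def)
    ultimately show "x = y" by linarith
  qed
  moreover have "(\<lambda>p. (p - 1) div q) ` X \<subseteq> {1..N div q}"
  proof
    fix z assume "z \<in> (\<lambda>p. (p - 1) div q) ` X"
    then obtain p where p: "z = (p - 1) div q" "prime p" "p \<le> N" "q dvd p - 1" by (auto simp: X_def)
    have "p - 1 > 0" using prime_gt_1_nat[OF p(2)] by simp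
    hence "q \<le> p - 1" using p(4) by (rule dvd_imp_le[rotated])
    hence "z \<ge> 1" using p(1) q0 by (simp add: div_greater_zero_iff Suc_le_eq)
    moreover have "z \<le> N div q" unfolding p(1) using p(3) by (intro div_le_mono) simp
    ultimately show "z \<in> {1..N div q}" by simp
  qed
  ultimately have "card X \<le> card {1..N div q}" by (rule card_inj_on_le) simp
  hence "real (card X) \<le> real (N div q)" by simp
  also have "\<dots> \<le> real N / real q" by (rule of_nat_div_le_of_nat)
  finally have cX: "real (card X) \<le> real N / real q" .
  have "(\<Sum>p\<in>X. ln (real p)) \<le> (\<Sum>p\<in>X. ln (real N))"
  proof (rule sum_mono)
    fix p assume "p \<in> X"
    hence "p > 0" "p \<le> N" using prime_gt_0_nat[of p] by (auto simp: X_def)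
    thus "ln (real p) \<le> ln (real N)" by simp
  qed
  also have "\<dots> = ln (real N) * real (card X)" by simp
  also have "\<dots> \<le> ln (real N) * (real N / real q)" using cX N by (intro mult_left_mono) auto
  finally show "(\<Sum>p | prime p \<and> p \<le> N \<and> q dvd p - 1. ln (real p)) \<le> ln (real N) * (real N / real q)" unfolding X_def .
qed

text \<open>Majorant for the change caused by dropping the local factors at primes above y, each of
  which lies within 1 / q of 1.\<close>

definition large_factor_sum :: "nat \<Rightarrow> nat \<Rightarrow> real" where
  "large_factor_sum y n = (\<Sum>q | q \<in> prime_factors n \<and> y < q. 1 / real q)"

lemma large_factor_sum_swap:
  "(\<Sum>p | prime p \<and> p \<le> N. wfun k r p * large_factor_sum y (p - 1)) =
   (\<Sum>q | prime q \<and> y < q \<and> q \<le> N. 1 / real q * (\<Sum>p | prime p \<and> p \<le> N \<and> q dvd p - 1. wfun k r p))"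
proof -
  have "(\<Sum>p | prime p \<and> p \<le> N. wfun k r p * large_factor_sum y (p - 1)) =
    (\<Sum>p | prime p \<and> p \<le> N. \<Sum>q | prime q \<and> y < q \<and> q \<le> N. if q dvd p - 1 then 1 / real q * wfun k r p else 0)"
  proof (rule sum.cong[OF refl])
    fix p assume "p \<in> {p. prime p \<and> p \<le> N}"
    hence p: "prime p" "p \<le> N" "p - 1 > 0" using prime_gt_1_nat[of p] by auto
    have "{q. q \<in> prime_factors (p - 1) \<and> y < q} = {q. (prime q \<and> y < q \<and> q \<le> N) \<and> q dvd p - 1}"
    proof -
      have pf: "prime_factors (p - 1) = {q. prime q \<and> q dvd p - 1}" by (rule prime_factors_dvd) (use p in simp)
      have "q \<le> N" if "q dvd p - 1" for q using dvd_imp_le[OF that p(3)] p(2) by linarith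
      thus ?thesis unfolding pf by blast
    qed
    hence "wfun k r p * large_factor_sum y (p - 1) = (\<Sum>q | (prime q \<and> y < q \<and> q \<le> N) \<and> q dvd p - 1. 1 / real q * wfun k r p)"
      by (simp add: large_factor_sum_def sum_distrib_left)
    also have "\<dots> = (\<Sum>q | prime q \<and> y < q \<and> q \<le> N. if q dvd p - 1 then 1 / real q * wfun k r p else 0)"
      by (rule sum.mono_neutral_cong_left) auto
    finally show "wfun k r p * large_factor_sum y (p - 1) = (\<Sum>q | prime q \<and> y < q \<and> q \<le> N. if q dvd p - 1 then 1 / real q * wfun k r p else 0)" .
  qed
  also have "\<dots> = (\<Sum>q | prime q \<and> y < q \<and> q \<le> N. \<Sum>p | prime p \<and> p \<le> N. if q dvd p - 1 then 1 / real q * wfun k r p else 0)"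
    by (rule sum.swap)
  also have "\<dots> = (\<Sum>q | prime q \<and> y < q \<and> q \<le> N. 1 / real q * (\<Sum>p | prime p \<and> p \<le> N \<and> q dvd p - 1. wfun k r p))"
    unfolding sum_distrib_left by (intro sum.cong refl sum.mono_neutral_cong_right) auto
  finally show ?thesis .
qed

text \<open>Primes \<open>q\<close> up to about \<open>(ln N)\<^sup>2\<close> are treated by the sieve bound, larger ones trivially.\<close>

lemma large_factor_mean_bound:
  assumes r: "r \<ge> 1"
  obtains C where "C \<ge> 0" "\<And>y e. y \<ge> 1 \<Longrightarrow> e > 0 \<Longrightarrow>
    eventually (\<lambda>N. (\<Sum>p | prime p \<and> p \<le> N. wfun k r p * large_factor_sum y (p - 1)) \<le> (C / real y + e) * wsum k r N) sequentially"
proof -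
  obtain K where K: "K \<ge> 0" "\<And>q N. N \<ge> 2 \<Longrightarrow> q = 1 \<or> prime q \<Longrightarrow>
    (\<Sum>n | n \<in> {1..N} \<and> [n = 1] (mod q). mangoldt n) \<le> K * (real N / real q + real N / ln (real N))"
    using brun_titchmarsh_weak by blast
  obtain c N0 where c: "c > 0" "N0 \<ge> 2" "\<And>N. N \<ge> N0 \<Longrightarrow> c * real N * gfun k r N \<le> wsum k r N"
    using wsum_lower_bound by blast
  \<comment> \<open>The part of the bound that vanishes as N grows: the N / ln N term of the sieve
    summed over q \<le> Z, and the trivial bound summed over q > Z.\<close>
  define D where "D = (\<lambda>N. K * ((1 + ln ((ln (real N))\<^sup>2 + 1)) / ln (real N)) + 1 / ln (real N))"
  have D: "D \<longlonglongrightarrow> 0" unfolding D_def by real_asymp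
  have main: "(\<Sum>p | prime p \<and> p \<le> N. wfun k r p * large_factor_sum y (p - 1)) \<le> gfun k r N * (real N * (K / real y + D N))"
    if N: "N \<ge> 3" and y: "y \<ge> 1" for N y
  proof -
    \<comment> \<open>The + 1 rounds (ln N)^2 up and keeps Z positive.\<close>
    define Z where "Z = nat \<lfloor>(ln (real N))\<^sup>2\<rfloor> + 1"
    define th where "th = (\<lambda>q. \<Sum>p | prime p \<and> p \<le> N \<and> q dvd p - 1. ln (real p))"
    have l: "ln (real N) > 0" using N by simp
    have Z: "real Z \<ge> (ln (real N))\<^sup>2" "real Z \<le> (ln (real N))\<^sup>2 + 1" "Z \<ge> 1"
    proof -
      define x where "x = (ln (real N))\<^sup>2"
      have "real (nat \<lfloor>x\<rfloor>) = real_of_int \<lfloor>x\<rfloor>" by (simp add: x_def)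
      thus "real Z \<ge> (ln (real N))\<^sup>2" "real Z \<le> (ln (real N))\<^sup>2 + 1" "Z \<ge> 1"
        unfolding Z_def x_def[symmetric] by linarith+
    qed
    have g0: "gfun k r N \<ge> 0" using N by (intro gfun_nonneg) simp
    have w: "(\<Sum>p | prime p \<and> p \<le> N \<and> q dvd p - 1. wfun k r p) \<le> gfun k r N * th q" for q
      unfolding th_def sum_distrib_left
    proof (rule sum_mono)
      fix p assume p: "p \<in> {p. prime p \<and> p \<le> N \<and> q dvd p - 1}"
      hence p2: "p \<ge> 2" using prime_ge_2_nat by auto
      have "wfun k r p = gfun k r p * ln (real p)" by (rule wfun_eq_gfun[OF p2])
      also have "\<dots> \<le> gfun k r N * ln (real p)" using p p2 by (intro mult_right_mono gfun_mono[OF r]) auto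
      finally show "wfun k r p \<le> gfun k r N * ln (real p)" .
    qed
    define Q where "Q = {q. prime q \<and> y < q \<and> q \<le> N}"
    have fQ: "finite Q" unfolding Q_def by simp
    have each: "1 / real q * th q \<le> K * real N * (1 / real q ^ 2) + K * (real N / ln (real N)) * (if q \<le> Z then 1 / real q else 0)
        + real N * ln (real N) * (if Z < q then 1 / real q ^ 2 else 0)" if q: "q \<in> Q" for q
    proof -
      have pq: "prime q" using q by (simp add: Q_def)
      have q0: "real q > 0" using prime_gt_0_nat[OF pq] by simp
      have N2: "N \<ge> 2" using N by simp
      note th = theta_class_bounds[OF N2 pq K(2)[OF N2 disjI2[OF pq]], folded th_def]
      show ?thesis
      proof (cases "q \<le> Z")
        case True
        have "1 / real q * th q \<le> 1 / real q * (K * (real N / real q + real N / ln (real N)))"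
          using th(1) q0 by (intro mult_left_mono) (auto simp: th_def)
        also have "\<dots> = K * real N * (1 / real q ^ 2) + K * (real N / ln (real N)) * (1 / real q)"
          using q0 l by (simp add: power2_eq_square field_simps)
        finally show ?thesis using True by simp
      next
        case False
        have "1 / real q * th q \<le> 1 / real q * (ln (real N) * (real N / real q))"
          using th(2) q0 by (intro mult_left_mono) (auto simp: th_def)
        also have "\<dots> = real N * ln (real N) * (1 / real q ^ 2)" by (simp add: power2_eq_square)
        also have "\<dots> \<le> K * real N * (1 / real q ^ 2) + real N * ln (real N) * (1 / real q ^ 2)" using K(1) by simp
        finally show ?thesis using False by simp
      qed
    qed
    have s1: "(\<Sum>q\<in>Q. 1 / real q ^ 2) \<le> 1 / real y"
    proof -
      have "(\<Sum>q\<in>Q. 1 / real q ^ 2) \<le> (\<Sum>q\<in>{y<..N}. 1 / real q ^ 2)" by (rule sum_mono2) (auto simp: Q_def)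
      also have "\<dots> \<le> 1 / real y" by (rule sum_inverse_squares_tail[OF y])
      finally show ?thesis .
    qed
    have s2: "(\<Sum>q\<in>Q. if q \<le> Z then 1 / real q else 0) \<le> 1 + ln ((ln (real N))\<^sup>2 + 1)"
    proof -
      have "(\<Sum>q\<in>Q. if q \<le> Z then 1 / real q else 0) = (\<Sum>q | q \<in> Q \<and> q \<le> Z. 1 / real q)"
        by (rule sum.mono_neutral_cong_right[OF fQ]) auto
      also have "\<dots> \<le> (\<Sum>q=1..Z. 1 / real q)" by (rule sum_mono2) (auto simp: Q_def)
      also have "\<dots> = harm Z" by (simp add: harm_def inverse_eq_divide)
      also have "\<dots> \<le> 1 + ln (real Z)"
        using decseqD[OF decseq_harm_diff_ln, of 0 "Z - 1"] Z(3) by (simp add: harm_def)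
      also have "ln (real Z) \<le> ln ((ln (real N))\<^sup>2 + 1)" using Z by simp
      finally show ?thesis by simp
    qed
    have s3: "(\<Sum>q\<in>Q. if Z < q then 1 / real q ^ 2 else 0) \<le> 1 / (ln (real N))\<^sup>2"
    proof -
      have "(\<Sum>q\<in>Q. if Z < q then 1 / real q ^ 2 else 0) = (\<Sum>q | q \<in> Q \<and> Z < q. 1 / real q ^ 2)"
        by (rule sum.mono_neutral_cong_right[OF fQ]) auto
      also have "\<dots> \<le> (\<Sum>q\<in>{Z<..N}. 1 / real q ^ 2)" by (rule sum_mono2) (auto simp: Q_def)
      also have "\<dots> \<le> 1 / real Z" by (rule sum_inverse_squares_tail[OF Z(3)])
      also have "\<dots> \<le> 1 / (ln (real N))\<^sup>2" using Z l by (intro divide_left_mono) auto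
      finally show ?thesis .
    qed
    have "(\<Sum>p | prime p \<and> p \<le> N. wfun k r p * large_factor_sum y (p - 1)) =
      (\<Sum>q\<in>Q. 1 / real q * (\<Sum>p | prime p \<and> p \<le> N \<and> q dvd p - 1. wfun k r p))"
      unfolding large_factor_sum_swap Q_def ..
    also have "\<dots> \<le> (\<Sum>q\<in>Q. 1 / real q * (gfun k r N * th q))"
      by (intro sum_mono mult_left_mono w) auto
    also have "\<dots> = gfun k r N * (\<Sum>q\<in>Q. 1 / real q * th q)" by (simp add: sum_distrib_left)
    also have "\<dots> \<le> gfun k r N * (real N * (K / real y + D N))"
    proof (rule mult_left_mono[OF _ g0])
      have "(\<Sum>q\<in>Q. 1 / real q * th q) \<le> (\<Sum>q\<in>Q. K * real N * (1 / real q ^ 2) + K * (real N / ln (real N)) * (if q \<le> Z then 1 / real q else 0)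
        + real N * ln (real N) * (if Z < q then 1 / real q ^ 2 else 0))"
        by (intro sum_mono each)
      also have "\<dots> = K * real N * (\<Sum>q\<in>Q. 1 / real q ^ 2) + K * (real N / ln (real N)) * (\<Sum>q\<in>Q. if q \<le> Z then 1 / real q else 0)
        + real N * ln (real N) * (\<Sum>q\<in>Q. if Z < q then 1 / real q ^ 2 else 0)"
        unfolding sum.distrib sum_distrib_left[symmetric] ..
      also have "\<dots> \<le> K * real N * (1 / real y) + K * (real N / ln (real N)) * (1 + ln ((ln (real N))\<^sup>2 + 1))
        + real N * ln (real N) * (1 / (ln (real N))\<^sup>2)"
        using K(1) l by (intro add_mono mult_left_mono s1 s2 s3) auto
      also have "\<dots> = real N * (K / real y + D N)"
        unfolding D_def using l by (simp add: power2_eq_square algebra_simps add_divide_distrib)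
      finally show "(\<Sum>q\<in>Q. 1 / real q * th q) \<le> real N * (K / real y + D N)" .
    qed
    finally show ?thesis .
  qed
  show ?thesis
  proof (rule that[of "K / c"])
    show "K / c \<ge> 0" using K(1) c(1) by simp
    fix y :: nat and e :: real assume y: "y \<ge> 1" and e: "e > 0"
    have "e * c > 0" using e c by simp
    from order_tendstoD(2)[OF D this]
    have "eventually (\<lambda>N. D N < e * c) sequentially" .
    thus "eventually (\<lambda>N. (\<Sum>p | prime p \<and> p \<le> N. wfun k r p * large_factor_sum y (p - 1)) \<le> (K / c / real y + e) * wsum k r N) sequentially"
      using eventually_ge_at_top[of "max 3 N0"]
    proof eventually_elim
      case (elim N)
      have g0: "gfun k r N \<ge> 0" using elim by (intro gfun_nonneg) simp
      have "(\<Sum>p | prime p \<and> p \<le> N. wfun k r p * large_factor_sum y (p - 1)) \<le> gfun k r N * (real N * (K / real y + D N))"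
        by (rule main) (use elim y in auto)
      also have "\<dots> \<le> gfun k r N * (real N * (K / real y + e * c))"
        using elim g0 by (intro mult_left_mono add_left_mono) auto
      also have "\<dots> = (K / c / real y + e) * (c * real N * gfun k r N)"
        using c(1) by (simp add: field_simps)
      also have "\<dots> \<le> (K / c / real y + e) * wsum k r N"
        using K(1) c(1) e elim by (intro mult_left_mono c(3)) auto
      finally show ?case .
    qed
  qed
qed

context local_factors
begin

text \<open>The full product is approximated by the one over a finite set A containing all primes up
  to y. The mean of the latter is a partial product close to L, and the error is at most
  \<open>large_factor_sum\<close>, of weighted mean at most C / y + e / 2.\<close>

theorem has_mean_product:
  assumes r: "r \<ge> 1" and L: "(\<lambda>Y. \<Prod>i<Y. E (nth_prime i)) \<longlonglongrightarrow> L"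
  shows "has_mean k r (\<lambda>p. \<Prod>q\<in>prime_factors (p - 1). h q (multiplicity q (p - 1))) L"
proof (rule has_mean_approx)
  fix e :: real assume e: "e > 0"
  obtain C where C: "C \<ge> 0" "\<And>y e. y \<ge> 1 \<Longrightarrow> e > 0 \<Longrightarrow>
    eventually (\<lambda>N. (\<Sum>p | prime p \<and> p \<le> N. wfun k r p * large_factor_sum y (p - 1)) \<le> (C / real y + e) * wsum k r N) sequentially"
    using large_factor_mean_bound[OF r] by blast
  obtain Y0 where Y0: "\<And>Y. Y \<ge> Y0 \<Longrightarrow> norm ((\<Prod>i<Y. E (nth_prime i)) - L) < e" using LIMSEQ_D[OF L e] by blast
  obtain y1 :: nat where y1: "real y1 > 2 * C / e" using reals_Archimedean2 by blast
  define y where "y = Suc (max Y0 y1)"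
  have y: "y \<ge> 1" "y \<ge> Y0" "real y > 2 * C / e" using y1 by (auto simp: y_def)
  \<comment> \<open>Since \<open>nth_prime j\<close> is at least j, a prime outside A exceeds
    y.\<close>
  define A where "A = nth_prime ` {..<Suc y}"
  have inj: "inj nth_prime" by (rule strict_mono_imp_inj_on[OF strict_mono_nth_prime])
  have A: "finite A" "\<And>q. q \<in> A \<Longrightarrow> prime q" using range_nth_prime by (auto simp: A_def)
  have large: "q > y" if q: "prime q" "q \<notin> A" for q
  proof -
    have "q \<in> range nth_prime" using q(1) by (simp add: range_nth_prime)
    then obtain j where j: "q = nth_prime j" by (rule rangeE)
    have "j \<ge> Suc y"
    proof (rule ccontr)
      assume "\<not> j \<ge> Suc y"
      hence "j \<in> {..<Suc y}" by simp
      thus False using q(2) unfolding A_def j by blast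
    qed
    moreover have "j \<le> nth_prime j" by (rule strict_mono_imp_increasing[OF strict_mono_nth_prime])
    ultimately show ?thesis using j by simp
  qed
  define F' where "F' = (\<lambda>p. \<Prod>q\<in>A. h q (multiplicity q (p - 1)))"
  have m: "has_mean k r F' (\<Prod>q\<in>A. E q)" unfolding F'_def by (rule has_mean_finite_product[OF r A])
  have "(\<Prod>q\<in>A. E q) = (\<Prod>i<Suc y. E (nth_prime i))"
    unfolding A_def by (subst prod.reindex) (auto intro: inj_on_subset[OF inj])
  hence l: "\<bar>(\<Prod>q\<in>A. E q) - L\<bar> \<le> e" using Y0[of "Suc y"] y by simp
  have pointwise: "\<bar>(\<Prod>q\<in>prime_factors (p - 1). h q (multiplicity q (p - 1))) - F' p\<bar> \<le> large_factor_sum y (p - 1)" if p: "prime p" for p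
  proof -
    define n where "n = p - 1"
    have n: "n > 0" using prime_gt_1_nat[OF p] by (simp add: n_def)
    have "F' p = (\<Prod>q\<in>prime_factors n \<inter> A. h q (multiplicity q n))"
      unfolding F'_def n_def[symmetric]
    proof (rule prod.mono_neutral_right[OF A(1)])
      show "\<forall>q\<in>A - prime_factors n \<inter> A. h q (multiplicity q n) = 1"
      proof
        fix q assume q: "q \<in> A - prime_factors n \<inter> A"
        hence "q \<in> A" "q \<notin> prime_factors n" by auto
        hence "\<not> q dvd n" using n A(2)[of q] by (simp add: prime_factors_dvd)
        thus "h q (multiplicity q n) = 1" by (simp add: not_dvd_imp_multiplicity_0 h0)
      qed
    qed simp
    also have "\<dots> = (\<Prod>q\<in>prime_factors n. if q \<in> A then h q (multiplicity q n) else 1)"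
      by (rule prod.inter_restrict) (rule finite_set_mset)
    finally have F': "F' p = (\<Prod>q\<in>prime_factors n. if q \<in> A then h q (multiplicity q n) else 1)" .
    have pr: "prime q" if "q \<in> prime_factors n" for q using that by auto
    have "norm ((\<Prod>q\<in>prime_factors n. h q (multiplicity q n)) - F' p) \<le> (\<Sum>q\<in>prime_factors n. norm (h q (multiplicity q n) - (if q \<in> A then h q (multiplicity q n) else 1)))"
      unfolding F'
    proof (rule norm_prod_diff)
      fix q assume "q \<in> prime_factors n"
      hence "0 \<le> h q (multiplicity q n)" "h q (multiplicity q n) \<le> 1" using h_range[OF pr, of q "multiplicity q n"] by simp_all
      thus "norm (h q (multiplicity q n)) \<le> 1" "norm (if q \<in> A then h q (multiplicity q n) else 1) \<le> 1" by simp_all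
    qed
    also have "\<dots> \<le> (\<Sum>q\<in>prime_factors n. if y < q then 1 / real q else 0)"
    proof (rule sum_mono)
      fix q assume q: "q \<in> prime_factors n"
      show "norm (h q (multiplicity q n) - (if q \<in> A then h q (multiplicity q n) else 1)) \<le> (if y < q then 1 / real q else 0)"
      proof (cases "q \<in> A")
        case False
        hence "y < q" using large pr[OF q] by blast
        thus ?thesis using False h_range[OF pr[OF q], of "multiplicity q n"] by simp
      qed simp
    qed
    also have "\<dots> = large_factor_sum y n"
      unfolding large_factor_sum_def by (rule sum.inter_filter[symmetric]) (rule finite_set_mset)
    finally show ?thesis by (simp add: n_def)
  qed
  have "e / 2 > 0" using e by simp
  note bound = C(2)[OF y(1) this]
  have tail: "eventually (\<lambda>N. \<bar>\<Sum>p | prime p \<and> p \<le> N. wfun k r p * ((\<Prod>q\<in>prime_factors (p - 1). h q (multiplicity q (p - 1))) - F' p)\<bar> \<le> e * wsum k r N) sequentially"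
    using bound eventually_ge_at_top[of "2::nat"]
  proof eventually_elim
    case (elim N)
    have "\<bar>\<Sum>p | prime p \<and> p \<le> N. wfun k r p * ((\<Prod>q\<in>prime_factors (p - 1). h q (multiplicity q (p - 1))) - F' p)\<bar>
      \<le> (\<Sum>p | prime p \<and> p \<le> N. wfun k r p * large_factor_sum y (p - 1))"
    proof (intro order_trans[OF sum_abs] sum_mono)
      fix p assume "p \<in> {p. prime p \<and> p \<le> N}"
      hence p: "prime p" by simp
      have "wfun k r p \<ge> 0" using wfun_prime_pos[OF p] by (rule less_imp_le)
      thus "\<bar>wfun k r p * ((\<Prod>q\<in>prime_factors (p - 1). h q (multiplicity q (p - 1))) - F' p)\<bar> \<le> wfun k r p * large_factor_sum y (p - 1)"
        unfolding abs_mult using pointwise[OF p] by (simp add: mult_left_mono)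
    qed
    also have "\<dots> \<le> (C / real y + e / 2) * wsum k r N" by (rule elim(1))
    also have "\<dots> \<le> e * wsum k r N"
    proof (rule mult_right_mono)
      have "C / real y \<le> e / 2" using y e C(1) by (simp add: field_simps)
      thus "C / real y + e / 2 \<le> e" by linarith
      show "0 \<le> wsum k r N" using wsum_pos[OF elim(2)] by (rule less_imp_le)
    qed
    finally show ?case .
  qed
  show "\<exists>F' l'. has_mean k r F' l' \<and> \<bar>l' - L\<bar> \<le> e \<and>
     eventually (\<lambda>N. \<bar>\<Sum>p | prime p \<and> p \<le> N. wfun k r p * ((\<Prod>q\<in>prime_factors (p - 1). h q (multiplicity q (p - 1))) - F' p)\<bar> \<le> e * wsum k r N) sequentially"
    by (rule exI, rule exI, rule conjI[OF m conjI[OF l tail]])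
qed

end

section \<open>The constants of Stephens and Artin\<close>

lemma bij_betw_nth_prime: "bij_betw nth_prime {..<Suc N} {p. prime p \<and> p \<le> nth_prime N}"
proof -
  have "nth_prime ` {..<Suc N} = {p. prime p \<and> p \<le> nth_prime N}"
  proof
    show "nth_prime ` {..<Suc N} \<subseteq> {p. prime p \<and> p \<le> nth_prime N}"
    proof
      fix p assume "p \<in> nth_prime ` {..<Suc N}"
      then obtain i where i: "i < Suc N" "p = nth_prime i" by blast
      have "p \<in> range nth_prime" using i by simp
      hence "prime p" using range_nth_prime by simp
      moreover have "p \<le> nth_prime N" using i strict_mono_less_eq[OF strict_mono_nth_prime, of i N] by simp
      ultimately show "p \<in> {p. prime p \<and> p \<le> nth_prime N}" by simp
    qed
    show "{p. prime p \<and> p \<le> nth_prime N} \<subseteq> nth_prime ` {..<Suc N}"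
    proof
      fix p assume p: "p \<in> {p. prime p \<and> p \<le> nth_prime N}"
      hence "p \<in> range nth_prime" by (simp add: range_nth_prime)
      then obtain i where i: "p = nth_prime i" by (rule rangeE)
      have "i \<le> N" using p i strict_mono_less_eq[OF strict_mono_nth_prime, of i N] by simp
      thus "p \<in> nth_prime ` {..<Suc N}" using i by simp
    qed
  qed
  moreover have "inj_on nth_prime {..<Suc N}"
    by (rule strict_mono_imp_inj_on[OF strict_mono_nth_prime])
  ultimately show ?thesis by (simp add: bij_betw_def)
qed

text \<open>The primes up to \<open>nth_prime N\<close> are the first N + 1, so the limit is taken
  along this subsequence and the index is shifted by one.\<close>

lemma has_mean_imp_nth_prime_limit:
  assumes "has_mean k r F l"
  shows "(\<lambda>N. (\<Sum>i<N. wfun k r (nth_prime i) * F (nth_prime i)) / (\<Sum>i<N. wfun k r (nth_prime i))) \<longlonglongrightarrow> l"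
proof -
  have s: "(\<Sum>p | prime p \<and> p \<le> nth_prime N. f p) = (\<Sum>i<Suc N. f (nth_prime i))" for N and f :: "nat \<Rightarrow> real"
    by (rule sum.reindex_bij_betw[OF bij_betw_nth_prime, symmetric])
  have "(\<lambda>N. (\<Sum>p | prime p \<and> p \<le> nth_prime N. wfun k r p * F p) / wsum k r (nth_prime N)) \<longlonglongrightarrow> l"
    using filterlim_compose[OF assms[unfolded has_mean_def] filterlim_subseq[OF strict_mono_nth_prime]] .
  thus ?thesis unfolding s wsum_def by (subst (asm) filterlim_sequentially_Suc)
qed

lemma prime_nth_prime: "prime (nth_prime i)"
proof -
  have "nth_prime i \<in> range nth_prime" by simp
  thus ?thesis by (simp add: range_nth_prime)
qed

lemma nth_prime_ge: "Suc i \<le> nth_prime i"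
proof (induction i)
  case 0
  show ?case using prime_gt_0_nat[OF prime_nth_prime[of 0]] by simp
next
  case (Suc i)
  have "nth_prime i < nth_prime (Suc i)" using strict_monoD[OF strict_mono_nth_prime, of i "Suc i"] by simp
  thus ?case using Suc by simp
qed

lemma convergent_prod_nth_prime:
  fixes E :: "nat \<Rightarrow> real"
  assumes "\<And>q. prime q \<Longrightarrow> \<bar>E q - 1\<bar> \<le> 2 / real q ^ 2"
  shows "convergent_prod (\<lambda>i. E (nth_prime i))"
proof -
  have "summable (\<lambda>i. 2 * inverse (real (Suc i) ^ 2))"
    by (intro summable_mult summable_Suc_iff[THEN iffD2] inverse_power_summable) simp
  hence "summable (\<lambda>i. norm (E (nth_prime i) - 1))"
  proof (rule summable_comparison_test')
    fix i :: nat
    have "\<bar>E (nth_prime i) - 1\<bar> \<le> 2 / real (nth_prime i) ^ 2" by (rule assms[OF prime_nth_prime])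
    also have "\<dots> \<le> 2 / real (Suc i) ^ 2"
      using nth_prime_ge[of i] by (intro divide_left_mono power_mono mult_pos_pos zero_less_power) auto
    finally show "norm (norm (E (nth_prime i) - 1)) \<le> 2 * inverse (real (Suc i) ^ 2)" by (simp add: divide_inverse)
  qed
  thus ?thesis
    by (intro abs_convergent_prod_imp_convergent_prod) (simp add: abs_convergent_prod_conv_summable)
qed

theorem (in local_factors) nth_prime_mean:
  assumes r: "r \<ge> 1" and E1: "\<And>q. prime q \<Longrightarrow> \<bar>E q - 1\<bar> \<le> 2 / real q ^ 2"
    and F: "\<And>p. prime p \<Longrightarrow> F p = (real p - 1) ^ r * (\<Prod>q\<in>prime_factors (p - 1). h q (multiplicity q (p - 1)))"
  shows "convergent_prod (\<lambda>i. E (nth_prime i)) \<and>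
    (\<lambda>N. (\<Sum>i<N. real (nth_prime i) ^ k * F (nth_prime i)) / (\<Sum>i<N. real (nth_prime i) ^ k * (real (nth_prime i) - 1) ^ r))
      \<longlonglongrightarrow> (\<Prod>i. E (nth_prime i))"
proof
  show conv: "convergent_prod (\<lambda>i. E (nth_prime i))" by (rule convergent_prod_nth_prime[OF E1])
  have "(\<lambda>Y. \<Prod>i<Suc Y. E (nth_prime i)) \<longlonglongrightarrow> (\<Prod>i. E (nth_prime i))"
    using convergent_prod_LIMSEQ[OF conv] unfolding lessThan_Suc_atMost .
  hence "(\<lambda>Y. \<Prod>i<Y. E (nth_prime i)) \<longlonglongrightarrow> (\<Prod>i. E (nth_prime i))" by (rule LIMSEQ_imp_Suc)
  from has_mean_imp_nth_prime_limit[OF has_mean_product[OF r this]]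
  show "(\<lambda>N. (\<Sum>i<N. real (nth_prime i) ^ k * F (nth_prime i)) / (\<Sum>i<N. real (nth_prime i) ^ k * (real (nth_prime i) - 1) ^ r))
      \<longlonglongrightarrow> (\<Prod>i. E (nth_prime i))"
    unfolding F[OF prime_nth_prime] wfun_def by (simp only: mult.assoc)
qed

section \<open>Local factors of Stephens' function\<close>

lemma prime_factors_prime_power_mult:
  assumes p: "prime (p::nat)" and m: "\<not> p dvd m" "m > 0" and a: "a > 0"
  shows "(\<Prod>q\<in>prime_factors (p ^ a * m). f q (multiplicity q (p ^ a * m))) =
    f p a * (\<Prod>q\<in>prime_factors m. f q (multiplicity q m) :: 'a :: comm_monoid_mult)"
proof -
  have p0: "p \<noteq> 0" "m \<noteq> 0" using p m by auto
  have "prime_factors (p ^ a * m) = insert p (prime_factors m)"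
    using p0 p a by (simp add: prime_factors_product prime_factors_power prime_prime_factors)
  moreover have "p \<notin> prime_factors m" using m by (simp add: prime_factors_dvd)
  moreover have "multiplicity p (p ^ a * m) = a" 
    using p p0 m by (simp add: prime_elem_multiplicity_mult_distrib not_dvd_imp_multiplicity_0)
  moreover have "multiplicity q (p ^ a * m) = multiplicity q m" if "q \<in> prime_factors m" for q
  proof -
    have q: "prime q" "q \<noteq> p" using that m by (auto simp: prime_factors_dvd)
    have "multiplicity q (p ^ a) = 0" using q p by (simp add: multiplicity_distinct_prime_power)
    thus ?thesis using q p0 by (simp add: prime_elem_multiplicity_mult_distrib)
  qed
  ultimately show ?thesis by simp
qed

text \<open>The factor (q^(2v + 1) + 1) / (q + 1) divided by q^(2v), written so that its limit q /
  (q + 1) for growing v is visible.\<close>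

definition stephens_local :: "nat \<Rightarrow> nat \<Rightarrow> real" where
  "stephens_local q v = (real q + 1 / real q ^ (2 * v)) / (real q + 1)"

lemma sum_prime_power_totient:
  assumes p: "prime p"
  shows "real (\<Sum>i\<le>a. p ^ i * totient (p ^ i)) = real (p ^ a) ^ 2 * stephens_local p a"
proof -
  have p1: "real p > 1" using prime_gt_1_nat[OF p] by simp
  have even: "real p ^ (2 * b) = real p ^ b * real p ^ b" for b by (simp add: mult_2 power_add)
  have "real (\<Sum>i\<le>a. p ^ i * totient (p ^ i)) * (real p + 1) = real p ^ (2 * a) * real p + 1"
  proof (induction a)
    case (Suc a)
    have t: "real (totient (p ^ Suc a)) = real p ^ a * (real p - 1)"
      using prime_gt_1_nat[OF p] by (simp add: totient_prime_power_Suc[OF p] of_nat_diff del: power_Suc)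
    have "real (\<Sum>i\<le>Suc a. p ^ i * totient (p ^ i)) * (real p + 1) =
      real (\<Sum>i\<le>a. p ^ i * totient (p ^ i)) * (real p + 1) + real p ^ Suc a * real (totient (p ^ Suc a)) * (real p + 1)"
      by (simp add: algebra_simps del: power_Suc)
    also have "\<dots> = real p ^ (2 * Suc a) * real p + 1"
      unfolding Suc t even by (simp add: algebra_simps)
    finally show ?case .
  qed simp
  hence "real (\<Sum>i\<le>a. p ^ i * totient (p ^ i)) = (real p ^ (2 * a) * real p + 1) / (real p + 1)"
    using p1 by (simp add: field_simps)
  also have "\<dots> = real (p ^ a) ^ 2 * stephens_local p a"
    unfolding stephens_local_def even using p1 by (simp add: power2_eq_square distrib_left)
  finally show ?thesis .
qed

text \<open>The function d totient(d) is multiplicative, so the induction splits off the full power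
  of one prime.\<close>

lemma sum_divisor_totient:
  "n > 0 \<Longrightarrow> real (\<Sum>d | d dvd n. d * totient d) = real n ^ 2 * (\<Prod>q\<in>prime_factors n. stephens_local q (multiplicity q n))"
proof (induction n rule: less_induct)
  case (less n)
  show ?case
  proof (cases "n = 1")
    case True
    thus ?thesis by simp
  next
    case False
    then obtain p where p: "prime p" "p dvd n" using prime_factor_nat by blast
    obtain a m where n: "n = p ^ a * m" "\<not> p dvd m"
      using multiplicity_decompose'[of n p] p less.prems by (metis not_prime_unit neq0_conv)
    have a: "a \<noteq> 0" using n p by (metis mult.left_neutral power_0)
    hence "p ^ a > 1" using prime_gt_1_nat[OF p(1)] one_less_power by blast
    hence m: "m < n" "m > 0" using n less.prems by auto
    have "(\<Sum>d | d dvd n. d * totient d) = (\<Sum>x\<in>{..a} \<times> {e. e dvd m}. (case x of (i, e) \<Rightarrow> p ^ i * e) * totient (case x of (i, e) \<Rightarrow> p ^ i * e))"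
      unfolding n(1) by (rule sum.reindex_bij_betw[OF divisors_prime_power_mult[OF p(1) n(2)], symmetric])
    also have "\<dots> = (\<Sum>(i, e)\<in>{..a} \<times> {e. e dvd m}. (p ^ i * totient (p ^ i)) * (e * totient e))"
    proof (intro sum.cong refl)
      fix x assume "x \<in> {..a} \<times> {e. e dvd m}"
      then obtain i e where x: "x = (i, e)" "e dvd m" by blast
      have "\<not> p dvd e" using n(2) x(2) dvd_trans by blast
      hence "coprime (p ^ i) e" using p(1) by (simp add: prime_imp_coprime)
      thus "(case x of (i, e) \<Rightarrow> p ^ i * e) * totient (case x of (i, e) \<Rightarrow> p ^ i * e) =
        (case x of (i, e) \<Rightarrow> (p ^ i * totient (p ^ i)) * (e * totient e))"
        unfolding x by (simp add: totient_mult_coprime)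
    qed
    also have "\<dots> = (\<Sum>i\<le>a. p ^ i * totient (p ^ i)) * (\<Sum>d | d dvd m. d * totient d)"
      by (simp add: sum_product sum.cartesian_product)
    finally have "real (\<Sum>d | d dvd n. d * totient d) = real (\<Sum>i\<le>a. p ^ i * totient (p ^ i)) * real (\<Sum>d | d dvd m. d * totient d)"
      by (simp only: of_nat_mult)
    also have "\<dots> = real n ^ 2 * (stephens_local p a * (\<Prod>q\<in>prime_factors m. stephens_local q (multiplicity q m)))"
      unfolding sum_prime_power_totient[OF p(1)] less.IH[OF m] n(1) by (simp add: power_mult_distrib)
    also have "stephens_local p a * (\<Prod>q\<in>prime_factors m. stephens_local q (multiplicity q m)) = (\<Prod>q\<in>prime_factors n. stephens_local q (multiplicity q n))"
      unfolding n(1) using prime_factors_prime_power_mult[OF p(1) n(2) m(2), of a stephens_local] a by simp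
    finally show ?thesis .
  qed
qed

lemma stephens_factor_bound:
  assumes q: "prime q"
  shows "\<bar>stephens_factor q - 1\<bar> \<le> 2 / real q ^ 2"
proof -
  define x where "x = real q"
  have x: "x \<ge> 2" using prime_ge_2_nat[OF q] by (simp add: x_def)
  have "x ^ 3 \<ge> 2 ^ 3" using x by (intro power_mono) auto
  hence "x / (x ^ 3 - 1) \<le> x / (x ^ 3 / 2)" using x by (intro divide_left_mono mult_pos_pos) auto
  also have "\<dots> = 2 / x ^ 2" using x by (simp add: power2_eq_square power3_eq_cube)
  finally have "x / (x ^ 3 - 1) \<le> 2 / x ^ 2" .
  moreover have "x / (x ^ 3 - 1) \<ge> 0" using x \<open>x ^ 3 \<ge> 2 ^ 3\<close> by simp
  ultimately have "\<bar>x / (x ^ 3 - 1)\<bar> \<le> 2 / x ^ 2" by linarith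
  thus ?thesis unfolding stephens_factor_def x_def by simp
qed

interpretation stephens: local_factors stephens_local stephens_factor
proof
  show "stephens_local q 0 = 1" for q by (simp add: stephens_local_def)
  fix q :: nat assume q: "prime q"
  define x where "x = real q"
  have x: "x > 1" using prime_gt_1_nat[OF q] by (simp add: x_def)
  have local_eq: "stephens_local q v = (x + (1 / x\<^sup>2) ^ v) / (x + 1)" for v
    by (simp add: stephens_local_def x_def power_mult power_divide)
  show "0 \<le> stephens_local q v \<and> stephens_local q v \<le> 1 \<and> 1 - stephens_local q v \<le> 1 / real q" for v
  proof -
    define t where "t = (1 / x\<^sup>2) ^ v"
    have "1 / x\<^sup>2 \<le> 1" using x by simp
    hence t: "0 \<le> t" "t \<le> 1" unfolding t_def by (simp, intro power_le_one) auto
    have "x * (1 - t) \<le> x * 1" using t x by (intro mult_left_mono) auto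
    hence "1 - (x + t) / (x + 1) \<le> 1 / x" using x t by (simp add: field_simps)
    thus ?thesis using x t unfolding local_eq t_def[symmetric] x_def[symmetric] by simp
  qed
  have "(\<lambda>v. (x + (1 / x\<^sup>2) ^ v) / (x + 1)) \<longlonglongrightarrow> (x + 0) / (x + 1)"
    using x by (intro tendsto_intros LIMSEQ_power_zero) auto
  thus "convergent (stephens_local q)" unfolding local_eq[abs_def] convergent_def by blast
  \<comment> \<open>After division by the totient the increments form a geometric series of ratio 1
    / q^3, which is where the denominator q^3 - 1 of the Stephens factor originates.\<close>
  have step: "increment (stephens_local q) (Suc i) / real (totient (q ^ Suc i)) = - (1 / x\<^sup>2) * (1 / x ^ 3) ^ i" for i
  proof -
    have "real (totient (q ^ Suc i)) = x ^ i * (x - 1)"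
      using prime_gt_1_nat[OF q] by (simp add: totient_prime_power_Suc[OF q] of_nat_diff x_def del: power_Suc)
    moreover have "increment (stephens_local q) (Suc i) = - (1 / x\<^sup>2) * (1 / x\<^sup>2) ^ i * (x - 1)"
    proof -
      have "increment (stephens_local q) (Suc i) = ((1 / x\<^sup>2) * (1 / x\<^sup>2) ^ i - (1 / x\<^sup>2) ^ i) / (x + 1)"
        unfolding increment_def local_eq by (simp add: diff_divide_distrib add_divide_distrib)
      also have "\<dots> = - (1 / x\<^sup>2) * (1 / x\<^sup>2) ^ i * ((x\<^sup>2 - 1) / (x + 1))"
      proof -
        define t where "t = (1 / x\<^sup>2) ^ i"
        have "(1 / x\<^sup>2) * t - t = - (1 / x\<^sup>2) * t * (x\<^sup>2 - 1)" using x by (simp add: field_simps)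
        thus ?thesis unfolding t_def by simp
      qed
      also have "(x\<^sup>2 - 1) / (x + 1) = x - 1" using x by (simp add: field_simps power2_eq_square)
      finally show ?thesis .
    qed
    moreover have "(1 / x\<^sup>2) ^ i = (1 / x ^ 3) ^ i * x ^ i"
      using x by (simp flip: power_mult_distrib add: power2_eq_square power3_eq_cube)
    ultimately show ?thesis using x by simp
  qed
  have x3: "x ^ 3 > 1" using x by (intro one_less_power) auto
  have "(\<lambda>i. (1 / x ^ 3) ^ i) sums (1 / (1 - 1 / x ^ 3))" using x3 x by (intro geometric_sums) simp
  hence "(\<lambda>i. - (1 / x\<^sup>2) * (1 / x ^ 3) ^ i) sums (- (1 / x\<^sup>2) * (1 / (1 - 1 / x ^ 3)))" by (rule sums_mult)
  hence "(\<lambda>j. increment (stephens_local q) j / real (totient (q ^ j))) sums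
    (- (1 / x\<^sup>2) * (1 / (1 - 1 / x ^ 3)) + increment (stephens_local q) 0 / real (totient (q ^ 0)))"
    unfolding step[symmetric] by (rule sums_Suc)
  moreover have "- (1 / x\<^sup>2) * (1 / (1 - 1 / x ^ 3)) + increment (stephens_local q) 0 / real (totient (q ^ 0)) = stephens_factor q"
  proof -
    have "(1 / x\<^sup>2) * (1 / (1 - 1 / x ^ 3)) = x / (x ^ 3 - 1)"
    proof -
      have "1 - 1 / x ^ 3 = (x ^ 3 - 1) / (x\<^sup>2 * x)" using x by (simp add: field_simps power2_eq_square power3_eq_cube)
      thus ?thesis using x x3 by simp
    qed
    thus ?thesis by (simp add: increment_def stephens_local_def stephens_factor_def x_def)
  qed
  ultimately show "(\<lambda>j. increment (stephens_local q) j / real (totient (q ^ j))) sums stephens_factor q" by simp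
qed

section \<open>Local factors of the Artin function of rank r, and conclusion\<close>

definition artin_local :: "nat \<Rightarrow> nat \<Rightarrow> nat \<Rightarrow> real" where
  "artin_local r q v = (if v = 0 then 1 else 1 - 1 / real q ^ r)"

lemma artin_fun_eq:
  assumes p: "prime p"
  shows "artin_fun r p = (real p - 1) ^ r * (\<Prod>q\<in>prime_factors (p - 1). artin_local r q (multiplicity q (p - 1)))"
proof -
  define n where "n = p - 1"
  have n: "n > 0" using prime_gt_1_nat[OF p] by (simp add: n_def)
  have "real n = (\<Prod>q\<in>prime_factors n. real q ^ multiplicity q n)"
    by (subst prime_factorization_nat[OF n]) simp
  hence "real n ^ r = (\<Prod>q\<in>prime_factors n. real q ^ (r * multiplicity q n))"
    by (simp add: prod_power_distrib power_mult[symmetric] mult.commute)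
  moreover have "real q ^ (r * multiplicity q n) - real q ^ (r * (multiplicity q n - 1)) =
    real q ^ (r * multiplicity q n) * artin_local r q (multiplicity q n)" if q: "q \<in> prime_factors n" for q
  proof -
    have "multiplicity q n > 0" using q by (simp add: prime_factors_multiplicity)
    then obtain v where v: "multiplicity q n = Suc v" using gr0_implies_Suc by blast
    have "q > 0" using q by (intro prime_gt_0_nat) auto
    thus ?thesis unfolding v by (simp add: artin_local_def power_add field_simps)
  qed
  ultimately have "artin_fun r p = real n ^ r * (\<Prod>q\<in>prime_factors n. artin_local r q (multiplicity q n))"
    unfolding artin_fun_def n_def[symmetric] by (simp add: prod.distrib)
  moreover have "real n = real p - 1" using prime_gt_1_nat[OF p] by (simp add: n_def of_nat_diff)
  ultimately show ?thesis by (simp add: n_def)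
qed

lemma artin_factor_bound:
  assumes q: "prime q" and r: "r \<ge> 1"
  shows "\<bar>artin_factor r q - 1\<bar> \<le> 2 / real q ^ 2"
proof -
  define x where "x = real q"
  have x: "x \<ge> 2" using prime_ge_2_nat[OF q] by (simp add: x_def)
  have "x * (x / 2) \<le> x ^ r * (x - 1)"
    using x r power_increasing[of 1 r x] by (intro mult_mono) auto
  hence "1 / (x ^ r * (x - 1)) \<le> 1 / (x * (x / 2))" using x by (intro divide_left_mono mult_pos_pos) auto
  also have "\<dots> = 2 / x ^ 2" by (simp add: power2_eq_square)
  finally have "1 / (x ^ r * (x - 1)) \<le> 2 / x ^ 2" .
  moreover have "1 / (x ^ r * (x - 1)) \<ge> 0" using x by simp
  ultimately show ?thesis by (simp add: artin_factor_def x_def)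
qed

lemma local_factors_artin:
  assumes r: "r \<ge> 1"
  shows "local_factors (artin_local r) (artin_factor r)"
proof
  show "artin_local r q 0 = 1" for q by (simp add: artin_local_def)
  fix q :: nat assume q: "prime q"
  have q1: "real q > 1" using prime_gt_1_nat[OF q] by simp
  have "real q ^ 1 \<le> real q ^ r" using q1 r by (intro power_increasing) auto
  hence qr: "1 / real q ^ r \<le> 1 / real q" using q1 by (intro divide_left_mono mult_pos_pos) auto
  have q2: "1 / real q \<le> 1" using q1 by simp
  have q3: "1 / real q ^ r \<ge> 0" using q1 by simp
  show "0 \<le> artin_local r q v \<and> artin_local r q v \<le> 1 \<and> 1 - artin_local r q v \<le> 1 / real q" for v
    using qr q2 q3 unfolding artin_local_def by (cases "v = 0") simp_all
  have "eventually (\<lambda>v. artin_local r q v = 1 - 1 / real q ^ r) sequentially"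
    using eventually_gt_at_top[of "0::nat"] by eventually_elim (simp add: artin_local_def)
  thus "convergent (artin_local r q)" unfolding convergent_def using tendsto_eventually by blast
  \<comment> \<open>The local factor is constant for v \<ge> 1, so only j = 0 and j = 1 contribute;
    the latter gives -1 / q^r divided by totient(q) = q - 1.\<close>
  have "(\<lambda>j. increment (artin_local r q) j / real (totient (q ^ j))) sums (\<Sum>j\<in>{0, 1::nat}. increment (artin_local r q) j / real (totient (q ^ j)))"
    by (rule sums_finite) (auto simp: increment_def artin_local_def)
  also have "(\<Sum>j\<in>{0, 1::nat}. increment (artin_local r q) j / real (totient (q ^ j))) = artin_factor r q"
    using q1 by (simp add: increment_def artin_local_def artin_factor_def totient_prime[OF q] of_nat_diff)
  finally show "(\<lambda>j. increment (artin_local r q) j / real (totient (q ^ j))) sums artin_factor r q" .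
qed

theorem theorem2:
  fixes k r :: nat
  assumes "r \<ge> 1"
  shows "(convergent_prod (\<lambda>i. stephens_factor (nth_prime i)) \<and>
          (\<lambda>N. (\<Sum>i<N. real (nth_prime i) ^ k * real (stephens_fun (nth_prime i)))
               / (\<Sum>i<N. real (nth_prime i) ^ k * (real (nth_prime i) - 1) ^ 2))
            \<longlonglongrightarrow> stephens_const) \<and>
         (convergent_prod (\<lambda>i. artin_factor r (nth_prime i)) \<and>
          (\<lambda>N. (\<Sum>i<N. real (nth_prime i) ^ k * artin_fun r (nth_prime i))
               / (\<Sum>i<N. real (nth_prime i) ^ k * (real (nth_prime i) - 1) ^ r))
            \<longlonglongrightarrow> artin_const r)"
proof
  have "real (stephens_fun p) = (real p - 1) ^ 2 * (\<Prod>q\<in>prime_factors (p - 1). stephens_local q (multiplicity q (p - 1)))"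
    if "prime p" for p
    using prime_gt_1_nat[OF that] sum_divisor_totient[of "p - 1"] by (simp add: stephens_fun_def of_nat_diff del: of_nat_sum)
  from stephens.nth_prime_mean[where r = 2 and k = k, OF _ stephens_factor_bound this]
  show "convergent_prod (\<lambda>i. stephens_factor (nth_prime i)) \<and>
          (\<lambda>N. (\<Sum>i<N. real (nth_prime i) ^ k * real (stephens_fun (nth_prime i)))
               / (\<Sum>i<N. real (nth_prime i) ^ k * (real (nth_prime i) - 1) ^ 2))
            \<longlonglongrightarrow> stephens_const"
    unfolding stephens_const_def by simp
  show "convergent_prod (\<lambda>i. artin_factor r (nth_prime i)) \<and>
          (\<lambda>N. (\<Sum>i<N. real (nth_prime i) ^ k * artin_fun r (nth_prime i))
               / (\<Sum>i<N. real (nth_prime i) ^ k * (real (nth_prime i) - 1) ^ r))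
            \<longlonglongrightarrow> artin_const r"
    unfolding artin_const_def
    by (rule local_factors.nth_prime_mean[OF local_factors_artin[OF assms] assms artin_factor_bound[OF _ assms] artin_fun_eq])
qed

end
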